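(* Let $p$ be an odd prime, let $m\ge 5$ be an odd integer, and let $k$ be a positive integer with $\gcd(m,k)=1$. For $\alpha,\beta,\gamma,\delta\in\mathbb{F}_{p^m}$ let $$S(\alpha,\beta,\gamma,\delta)=\sum_{x\in\mathbb{F}_{p^m}}\zeta_p^{\mathrm{Tr}(\alpha x^{p^{2k}+1}+\beta x^{p^k+1}+\gamma x^2+\delta x)}.$$ Let the integers $n_{\varepsilon,i}$ and $n_i$ ($\varepsilon=\pm1$, $0\le i\le 4$) be given by the explicit formulas in the context. Then, as $(\alpha,\beta,\gamma,\delta)$ runs through $\mathbb{F}_{p^m}^4$, the value distribution of $S(\alpha,\beta,\gamma,\delta)$ is as follows (frequency = number of quadruples), for $\varepsilon=\pm1$ and $j\in\mathbb{F}_p$: - for $i\in\{0,2,4\}$, the value $\varepsilon\zeta_p^j\sqrt{p^*}\,p^{\frac{m+i-1}{2}}$ occurs $n_{\varepsilon,i,j}$ times, where $$n_{\varepsilon,i,0}=p^{m-i-1}n_{\varepsilon,i},\qquad n_{\varepsilon,i,j}=\Big(p^{m-i-1}+\varepsilon\Big(\frac{-j}{p}\Big)p^{\frac{m-i-1}{2}}\Big)n_{\varepsilon,i}\quad (j\ne 0);$$ - for $i\in\{1,3\}$, the value $\varepsilon\zeta_p^j p^{\frac{m+i}{2}}$ occurs $n_{\varepsilon,i,j}$ times, where $$n_{\varepsilon,i,0}=\big(p^{m-i-1}+\varepsilon(p-1)p^{\frac{m-i-2}{2}}\big)n_{\varepsilon,i},\qquad n_{\varepsilon,i,j}=\big(p^{m-i-1}-\varepsilon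 p^{\frac{m-i-2}{2}}\big)n_{\varepsilon,i}\quad (j\neq 0);$$ - the value $0$ occurs $\omega$ times, where $$\omega=p^m-1+(p^m-p^{m-1})n_1+(p^m-p^{m-2})n_2+(p^m-p^{m-3})n_3+(p^m-p^{m-4})n_4;$$ - the value $p^m$ occurs once; and no other values occur.
   Context: $\mathrm{Tr}$ denotes the trace map from $\mathbb{F}_{p^m}$ to $\mathbb{F}_p$, $\zeta_p=e^{2\pi i/p}$, and $(\frac{\cdot}{p})$ is the Legendre symbol. Put $p^*=(-1)^{\frac{p-1}{2}}p$, with $\sqrt{p^*}=\sqrt p$ if $p\equiv 1\pmod 4$ and $\sqrt{p^*}=i\sqrt p$ if $p\equiv 3\pmod 4$. For $\varepsilon\in\{1,-1\}$ define $$n_{\varepsilon,1}=\frac{(p^{m+1}+\varepsilon p^{(m+3)/2})(p^{2m}-p^{2m-2}-p^{2m-3}+p^{m-2}+p^{m-3}-1)}{2(p^2-1)},$$ $$n_{\varepsilon,3}=\frac{(p^{m-3}+\varepsilon p^{(m-3)/2})(p^{m-1}-1)(p^m-1)}{2(p^2-1)},$$ $$n_{1,2}=n_{-1,2}=\frac{p^2(p^{m-1}-1)(p^{2m}-p^{2m-2}-p^{2m-3}+p^{m-2}+p^{m-3}-1)}{2(p^2-1)^2},$$ $$n_{1,4}=n_{-1,4}=\frac{(p^m-1)(p^{m-1}-1)(p^{m-3}-1)}{2(p^2-1)(p^4-1)},$$ $$n_{1,0}=n_{-1,0}=\tfrac12(p^m-1)(p^{2m}-p^{2m-1}+p^{2m-4}+p^m-p^{m-1}-p^{m-3}+1)-n_{1,2}-n_{1,4},$$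 and $n_i=n_{1,i}+n_{-1,i}$ for $0\le i\le 4$. *)

theory Defs
  imports "HOL-Analysis.Analysis" "HOL-Computational_Algebra.Polynomial" "HOL-Number_Theory.Residues"
begin

text \<open>
  A field with \<open>p ^ m\<close> elements is a type \<open>'a :: finite_field\<close> with \<open>CARD('a) = p ^ m\<close>;
  \<open>\<bbbF>\<^sub>p\<close> is represented by the residues \<open>{0..<p}\<close>, and sits inside \<open>'a\<close> as the image of
  \<^const>\<open>of_nat\<close>. The trace is written as the sum of the Galois conjugates, an element of \<open>'a\<close>
  that lies in this copy of \<open>\<bbbF>\<^sub>p\<close>.
\<close>

definition abs_trace :: "nat \<Rightarrow> nat \<Rightarrow> 'a::finite_field \<Rightarrow> 'a" where
  "abs_trace p m x = (\<Sum>i<m. x ^ (p ^ i))"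

definition residue_of :: "nat \<Rightarrow> 'a::finite_field \<Rightarrow> nat" where
  "residue_of p t = (THE j. j < p \<and> of_nat j = t)"

lemma abs_trace_ex1_residue:
  assumes p: "prime p" and card: "CARD('a::finite_field) = p ^ m"
  shows "\<exists>!j. j < p \<and> of_nat j = abs_trace p m (x :: 'a)"
proof -
  have "CHAR('a) dvd p ^ m" using CHAR_dvd_CARD[where 'a = 'a] card by simp
  hence "CHAR('a) dvd p"
    using CHAR_prime[where 'a = 'a] prime_dvd_power by blast
  hence char: "CHAR('a) = p"
    using p CHAR_prime[where 'a = 'a] primes_dvd_imp_eq by blast
  define t where "t = abs_trace p m x"
  define F :: "'a set" where "F = of_nat ` {..<p}"
  have inj: "inj_on (of_nat :: nat \<Rightarrow> 'a) {..<p}"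
    by (rule inj_onI) (auto simp: of_nat_eq_iff_cong_CHAR char cong_def)
  have cardF: "card F = p"
    unfolding F_def by (simp add: card_image inj)
  have frob_of_nat: "of_nat j ^ p = (of_nat j :: 'a)" for j
  proof -
    have "(\<Sum>i<j. 1 :: 'a) ^ p = (\<Sum>i<j. 1 ^ p)"
      by (rule freshmans_dream_sum) (use p char in auto)
    thus ?thesis by simp
  qed
  have "t ^ p = (\<Sum>i<m. (x ^ (p ^ i)) ^ p)"
    unfolding t_def abs_trace_def by (rule freshmans_dream_sum) (use p char in auto)
  also have "\<dots> = (\<Sum>i<m. x ^ (p ^ Suc i))"
    by (simp add: mult.commute flip: power_mult)
  also have "\<dots> = (\<Sum>i<Suc m. x ^ (p ^ i)) - x"
    by (subst sum.lessThan_Suc_shift) simp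
  also have "\<dots> = t"
    using finite_field_power_card_eq_same[of x] card by (simp add: t_def abs_trace_def)
  finally have tp: "t ^ p = t" .
  define P :: "'a poly" where "P = Polynomial.monom 1 p - Polynomial.monom 1 1"
  have "p > 1" using p prime_gt_1_nat by blast
  have degP: "Polynomial.degree P \<le> p"
    unfolding P_def by (intro degree_diff_le degree_monom_le) (use \<open>p > 1\<close> in \<open>auto intro: order.trans[OF degree_monom_le]\<close>)
  have "Polynomial.coeff P p = 1" using \<open>p > 1\<close> by (simp add: P_def)
  hence "P \<noteq> 0" by auto
  define R where "R = {z. poly P z = 0}"
  have R: "R = {z. z ^ p = z}" by (simp add: R_def P_def poly_monom)
  have "finite R" by simp
  moreover have "F \<subseteq> R" unfolding F_def R using frob_of_nat by auto
  moreover have "card R \<le> card F"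
    using card_poly_roots_bound[OF \<open>P \<noteq> 0\<close>] degP unfolding cardF R_def by linarith
  ultimately have "F = R" by (metis card_seteq)
  hence "t \<in> F" using tp R by auto
  then obtain j where "j < p" "of_nat j = t" unfolding F_def by auto
  thus ?thesis
    unfolding t_def[symmetric] using inj by (auto simp: inj_on_def)
qed

definition zeta :: "nat \<Rightarrow> complex" where
  "zeta p = exp (2 * of_real pi * \<i> / of_nat p)"

text \<open>The square root of \<open>p* = (-1) ^ ((p - 1) / 2) * p\<close>, for odd \<open>p\<close>.\<close>

definition sqrt_pstar :: "nat \<Rightarrow> complex" where
  "sqrt_pstar p = (if p mod 4 = 1 then of_real (sqrt (real p)) else \<i> * of_real (sqrt (real p)))"

definition exp_sum :: "nat \<Rightarrow> nat \<Rightarrow> nat \<Rightarrow> 'a::finite_field \<Rightarrow> 'a \<Rightarrow> 'a \<Rightarrow> 'a \<Rightarrow> complex" where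
  "exp_sum p m k \<alpha> \<beta> \<gamma> \<delta> =
     (\<Sum>x\<in>UNIV. zeta p ^ residue_of p (abs_trace p m
        (\<alpha> * x ^ (p ^ (2 * k) + 1) + \<beta> * x ^ (p ^ k + 1) + \<gamma> * x\<^sup>2 + \<delta> * x)))"

definition num_quadruples ::
  "('a::finite_field \<Rightarrow> 'a \<Rightarrow> 'a \<Rightarrow> 'a \<Rightarrow> complex) \<Rightarrow> complex \<Rightarrow> nat" where
  "num_quadruples S v = card {(\<alpha>, \<beta>, \<gamma>, \<delta>). S \<alpha> \<beta> \<gamma> \<delta> = v}"

text \<open>
  The numbers \<open>n\<^sub>\<epsilon>\<^sub>,\<^sub>i\<close>, as real numbers so that the division is exact. All differences and halves
  occurring in exponents are exact for odd \<open>m \<ge> 5\<close>.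
\<close>

definition n1 :: "nat \<Rightarrow> nat \<Rightarrow> int \<Rightarrow> real" where
  "n1 p m \<epsilon> =
     (real p ^ (m + 1) + of_int \<epsilon> * real p ^ ((m + 3) div 2))
     * (real p ^ (2 * m) - real p ^ (2 * m - 2) - real p ^ (2 * m - 3)
        + real p ^ (m - 2) + real p ^ (m - 3) - 1)
     / (2 * ((real p)\<^sup>2 - 1))"

definition n3 :: "nat \<Rightarrow> nat \<Rightarrow> int \<Rightarrow> real" where
  "n3 p m \<epsilon> =
     (real p ^ (m - 3) + of_int \<epsilon> * real p ^ ((m - 3) div 2))
     * (real p ^ (m - 1) - 1) * (real p ^ m - 1)
     / (2 * ((real p)\<^sup>2 - 1))"

definition n2 :: "nat \<Rightarrow> nat \<Rightarrow> real" where
  "n2 p m =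
     (real p)\<^sup>2 * (real p ^ (m - 1) - 1)
     * (real p ^ (2 * m) - real p ^ (2 * m - 2) - real p ^ (2 * m - 3)
        + real p ^ (m - 2) + real p ^ (m - 3) - 1)
     / (2 * ((real p)\<^sup>2 - 1)\<^sup>2)"

definition n4 :: "nat \<Rightarrow> nat \<Rightarrow> real" where
  "n4 p m =
     (real p ^ m - 1) * (real p ^ (m - 1) - 1) * (real p ^ (m - 3) - 1)
     / (2 * ((real p)\<^sup>2 - 1) * (real p ^ 4 - 1))"

definition n0 :: "nat \<Rightarrow> nat \<Rightarrow> real" where
  "n0 p m =
     1 / 2 * (real p ^ m - 1)
     * (real p ^ (2 * m) - real p ^ (2 * m - 1) + real p ^ (2 * m - 4)
        + real p ^ m - real p ^ (m - 1) - real p ^ (m - 3) + 1)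
     - n2 p m - n4 p m"

definition n_signed :: "nat \<Rightarrow> nat \<Rightarrow> int \<Rightarrow> nat \<Rightarrow> real" where
  "n_signed p m \<epsilon> i = [n0 p m, n1 p m \<epsilon>, n2 p m, n3 p m \<epsilon>, n4 p m] ! i"

definition n_total :: "nat \<Rightarrow> nat \<Rightarrow> nat \<Rightarrow> real" where
  "n_total p m i = n_signed p m 1 i + n_signed p m (-1) i"

text \<open>The frequencies \<open>n\<^sub>\<epsilon>\<^sub>,\<^sub>i\<^sub>,\<^sub>j\<close>, for even and for odd \<open>i\<close>.\<close>

definition freq_even :: "nat \<Rightarrow> nat \<Rightarrow> int \<Rightarrow> nat \<Rightarrow> nat \<Rightarrow> real" where
  "freq_even p m \<epsilon> i j =
     (if j = 0 then real p ^ (m - i - 1) * n_signed p m \<epsilon> i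
      else (real p ^ (m - i - 1)
            + of_int \<epsilon> * of_int (Legendre (- int j) (int p)) * real p ^ ((m - i - 1) div 2))
           * n_signed p m \<epsilon> i)"

definition freq_odd :: "nat \<Rightarrow> nat \<Rightarrow> int \<Rightarrow> nat \<Rightarrow> nat \<Rightarrow> real" where
  "freq_odd p m \<epsilon> i j =
     (if j = 0 then (real p ^ (m - i - 1) + of_int \<epsilon> * (real p - 1) * real p ^ ((m - i - 2) div 2))
                    * n_signed p m \<epsilon> i
      else (real p ^ (m - i - 1) - of_int \<epsilon> * real p ^ ((m - i - 2) div 2))
           * n_signed p m \<epsilon> i)"

definition freq_zero :: "nat \<Rightarrow> nat \<Rightarrow> real" where
  "freq_zero p m =
     real p ^ m - 1
     + (real p ^ m - real p ^ (m - 1)) * n_total p m 1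
     + (real p ^ m - real p ^ (m - 2)) * n_total p m 2
     + (real p ^ m - real p ^ (m - 3)) * n_total p m 3
     + (real p ^ m - real p ^ (m - 4)) * n_total p m 4"

definition value_even :: "nat \<Rightarrow> nat \<Rightarrow> int \<Rightarrow> nat \<Rightarrow> nat \<Rightarrow> complex" where
  "value_even p m \<epsilon> i j =
     of_int \<epsilon> * zeta p ^ j * sqrt_pstar p * of_nat p ^ ((m + i - 1) div 2)"

definition value_odd :: "nat \<Rightarrow> nat \<Rightarrow> int \<Rightarrow> nat \<Rightarrow> nat \<Rightarrow> complex" where
  "value_odd p m \<epsilon> i j = of_int \<epsilon> * zeta p ^ j * of_nat p ^ ((m + i) div 2)"

end

theory Submission
  imports Defs
begin

text \<open>
  Write \<open>\<sigma> x = x ^ p ^ k\<close>. For fixed \<open>(\<alpha>, \<beta>, \<gamma>) \<noteq> 0\<close> the quadratic form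
  \<open>Tr (\<alpha> x \<sigma>\<^sup>2 x + \<beta> x \<sigma> x + \<gamma> x\<^sup>2)\<close> has a radical cut out by a polynomial of degree 4 in \<open>\<sigma>\<close>, so
  its dimension \<open>i\<close> is at most 4. Orthogonal splitting turns the sum with \<open>\<delta> = 0\<close> into a product of
  Gauss sums, which leaves two possible values for each \<open>i\<close>; completing the square describes the
  distribution over \<open>\<delta>\<close>. Here the sign of the quadratic Gauss sum matters, and Gauss' own
  \<open>q\<close>-binomial argument provides it.

  The number of triples in each class is found from seven power moments. A moment counts the
  solutions of \<open>\<Sum> c\<^sub>i x\<^sub>i \<sigma>\<^sup>j x\<^sub>i = 0\<close> for \<open>j = 0, 1, 2\<close>, with at most four variables and coefficients
  \<open>c\<^sub>i\<close> in the prime field. A hyperbolic pair \<open>x\<^sup>2 - y\<^sup>2\<close> among the terms makes the count elementary: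
  after scaling one variable to 1, the equations say that \<open>\<sigma>\<close> fixes certain coordinates. Twisting one factor
  by a nonsquare separates even from odd rank, and the resulting linear system is of
  Vandermonde type.
\<close>

section \<open>The quadratic Gauss sum\<close>

text \<open>Five ranks and two signs give ten class sizes. Scaling by a nonsquare of the prime field
  exchanges the signs when the rank is odd, so seven unknowns remain: one for each of
  \<open>i\<close> = 0, 2, 4 and two for each of \<open>i\<close> = 1, 3. With T the sum at \<delta>
  = 0 and T' the sum of the form multiplied by -c for a nonsquare c, the seven equations are the
  sums over all triples of 1, T, |T|^2, T T', |T|^2 T, |T|^4 and |T|^2 T T'. Taking |T|^2 instead of
  T^2 guarantees a pair of terms with opposite signs, whether or not -1 is a square. The condition
  gcd(m, k) = 1 makes the prime field the fixed field of \<sigma>, so radicals are bounded by powers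
  of p rather than of p^k. Oddness of m keeps c a nonsquare in the whole field, so x^2 - c y^2 is
  anisotropic and the twisted counts collapse. The bound m \<ge> 5 gives i < m, which separates the
  value p^m of the zero triple from all others. The frequencies pair \<epsilon> with a Legendre
  symbol, so the opposite choice of \<open>sqrt_pstar\<close> would interchange different counts;
  this is why the modulus of the Gauss sum is not enough.\<close>

text \<open>Gaussian binomials through Pascal's rule. Being free of division, the identities below
  hold for every \<open>q\<close> in a commutative ring and can afterwards be evaluated at a root of
  unity.\<close>

fun qbinom :: "'a::comm_ring_1 \<Rightarrow> nat \<Rightarrow> nat \<Rightarrow> 'a" where
  "qbinom q n 0 = 1"
| "qbinom q 0 (Suc j) = 0"
| "qbinom q (Suc n) (Suc j) = qbinom q n j + q ^ Suc j * qbinom q n (Suc j)"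

lemma qbinom_eq_0: "n < j \<Longrightarrow> qbinom q n j = 0"
  by (induction q n j rule: qbinom.induct) auto

text \<open>The ratio identity \<open>qbinom_Suc_right\<close> and the absorption identity feed each
  other. This step from the former at \<open>n\<close> to the latter at \<open>Suc n\<close> is
  isolated because it is needed inside the induction and again after it.\<close>

lemma qbinom_absorb_aux:
  assumes "(1 - q ^ Suc j) * qbinom q n (Suc j) = (1 - q ^ (n - j)) * qbinom q n j" "j \<le> n"
  shows "(1 - q ^ Suc j) * qbinom q (Suc n) (Suc j) = (1 - q ^ Suc n) * qbinom q n j"
proof -
  have "(1 - q ^ Suc j) * qbinom q (Suc n) (Suc j)
      = (1 - q ^ Suc j) * qbinom q n j + q ^ Suc j * ((1 - q ^ Suc j) * qbinom q n (Suc j))"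
    by (simp add: algebra_simps)
  also have "\<dots> = (1 - q ^ Suc j * q ^ (n - j)) * qbinom q n j"
    by (subst assms(1)) (simp add: algebra_simps)
  also have "q ^ Suc j * q ^ (n - j) = q ^ Suc n"
    using assms(2) by (simp only: power_add[symmetric]) simp
  finally show ?thesis .
qed

lemma qbinom_Suc_right:
  "j \<le> n \<Longrightarrow> (1 - q ^ Suc j) * qbinom q n (Suc j) = (1 - q ^ (n - j)) * qbinom q n j"
proof (induction n arbitrary: j)
  case 0
  then show ?case by simp
next
  case (Suc n)
  note absorb = qbinom_absorb_aux[OF Suc.IH]
  show ?case
  proof (cases j)
    case 0
    then show ?thesis using absorb[of 0] by (simp del: power_Suc)
  next
    case (Suc i)
    then have i: "i \<le> n" using Suc.prems by simp
    have lhs: "(1 - q ^ Suc j) * qbinom q (Suc n) (Suc j) = (1 - q ^ Suc n) * qbinom q n j"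
    proof (cases "j \<le> n")
      case True
      then show ?thesis by (intro absorb)
    next
      case False
      then show ?thesis by (simp add: qbinom_eq_0)
    qed
    have "(1 - q ^ (n - i)) * qbinom q (Suc n) (Suc i)
        = (1 - q ^ (n - i)) * qbinom q n i + q ^ Suc i * (1 - q ^ (n - i)) * qbinom q n (Suc i)"
      by (simp add: algebra_simps)
    also have "(1 - q ^ (n - i)) * qbinom q n i = (1 - q ^ Suc i) * qbinom q n (Suc i)"
      by (rule Suc.IH[OF i, symmetric])
    also have "(1 - q ^ Suc i) * qbinom q n (Suc i) + q ^ Suc i * (1 - q ^ (n - i)) * qbinom q n (Suc i)
        = (1 - q ^ Suc i * q ^ (n - i)) * qbinom q n (Suc i)"
      by (simp add: algebra_simps)
    also have "q ^ Suc i * q ^ (n - i) = q ^ Suc n"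
      using i by (simp only: power_add[symmetric]) simp
    finally show ?thesis using lhs Suc by simp
  qed
qed

lemma qbinom_absorb:
  "(1 - q ^ Suc j) * qbinom q (Suc n) (Suc j) = (1 - q ^ Suc n) * qbinom q n j"
proof (cases "j \<le> n")
  case True
  then show ?thesis by (intro qbinom_absorb_aux qbinom_Suc_right)
qed (simp add: qbinom_eq_0)

text \<open>Pascal's rule and an index shift leave \<open>qbinom q (Suc n) (Suc j)\<close> with
  weight \<open>1 - q ^ Suc j\<close>; absorption replaces this by \<open>qbinom q n j\<close> with
  a weight that no longer depends on \<open>j\<close>.\<close>

lemma alternating_sum_qbinom_step:
  "(\<Sum>j\<le>Suc (Suc n). (- 1) ^ j * qbinom q (Suc (Suc n)) j)
    = (1 - q ^ Suc n) * (\<Sum>j\<le>n. (- 1) ^ j * qbinom q n j)"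
proof -
  have "(\<Sum>j\<le>Suc (Suc n). (- 1) ^ j * qbinom q (Suc (Suc n)) j)
      = 1 - (\<Sum>j\<le>Suc n. (- 1) ^ j * qbinom q (Suc n) j)
        - (\<Sum>j\<le>Suc n. (- 1) ^ j * (q ^ Suc j * qbinom q (Suc n) (Suc j)))"
    unfolding sum.atMost_Suc_shift[of _ "Suc n"]
    by (simp add: sum.distrib[symmetric] sum_negf[symmetric] algebra_simps flip: sum_subtractf del: sum.atMost_Suc)
  also have "(\<Sum>j\<le>Suc n. (- 1) ^ j * qbinom q (Suc n) j)
      = 1 - (\<Sum>j\<le>n. (- 1) ^ j * qbinom q (Suc n) (Suc j))"
    unfolding sum.atMost_Suc_shift by (simp add: sum_negf del: qbinom.simps(3))
  also have "(\<Sum>j\<le>Suc n. (- 1) ^ j * (q ^ Suc j * qbinom q (Suc n) (Suc j)))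
      = (\<Sum>j\<le>n. (- 1) ^ j * (q ^ Suc j * qbinom q (Suc n) (Suc j)))"
    by (simp add: qbinom_eq_0)
  also have "1 - (1 - (\<Sum>j\<le>n. (- 1) ^ j * qbinom q (Suc n) (Suc j)))
        - (\<Sum>j\<le>n. (- 1) ^ j * (q ^ Suc j * qbinom q (Suc n) (Suc j)))
      = (\<Sum>j\<le>n. (- 1) ^ j * ((1 - q ^ Suc j) * qbinom q (Suc n) (Suc j)))"
    by (simp add: left_diff_distrib right_diff_distrib sum_subtractf del: qbinom.simps(3))
  also have "\<dots> = (1 - q ^ Suc n) * (\<Sum>j\<le>n. (- 1) ^ j * qbinom q n j)"
    unfolding qbinom_absorb sum_distrib_left by (intro sum.cong) (simp_all add: mult_ac)
  finally show ?thesis .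
qed

lemma alternating_sum_qbinom:
  "(\<Sum>j\<le>2 * h. (- 1) ^ j * qbinom q (2 * h) j) = (\<Prod>i<h. 1 - q ^ (2 * i + 1))"
proof (induction h)
  case (Suc h)
  have "2 * Suc h = Suc (Suc (2 * h))" by simp
  then show ?case
    using Suc by (simp only: alternating_sum_qbinom_step) (simp add: mult.commute)
qed simp

text \<open>As \<open>q ^ Suc n = 1\<close>, the factor \<open>1 - q ^ (n - j)\<close> in
  \<open>qbinom_Suc_right\<close> is \<open>- (1 - q ^ Suc j)\<close> divided by
  \<open>q ^ Suc j\<close>. Primitivity allows cancelling \<open>1 - q ^ Suc j\<close>, so
  consecutive coefficients differ by a signed power of \<open>q\<close>.\<close>

lemma qbinom_root_of_unity:
  fixes q :: "'a::idom"
  assumes root: "q ^ Suc n = 1" and prim: "\<And>i. 0 < i \<Longrightarrow> i \<le> n \<Longrightarrow> q ^ i \<noteq> 1"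
  shows "j \<le> n \<Longrightarrow> (- 1) ^ j * q ^ (\<Sum>{..j}) * qbinom q n j = 1"
proof (induction j)
  case (Suc j)
  have "(1 - q ^ Suc j) * (q ^ Suc j * qbinom q n (Suc j))
      = q ^ Suc j * ((1 - q ^ Suc j) * qbinom q n (Suc j))" by (simp only: mult_ac)
  also have "\<dots> = (q ^ Suc j - q ^ (Suc j + (n - j))) * qbinom q n j"
    using Suc.prems by (subst qbinom_Suc_right) (simp_all only: power_add right_diff_distrib left_diff_distrib, simp_all)
  also have "Suc j + (n - j) = Suc n" using Suc.prems by simp
  finally have "(1 - q ^ Suc j) * (q ^ Suc j * qbinom q n (Suc j)) = (1 - q ^ Suc j) * - qbinom q n j"
    by (simp only: root) (simp add: algebra_simps)
  moreover have "1 - q ^ Suc j \<noteq> 0" using prim[of "Suc j"] Suc.prems by auto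
  ultimately have *: "q ^ Suc j * qbinom q n (Suc j) = - qbinom q n j"
    using mult_left_cancel by blast
  have "(- 1) ^ Suc j * q ^ (\<Sum>{..Suc j}) * qbinom q n (Suc j)
      = - ((- 1) ^ j * q ^ (\<Sum>{..j}) * (q ^ Suc j * qbinom q n (Suc j)))"
    by (simp add: power_add mult_ac)
  also have "\<dots> = 1" unfolding * using Suc by simp
  finally show ?case .
qed simp

section \<open>Product formula, modulus and sign of the Gauss sum\<close>

lemma zeta_power: "zeta p ^ n = exp (2 * of_real pi * \<i> * (of_nat n / of_nat p))"
  unfolding zeta_def by (simp flip: exp_of_nat_mult add: field_simps)

lemma zeta_power_eq_1_iff: "p > 0 \<Longrightarrow> zeta p ^ n = 1 \<longleftrightarrow> p dvd n"
  unfolding zeta_power using complex_root_unity_eq_1[of p n] by simp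

lemma norm_zeta [simp]: "norm (zeta p) = 1"
  unfolding zeta_def by (simp add: norm_exp_eq_Re)

lemma zeta_neq_0 [simp]: "zeta p \<noteq> 0"
  by (simp add: zeta_def)

lemma zeta_power_mod: "p > 0 \<Longrightarrow> zeta p ^ (n mod p) = zeta p ^ n"
proof -
  assume "p > 0"
  then have "zeta p ^ p = 1" by (simp add: zeta_power_eq_1_iff)
  then have "zeta p ^ (p * (n div p) + n mod p) = zeta p ^ (n mod p)"
    by (simp only: power_add power_mult) simp
  then show ?thesis by simp
qed

lemma sum_periodic_shift:
  fixes f :: "nat \<Rightarrow> 'a::ab_group_add"
  assumes "\<And>n. f (n + p) = f n"
  shows "(\<Sum>j<p. f (j + a)) = (\<Sum>j<p. f j)"
proof (induction a)
  case (Suc a)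
  have "(\<Sum>j<p. f (j + Suc a)) + f a = (\<Sum>j<Suc p. f (j + a))"
    by (simp only: sum.lessThan_Suc_shift) simp
  also have "\<dots> = (\<Sum>j<p. f (j + a)) + f a"
    using assms[of a] by (simp add: add.commute)
  finally show ?case using Suc by simp
qed simp

text \<open>At a suitable root of unity the terms of the alternating sum of Gaussian binomials
  become \<open>z ^ (j * (j + 1))\<close>. Completing the square makes this the Gauss sum, while the
  other side is already a product.\<close>

lemma quadratic_gauss_sum_prod:
  assumes "p = 2 * h + 1" "h > 0"
  shows "(\<Sum>t<p. zeta p ^ t\<^sup>2) = (\<Prod>i<h. zeta p ^ (2 * i + 1) - inverse (zeta p) ^ (2 * i + 1))"
proof -
  define z where "z = zeta p"
  define q where "q = inverse z ^ 2"
  have p: "p > 0" using assms by simp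
  have z0: "z \<noteq> 0" by (simp add: z_def)
  have z1: "z ^ n = 1 \<longleftrightarrow> p dvd n" for n using zeta_power_eq_1_iff[OF p] z_def by simp
  have odd: "coprime p 2" using assms by simp
  have qn: "q ^ n = 1 \<longleftrightarrow> p dvd n" for n
  proof -
    have "q ^ n = inverse (z ^ (2 * n))" by (simp add: q_def power_inverse power_mult)
    then have "q ^ n = 1 \<longleftrightarrow> p dvd 2 * n" using z1 by (simp add: inverse_eq_1_iff)
    then show ?thesis using odd by (simp add: coprime_dvd_mult_right_iff)
  qed
  have q0: "q \<noteq> 0" by (simp add: q_def z0)
  have G: "(- 1) ^ j * qbinom q (2 * h) j = z ^ (j * (j + 1))" if "j \<le> 2 * h" for j
  proof -
    have "\<Sum>{..j} = j * (j + 1) div 2"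
      by (metis Sum_Icc_nat atLeast0AtMost mult_zero_left diff_zero)
    then have "2 * \<Sum>{..j} = j * (j + 1)" by simp
    then have e: "q ^ (\<Sum>{..j}) = inverse (z ^ (j * (j + 1)))"
      by (simp add: q_def power_inverse flip: power_mult)
    have "(- 1) ^ j * q ^ (\<Sum>{..j}) * qbinom q (2 * h) j = 1"
    proof (rule qbinom_root_of_unity)
      show "q ^ Suc (2 * h) = 1" using qn[of "Suc (2*h)"] assms by simp
      show "q ^ i \<noteq> 1" if "0 < i" "i \<le> 2 * h" for i
        using qn[of i] that assms by (auto dest: dvd_imp_le)
    qed (use that in auto)
    then show ?thesis unfolding e using z0 by (simp add: field_simps)
  qed
  \<comment> \<open>\<open>h + 1\<close> is the inverse of 2 modulo \<open>p\<close>, so this shift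
    completes the square \<open>j * (j + 1)\<close>.\<close>
  have "(\<Sum>t<p. z ^ t\<^sup>2) = (\<Sum>t<p. z ^ (t + (h + 1))\<^sup>2)"
  proof (rule sum_periodic_shift[symmetric])
    fix n
    have "(n + p)\<^sup>2 = n\<^sup>2 + p * (2 * n + p)" by (simp add: power2_eq_square algebra_simps)
    then show "z ^ (n + p)\<^sup>2 = z ^ n\<^sup>2" using z1[of "p * (2 * n + p)"] by (simp add: power_add)
  qed
  also have "\<dots> = (\<Sum>j\<le>2 * h. z ^ (h + 1)\<^sup>2 * z ^ (j * (j + 1)))"
  proof (rule sum.cong)
    show "{..<p} = {..2 * h}" using assms by auto
    fix j
    have "(j + (h + 1))\<^sup>2 = p * j + ((h + 1)\<^sup>2 + j * (j + 1))"
      using assms by (simp add: power2_eq_square algebra_simps)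
    then show "z ^ (j + (h + 1))\<^sup>2 = z ^ (h + 1)\<^sup>2 * z ^ (j * (j + 1))"
      using z1[of "p * j"] by (simp add: power_add)
  qed
  also have "\<dots> = z ^ (h + 1)\<^sup>2 * (\<Sum>j\<le>2 * h. (- 1) ^ j * qbinom q (2 * h) j)"
    using G by (simp add: sum_distrib_left)
  also have "\<dots> = z ^ (h + 1)\<^sup>2 * (\<Prod>i<h. 1 - q ^ (2 * i + 1))"
    by (simp only: alternating_sum_qbinom)
  \<comment> \<open>\<open>(h + 1)^2 = h^2 + p\<close> and \<open>h^2\<close> is the sum of the
    first \<open>h\<close> odd numbers, so the prefactor can be distributed over the
    product.\<close>
  also have "z ^ (h + 1)\<^sup>2 = z ^ (\<Sum>i<h. 2 * i + 1)"
  proof -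
    have "(\<Sum>i<h. 2 * i + 1) = h\<^sup>2" by (induction h) (auto simp: power2_eq_square)
    moreover have "(h + 1)\<^sup>2 = h\<^sup>2 + p" using assms by (simp add: power2_eq_square)
    ultimately show ?thesis using z1[of p] by (simp add: power_add)
  qed
  also have "z ^ (\<Sum>i<h. 2 * i + 1) = (\<Prod>i<h. z ^ (2 * i + 1))"
    by (simp only: power_sum)
  also have "(\<Prod>i<h. z ^ (2 * i + 1)) * (\<Prod>i<h. 1 - q ^ (2 * i + 1))
      = (\<Prod>i<h. z ^ (2 * i + 1) - inverse z ^ (2 * i + 1))"
    unfolding prod.distrib[symmetric]
  proof (rule prod.cong)
    fix i
    have "z ^ n * (1 - q ^ n) = z ^ n - inverse z ^ n" for n
    proof -
      have "q ^ n = inverse z ^ n * inverse z ^ n"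
        by (simp add: q_def power2_eq_square power_mult_distrib)
      moreover have "z ^ n * inverse z ^ n = 1" using z0 by (simp flip: power_mult_distrib)
      ultimately show ?thesis by (simp add: algebra_simps)
    qed
    then show "z ^ (2 * i + 1) * (1 - q ^ (2 * i + 1)) = z ^ (2 * i + 1) - inverse z ^ (2 * i + 1)" .
  qed simp
  finally show ?thesis by (simp add: z_def)
qed

text \<open>Replacing \<open>s\<close> by \<open>s + t\<close> in the double sum cancels the square
  of \<open>t\<close> and leaves a geometric sum over \<open>t\<close>, which vanishes unless
  \<open>s = 0\<close>.\<close>

lemma norm_quadratic_gauss_sum:
  assumes "odd p"
  shows "(\<Sum>t<p. zeta p ^ t\<^sup>2) * cnj (\<Sum>t<p. zeta p ^ t\<^sup>2) = of_nat p"
proof -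
  define z where "z = zeta p"
  have p: "p > 0" using assms by (simp add: odd_pos)
  have z1: "z ^ n = 1 \<longleftrightarrow> p dvd n" for n using zeta_power_eq_1_iff[OF p] z_def by simp
  have zc: "z ^ n * cnj (z ^ n) = 1" for n
    unfolding complex_norm_square[symmetric] by (simp add: z_def norm_power)
  have shift: "(\<Sum>s<p. z ^ s\<^sup>2) = (\<Sum>s<p. z ^ (s + t)\<^sup>2)" for t
  proof (rule sum_periodic_shift[symmetric])
    fix n
    have "(n + p)\<^sup>2 = n\<^sup>2 + p * (2 * n + p)" by (simp add: power2_eq_square algebra_simps)
    then show "z ^ (n + p)\<^sup>2 = z ^ n\<^sup>2" using z1[of "p * (2 * n + p)"] by (simp add: power_add)
  qed
  have geo: "(\<Sum>t<p. (z ^ (2 * s)) ^ t) = (if s = 0 then of_nat p else 0)" if "s < p" for s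
  proof (cases "s = 0")
    case False
    have "coprime p 2" using assms by simp
    then have "\<not> p dvd 2 * s" using that False by (auto simp: coprime_dvd_mult_right_iff dest: dvd_imp_le)
    then have "z ^ (2 * s) \<noteq> 1" using z1 by simp
    moreover have "(z ^ (2 * s)) ^ p = 1" unfolding power_mult[symmetric] z1 by simp
    ultimately show ?thesis using False by (simp add: sum_gp_strict)
  qed simp
  have "(\<Sum>s<p. z ^ s\<^sup>2) * cnj (\<Sum>t<p. z ^ t\<^sup>2) = (\<Sum>t<p. (\<Sum>s<p. z ^ s\<^sup>2) * cnj (z ^ t\<^sup>2))"
    by (simp add: sum_distrib_left)
  also have "\<dots> = (\<Sum>t<p. \<Sum>s<p. z ^ s\<^sup>2 * (z ^ (2 * s)) ^ t)"
  proof (rule sum.cong)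
    fix t
    have "z ^ (s + t)\<^sup>2 * cnj (z ^ t\<^sup>2) = z ^ s\<^sup>2 * (z ^ (2 * s)) ^ t" for s
    proof -
      have "z ^ (s + t)\<^sup>2 = z ^ s\<^sup>2 * (z ^ (2 * s)) ^ t * z ^ t\<^sup>2"
        by (simp add: power2_sum power_add mult_ac flip: power_mult)
      then show ?thesis using zc[of "t\<^sup>2"] by (simp add: mult.assoc)
    qed
    then show "(\<Sum>s<p. z ^ s\<^sup>2) * cnj (z ^ t\<^sup>2) = (\<Sum>s<p. z ^ s\<^sup>2 * (z ^ (2 * s)) ^ t)"
      unfolding shift[of t] sum_distrib_right by simp
  qed simp
  also have "\<dots> = (\<Sum>s<p. z ^ s\<^sup>2 * (\<Sum>t<p. (z ^ (2 * s)) ^ t))"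
    by (subst sum.swap) (simp add: sum_distrib_left)
  also have "\<dots> = (\<Sum>s<p. if s = 0 then of_nat p else 0)"
    using geo by (intro sum.cong) auto
  also have "\<dots> = of_nat p" using p by simp
  finally show ?thesis by (simp add: z_def)
qed

text \<open>The product formula supplies only the argument: each factor is \<open>2 * \<i>\<close>
  times a sine of known sign. The modulus comes from
  \<open>norm_quadratic_gauss_sum\<close>.\<close>

theorem quadratic_gauss_sum:
  assumes "odd p" "p > 1"
  shows "(\<Sum>t<p. zeta p ^ t\<^sup>2) = sqrt_pstar p"
proof -
  obtain h where h: "p = 2 * h + 1" using assms(1) oddE by blast
  then have h0: "h > 0" using assms(2) by simp
  \<comment> \<open>The number of negative sines: \<open>s i < 0\<close> means
    \<open>4 * i + 2 > p\<close>, true for the last \<open>h div 2\<close> indices.\<close>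
  define t where "t = h div 2"
  define s where "s i = sin (2 * pi * (2 * real i + 1) / real p)" for i
  define P where "P = (\<Prod>i<h. s i)"
  have fac: "zeta p ^ n - inverse (zeta p) ^ n = 2 * \<i> * of_real (sin (2 * pi * real n / real p))" for n
  proof -
    have "zeta p ^ n = cis (2 * pi * real n / real p)"
      by (simp add: zeta_power cis_conv_exp mult_ac)
    moreover have "inverse (zeta p) ^ n = cis (- (2 * pi * real n / real p))"
      using calculation by (metis cis_inverse power_inverse)
    ultimately show ?thesis by (simp add: complex_eq_iff)
  qed
  have g: "(\<Sum>t<p. zeta p ^ t\<^sup>2) = (2 * \<i>) ^ h * of_real P"
    unfolding quadratic_gauss_sum_prod[OF h h0] fac P_def s_def
    by (simp add: prod.distrib algebra_simps)
  have sgn: "sgn (s i) = (if i < h - t then 1 else - 1)" if "i < h" for i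
  proof -
    have p0: "real p > 0" using h by simp
    have a: "2 * pi * (2 * real i + 1) / real p = pi * ((4 * real i + 2) / real p)"
      by (simp add: field_simps)
    show ?thesis
    proof (cases "i < h - t")
      case True
      then have "4 * i + 2 < p" using h t_def by presburger
      then have "(4 * real i + 2) / real p < 1" "(4 * real i + 2) / real p > 0"
        using p0 by (simp_all add: field_simps)
      then have "sin (pi * ((4 * real i + 2) / real p)) > 0"
        by (intro sin_gt_zero mult_pos_pos) (auto simp del: times_divide_eq_right)
      then show ?thesis using True by (simp add: s_def a)
    next
      case False
      have "4 * i + 2 > p" using False h t_def by presburger
      moreover have "4 * i + 2 < 2 * p" using that h by simp
      ultimately have "(4 * real i + 2) / real p > 1" "(4 * real i + 2) / real p < 2"
        using p0 by (simp_all add: field_simps)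
      then have "sin (pi * ((4 * real i + 2) / real p)) < 0"
        by (intro sin_lt_zero) (auto simp del: times_divide_eq_right)
      then show ?thesis using False by (simp add: s_def a)
    qed
  qed
  have "sgn P = (\<Prod>i<h. if i < h - t then 1 else - 1)"
  proof -
    have "sgn (prod s A) = (\<Prod>i\<in>A. sgn (s i))" for A
      by (induction A rule: infinite_finite_induct) (auto simp: sgn_mult)
    then show ?thesis unfolding P_def using sgn by simp
  qed
  also have "\<dots> = (\<Prod>i\<in>{h - t..<h}. - 1)"
    by (rule prod.mono_neutral_cong_right) auto
  also have "\<dots> = (- 1) ^ t" by (simp add: t_def)
  finally have P: "P = (- 1) ^ t * \<bar>P\<bar>" using sgn_mult_abs[of P] by simp
  \<comment> \<open>The sign \<open>(- 1) ^ t\<close> cancels the complete squares of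
    \<open>\<i>\<close>; what is left depends on the parity of \<open>h\<close>, that is, on
    \<open>p\<close> modulo 4.\<close>
  have ih: "\<i> ^ h * (- 1) ^ t = \<i> ^ (h mod 2)"
  proof -
    have "\<i> ^ h = \<i> ^ (2 * t + h mod 2)" by (simp add: t_def)
    also have "\<dots> = (- 1) ^ t * \<i> ^ (h mod 2)" by (simp add: power_add power_mult)
    finally show ?thesis by (simp flip: power_mult_distrib)
  qed
  define c where "c = 2 ^ h * \<bar>P\<bar>"
  have "(\<Sum>t<p. zeta p ^ t\<^sup>2) = 2 ^ h * \<i> ^ h * of_real ((- 1) ^ t * \<bar>P\<bar>)"
    unfolding g by (subst P) (simp add: power_mult_distrib)
  also have "\<dots> = (\<i> ^ h * (- 1) ^ t) * of_real c" by (simp add: c_def)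
  finally have gc: "(\<Sum>t<p. zeta p ^ t\<^sup>2) = \<i> ^ (h mod 2) * of_real c" unfolding ih .
  have "of_real (c\<^sup>2) = (\<i> ^ (h mod 2) * of_real c) * cnj (\<i> ^ (h mod 2) * of_real c)"
    by (cases "odd h") (simp_all add: mod_2_eq_odd power2_eq_square complex_eq_iff)
  also have "\<dots> = of_nat p"
    using norm_quadratic_gauss_sum[OF assms(1)] unfolding gc .
  finally have "c\<^sup>2 = real p" by (metis of_real_eq_iff of_real_of_nat_eq)
  moreover have "c \<ge> 0" by (simp add: c_def)
  ultimately have c: "c = sqrt (real p)" by (metis real_sqrt_unique)
  have "p mod 4 = 1 \<longleftrightarrow> h mod 2 = 0" using h by presburger
  then show ?thesis unfolding gc c sqrt_pstar_def by (auto simp: mod_2_eq_odd)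
qed

section \<open>Characters of a finite field\<close>

locale prime_power_field =
  fixes p m :: nat and ty :: "'a::finite_field itself"
  assumes prime_p: "prime p" and card_field: "CARD('a) = p ^ m"
begin

lemma p_gt_1: "p > 1"
  using prime_p prime_gt_1_nat by blast

lemma CHAR_field: "CHAR('a) = p"
proof -
  have "CHAR('a) dvd p ^ m" using CHAR_dvd_CARD[where 'a = 'a] card_field by simp
  then have "CHAR('a) dvd p"
    using CHAR_prime[where 'a = 'a] prime_dvd_power by blast
  then show ?thesis
    using prime_p CHAR_prime[where 'a = 'a] primes_dvd_imp_eq by blast
qed

lemma m_pos: "m > 0"
proof (rule ccontr)
  assume "\<not> m > 0"
  then have "CARD('a) = 1" using card_field by simp
  moreover have "card {0, 1 :: 'a} \<le> CARD('a)" by (rule card_mono) auto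
  ultimately show False by simp
qed

lemma frobenius_add: "(x + y :: 'a) ^ p ^ n = x ^ p ^ n + y ^ p ^ n"
  by (rule freshmans_dream') (simp_all add: CHAR_field prime_p)

lemma frobenius_sum: "(sum f A :: 'a) ^ p ^ n = (\<Sum>i\<in>A. f i ^ p ^ n)"
  by (rule freshmans_dream_sum') (simp_all add: CHAR_field prime_p)

lemma frobenius_minus: "(- x :: 'a) ^ p ^ n = - (x ^ p ^ n)"
proof -
  have "(x + - x) ^ p ^ n = 0" using p_gt_1 by (simp add: power_0_left)
  then show ?thesis unfolding frobenius_add by (metis add.commute eq_neg_iff_add_eq_0)
qed

lemma frobenius_diff: "(x - y :: 'a) ^ p ^ n = x ^ p ^ n - y ^ p ^ n"
  using frobenius_add[of x "- y" n] by (simp add: frobenius_minus)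

text \<open>Taking the fixed points of the Frobenius map makes closure under the field operations
  immediate and fits the later test \<open>sig x = x\<close>. \<open>prime_field_eq\<close> recovers
  the description by residues.\<close>

definition prime_field :: "'a set" where
  "prime_field = {z. z ^ p = z}"

lemma prime_field_power: "z \<in> prime_field \<Longrightarrow> z ^ p ^ n = z"
  by (induction n) (auto simp: prime_field_def power_mult)

lemma prime_field_0 [simp]: "0 \<in> prime_field"
  and prime_field_1 [simp]: "1 \<in> prime_field"
  using p_gt_1 by (auto simp: prime_field_def)

lemma prime_field_add [simp]: "a \<in> prime_field \<Longrightarrow> b \<in> prime_field \<Longrightarrow> a + b \<in> prime_field"
  using frobenius_add[of a b 1] by (simp add: prime_field_def)

lemma prime_field_diff [simp]: "a \<in> prime_field \<Longrightarrow> b \<in> prime_field \<Longrightarrow> a - b \<in> prime_field"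
  using frobenius_diff[of a b 1] by (simp add: prime_field_def)

lemma prime_field_minus [simp]: "a \<in> prime_field \<Longrightarrow> - a \<in> prime_field"
  using prime_field_diff[of 0 a] by simp

lemma prime_field_mult [simp]: "a \<in> prime_field \<Longrightarrow> b \<in> prime_field \<Longrightarrow> a * b \<in> prime_field"
  and prime_field_divide [simp]: "a \<in> prime_field \<Longrightarrow> b \<in> prime_field \<Longrightarrow> a / b \<in> prime_field"
  by (auto simp: prime_field_def power_mult_distrib power_divide)

lemma prime_field_pow [simp]: "a \<in> prime_field \<Longrightarrow> a ^ n \<in> prime_field"
  by (induction n) auto

lemma prime_field_of_nat [simp]: "of_nat n \<in> prime_field"
  by (induction n) auto

lemma inj_on_of_nat: "inj_on (of_nat :: nat \<Rightarrow> 'a) {..<p}"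
  by (rule inj_onI) (auto simp: of_nat_eq_iff_cong_CHAR CHAR_field cong_def)

lemma prime_field_eq: "prime_field = of_nat ` {..<p}"
proof -
  define P :: "'a poly" where "P = Polynomial.monom 1 p - Polynomial.monom 1 1"
  have degP: "Polynomial.degree P \<le> p"
    unfolding P_def
    by (intro degree_diff_le degree_monom_le)
      (use p_gt_1 in \<open>auto intro: order.trans[OF degree_monom_le]\<close>)
  have "Polynomial.coeff P p = 1" using p_gt_1 by (simp add: P_def)
  then have "P \<noteq> 0" by auto
  have R: "prime_field = {z. poly P z = 0}"
    by (simp add: prime_field_def P_def poly_monom)
  have "card prime_field \<le> p"
    unfolding R using card_poly_roots_bound[OF \<open>P \<noteq> 0\<close>] degP by linarith
  also have "p = card (of_nat ` {..<p} :: 'a set)"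
    by (simp add: card_image inj_on_of_nat)
  finally show ?thesis
    by (intro card_seteq[symmetric]) auto
qed

lemma card_prime_field: "card prime_field = p"
  by (simp add: prime_field_eq card_image inj_on_of_nat)

lemma residue_of_of_nat: "residue_of p (of_nat n :: 'a) = n mod p"
  unfolding residue_of_def
proof (rule the_equality)
  show "n mod p < p \<and> of_nat (n mod p) = (of_nat n :: 'a)"
    using p_gt_1 by (simp add: of_nat_eq_iff_cong_CHAR CHAR_field)
  show "j = n mod p" if "j < p \<and> of_nat j = (of_nat n :: 'a)" for j
    using that by (auto simp: of_nat_eq_iff_cong_CHAR CHAR_field cong_def)
qed

section \<open>Additive characters and the trace\<close>

definition add_char :: "'a \<Rightarrow> complex" where
  "add_char z = zeta p ^ residue_of p z"

lemma add_char_of_nat: "add_char (of_nat n) = zeta p ^ n"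
  using p_gt_1 by (simp add: add_char_def residue_of_of_nat zeta_power_mod)

lemma add_char_0 [simp]: "add_char 0 = 1"
  using add_char_of_nat[of 0] by simp

lemma add_char_add:
  assumes "a \<in> prime_field" "b \<in> prime_field"
  shows "add_char (a + b) = add_char a * add_char b"
proof -
  from assms obtain i j where ij: "a = of_nat i" "b = of_nat j" by (auto simp: prime_field_eq)
  then have "a + b = of_nat (i + j)" by simp
  then show ?thesis by (simp only: add_char_of_nat ij power_add)
qed

lemma norm_add_char [simp]: "norm (add_char z) = 1"
  by (simp add: add_char_def norm_power)

lemma add_char_minus:
  assumes "a \<in> prime_field" shows "add_char (- a) = cnj (add_char a)"
proof -
  have "add_char a * add_char (- a) = 1"
    using add_char_add[of a "- a"] assms by simp
  moreover have "add_char a * cnj (add_char a) = 1"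
    by (simp flip: complex_norm_square)
  ultimately show ?thesis
    by (metis mult_left_cancel mult_zero_left zero_neq_one)
qed

lemma add_char_diff:
  "a \<in> prime_field \<Longrightarrow> b \<in> prime_field \<Longrightarrow> add_char (a - b) = add_char a * cnj (add_char b)"
  using add_char_add[of a "- b"] by (simp add: add_char_minus)

lemma add_char_eq_1_iff: "a \<in> prime_field \<Longrightarrow> add_char a = 1 \<longleftrightarrow> a = 0"
  using p_gt_1
  by (auto simp: prime_field_eq add_char_of_nat zeta_power_eq_1_iff of_nat_eq_0_iff_char_dvd CHAR_field)

lemma add_char_inj:
  assumes "a \<in> prime_field" "b \<in> prime_field" "add_char a = add_char b" shows "a = b"
proof -
  have "add_char (a - b) = 1"
    using assms by (simp add: add_char_diff flip: complex_norm_square)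
  then show ?thesis using assms by (simp add: add_char_eq_1_iff)
qed

lemma sum_add_char:
  assumes z: "z \<in> prime_field"
  shows "(\<Sum>t\<in>prime_field. add_char (t * z)) = (if z = 0 then of_nat p else 0)"
proof (cases "z = 0")
  case False
  have "(\<Sum>t\<in>prime_field. add_char (t * z)) = (\<Sum>t\<in>prime_field. add_char ((t + 1) * z))"
    by (rule sum.reindex_bij_witness[of _ "\<lambda>t. t + 1" "\<lambda>t. t - 1"]) auto
  also have "\<dots> = (\<Sum>t\<in>prime_field. add_char (t * z)) * add_char z"
    unfolding sum_distrib_right
    by (intro sum.cong) (auto simp: distrib_right add_char_add z)
  finally show ?thesis
    using False z add_char_eq_1_iff[OF z] by simp
qed (simp add: card_prime_field)

abbreviation tr :: "'a \<Rightarrow> 'a" where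
  "tr \<equiv> abs_trace p m"

lemma tr_in_prime_field [simp]: "tr x \<in> prime_field"
proof -
  obtain j where "j < p" "of_nat j = tr x"
    using abs_trace_ex1_residue[OF prime_p card_field, of x] by blast
  then show ?thesis unfolding prime_field_eq by (metis imageI lessThan_iff)
qed

lemma tr_add: "tr (x + y) = tr x + tr y"
  by (simp add: abs_trace_def frobenius_add sum.distrib)

lemma tr_minus: "tr (- x) = - tr x"
  by (simp add: abs_trace_def frobenius_minus sum_negf)

lemma tr_diff: "tr (x - y) = tr x - tr y"
  using tr_add[of x "- y"] by (simp add: tr_minus)

lemma tr_0 [simp]: "tr 0 = 0"
  using tr_add[of 0 0] by (simp only: add_0_left add_cancel_right_left)

lemma tr_scale: "c \<in> prime_field \<Longrightarrow> tr (c * x) = c * tr x"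
  by (simp add: abs_trace_def power_mult_distrib prime_field_power sum_distrib_left)

lemma tr_frobenius: "tr (x ^ p ^ n) = tr x"
proof -
  have "tr (x ^ p ^ n) = tr x ^ p ^ n"
    by (simp add: abs_trace_def frobenius_sum mult.commute flip: power_mult)
  then show ?thesis by (simp add: prime_field_power)
qed

text \<open>The trace is a polynomial of degree at most \<open>p ^ (m - 1)\<close> with linear
  coefficient 1, so it has fewer roots than the field has elements.\<close>

lemma tr_nontrivial: "\<exists>x. tr x \<noteq> 0"
proof (rule ccontr)
  assume "\<not> ?thesis"
  then have tr0: "tr x = 0" for x by blast
  define P :: "'a poly" where "P = (\<Sum>i<m. Polynomial.monom 1 (p ^ i))"
  have "Polynomial.coeff P 1 = (\<Sum>i<m. if i = 0 then 1 else 0)"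
    unfolding P_def coeff_sum using p_gt_1 by (intro sum.cong) auto
  then have "P \<noteq> 0" using m_pos by auto
  have "degree P \<le> p ^ (m - 1)"
    unfolding P_def
  proof (intro degree_sum_le)
    fix i assume "i \<in> {..<m}"
    then show "degree (Polynomial.monom (1 :: 'a) (p ^ i)) \<le> p ^ (m - 1)"
      using p_gt_1 by (intro order.trans[OF degree_monom_le] power_increasing) auto
  qed simp
  moreover have "{x. poly P x = 0} = UNIV"
    using tr0 by (auto simp: P_def abs_trace_def poly_sum poly_monom)
  ultimately have "p ^ m \<le> p ^ (m - 1)"
    using card_poly_roots_bound[OF \<open>P \<noteq> 0\<close>] card_field by simp
  moreover have "p ^ (m - 1) < p ^ m"
    using p_gt_1 m_pos by (intro power_strict_increasing) auto
  ultimately show False by simp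
qed

definition psi :: "'a \<Rightarrow> complex" where
  "psi x = add_char (tr x)"

lemma psi_0 [simp]: "psi 0 = 1"
  by (simp add: psi_def)

lemma psi_add: "psi (x + y) = psi x * psi y"
  by (simp add: psi_def tr_add add_char_add)

lemma psi_minus: "psi (- x) = cnj (psi x)"
  by (simp add: psi_def tr_minus add_char_minus)

lemma sum_psi: "(\<Sum>x\<in>UNIV. psi (a * x)) = (if a = 0 then of_nat (p ^ m) else 0)"
proof (cases "a = 0")
  case False
  obtain u where "tr u \<noteq> 0" using tr_nontrivial by blast
  define b where "b = u / a"
  have "psi (a * b) \<noteq> 1"
    using False \<open>tr u \<noteq> 0\<close> by (simp add: b_def psi_def add_char_eq_1_iff)
  have "(\<Sum>x\<in>UNIV. psi (a * x)) = (\<Sum>x\<in>UNIV. psi (a * (x + b)))"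
    by (rule sum.reindex_bij_witness[of _ "\<lambda>t. t + b" "\<lambda>t. t - b"]) auto
  also have "\<dots> = (\<Sum>x\<in>UNIV. psi (a * x)) * psi (a * b)"
    by (simp add: distrib_left psi_add sum_distrib_right)
  finally show ?thesis
    using False \<open>psi (a * b) \<noteq> 1\<close> by simp
qed (simp add: card_field)

end

locale odd_prime_power_field = prime_power_field +
  assumes odd_p: "odd p"
begin

lemma two_neq_0: "(2 :: 'a) \<noteq> 0"
proof
  assume "(2 :: 'a) = 0"
  then have "of_nat 2 = (0 :: 'a)" by simp
  then have "p dvd 2" by (simp only: of_nat_eq_0_iff_char_dvd CHAR_field)
  then have "p = 2" using p_gt_1 by (auto dest: dvd_imp_le)
  then show False using odd_p by simp
qed

lemma minus_neq: "(z :: 'a) \<noteq> 0 \<Longrightarrow> - z \<noteq> z"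
proof
  assume "z \<noteq> 0" "- z = z"
  then have "2 * z = 0" by (metis add.right_inverse mult_2)
  then show False using two_neq_0 \<open>z \<noteq> 0\<close> by simp
qed

section \<open>The quadratic character of the prime field and its Gauss sums\<close>

definition squares :: "'a set" where
  "squares = (\<lambda>c. c\<^sup>2) ` (prime_field - {0})"

text \<open>Meant for arguments in the prime field; outside it the value is -1 by default.\<close>

definition quad_char :: "'a \<Rightarrow> int" where
  "quad_char z = (if z = 0 then 0 else if z \<in> squares then 1 else - 1)"

lemma squares_subset: "squares \<subseteq> prime_field - {0}"
  by (auto simp: squares_def)

lemma sqrt_fiber:
  assumes "b \<in> prime_field" "b \<noteq> 0"
  shows "{c \<in> prime_field. c\<^sup>2 = b\<^sup>2} = {b, - b}"
  using assms by (auto simp: power2_eq_iff)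

lemma sum_squares:
  fixes f :: "'a \<Rightarrow> 'b::comm_semiring_1"
  shows "(\<Sum>c\<in>prime_field - {0}. f (c\<^sup>2)) = 2 * sum f squares"
proof -
  have "(\<Sum>c\<in>prime_field - {0}. f (c\<^sup>2))
      = (\<Sum>z\<in>squares. \<Sum>c\<in>{c \<in> prime_field - {0}. c\<^sup>2 = z}. f (c\<^sup>2))"
    unfolding squares_def by (rule sum.image_gen) simp
  also have "\<dots> = (\<Sum>z\<in>squares. 2 * f z)"
  proof (rule sum.cong)
    fix z assume "z \<in> squares"
    then obtain b where b: "b \<in> prime_field" "b \<noteq> 0" "z = b\<^sup>2" by (auto simp: squares_def)
    have "{c \<in> prime_field - {0}. c\<^sup>2 = z} = {c \<in> prime_field. c\<^sup>2 = b\<^sup>2}"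
      using b by auto
    also have "\<dots> = {b, - b}" using b by (intro sqrt_fiber)
    finally have "(\<Sum>c\<in>{c \<in> prime_field - {0}. c\<^sup>2 = z}. f (c\<^sup>2)) = (\<Sum>c\<in>{b, - b}. f (c\<^sup>2))"
      by (rule arg_cong)
    also have "\<dots> = f (b\<^sup>2) + f ((- b)\<^sup>2)"
      using minus_neq[OF b(2)] by (subst sum.insert) auto
    also have "\<dots> = 2 * f z" using b(3) by (simp only: power2_minus mult_2)
    finally show "(\<Sum>c\<in>{c \<in> prime_field - {0}. c\<^sup>2 = z}. f (c\<^sup>2)) = 2 * f z" .
  qed simp
  finally show ?thesis by (simp only: sum_distrib_left)
qed

lemma card_squares: "2 * card squares = p - 1"
  using sum_squares[of "\<lambda>_. 1 :: nat"] by (simp add: card_prime_field)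

lemma squares_mult_left_iff:
  assumes "d \<in> squares" "z \<in> prime_field" shows "d * z \<in> squares \<longleftrightarrow> z \<in> squares"
proof -
  obtain b where b: "b \<in> prime_field" "b \<noteq> 0" "d = b\<^sup>2" using assms by (auto simp: squares_def)
  show ?thesis
  proof
    assume "z \<in> squares"
    then obtain c where "c \<in> prime_field" "c \<noteq> 0" "z = c\<^sup>2" by (auto simp: squares_def)
    then show "d * z \<in> squares"
      unfolding squares_def using b by (intro image_eqI[of _ _ "b * c"]) (auto simp: power_mult_distrib)
  next
    assume "d * z \<in> squares"
    then obtain c where "c \<in> prime_field" "c \<noteq> 0" "d * z = c\<^sup>2" by (auto simp: squares_def)
    then show "z \<in> squares"
      unfolding squares_def using b
      by (intro image_eqI[of _ _ "c / b"]) (auto simp: power_divide field_simps)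
  qed
qed

lemma nonsquare_times_squares:
  assumes d: "d \<in> prime_field" "d \<noteq> 0" "d \<notin> squares"
  shows "(*) d ` squares = prime_field - {0} - squares"
proof (rule card_seteq)
  show "(*) d ` squares \<subseteq> prime_field - {0} - squares"
  proof (intro subsetI)
    fix x assume "x \<in> (*) d ` squares"
    then obtain z where z: "z \<in> squares" "x = z * d" by (auto simp: mult.commute)
    then have "x \<notin> squares" using squares_mult_left_iff[of z d] d by simp
    then show "x \<in> prime_field - {0} - squares" using z d squares_subset by auto
  qed
  have "card (prime_field - {0} - squares) = card squares"
    using card_squares squares_subset by (simp add: card_Diff_subset card_prime_field)
  also have "\<dots> = card ((*) d ` squares)"
    using d by (intro card_image[symmetric] inj_onI) auto
  finally show "card (prime_field - {0} - squares) \<le> card ((*) d ` squares)" by simp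
qed simp

lemma ex_nonsquare: "\<exists>c. c \<in> prime_field - {0} - squares"
proof (rule ccontr)
  assume "\<not> ?thesis"
  then have "prime_field - {0} = squares" using squares_subset by blast
  then have "card squares = p - 1" by (simp add: card_prime_field flip: \<open>_ = squares\<close>)
  then show False using card_squares p_gt_1 by linarith
qed

lemma quad_char_mult:
  assumes "a \<in> prime_field" "b \<in> prime_field"
  shows "quad_char (a * b) = quad_char a * quad_char b"
proof -
  have "a * b \<in> squares" if "a \<notin> squares" "b \<notin> squares" "a \<noteq> 0" "b \<noteq> 0"
  proof -
    have "b \<in> (*) a ` squares" using nonsquare_times_squares[of a] that assms by auto
    then obtain w where w: "w \<in> squares" "b = a * w" by auto
    have "a\<^sup>2 \<in> squares" using assms that by (auto simp: squares_def)
    then have "a\<^sup>2 * w \<in> squares" using squares_mult_left_iff w squares_subset by blast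
    then show ?thesis using w by (simp add: power2_eq_square mult.assoc)
  qed
  then show ?thesis
    using squares_mult_left_iff[of a b] squares_mult_left_iff[of b a] assms
    by (auto simp: quad_char_def mult.commute)
qed

lemma gauss_sum_1: "(\<Sum>c\<in>prime_field. add_char (c\<^sup>2)) = sqrt_pstar p"
proof -
  have "(\<Sum>c\<in>prime_field. add_char (c\<^sup>2)) = (\<Sum>t<p. add_char ((of_nat t)\<^sup>2))"
    unfolding prime_field_eq by (simp add: sum.reindex inj_on_of_nat)
  also have "\<dots> = (\<Sum>t<p. zeta p ^ t\<^sup>2)"
    by (simp add: add_char_of_nat flip: of_nat_power)
  finally show ?thesis using quadratic_gauss_sum odd_p p_gt_1 by simp
qed

text \<open>For a nonsquare \<open>d\<close> the multiples \<open>d * z\<close> of squares run over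
  the nonsquares. Since \<open>add_char\<close> sums to 0 over the prime field, exchanging squares
  and nonsquares reverses the sign of the Gauss sum.\<close>

lemma gauss_sum:
  assumes d: "d \<in> prime_field" "d \<noteq> 0"
  shows "(\<Sum>c\<in>prime_field. add_char (d * c\<^sup>2)) = of_int (quad_char d) * sqrt_pstar p"
proof (cases "d \<in> squares")
  case True
  then obtain b where b: "b \<in> prime_field" "b \<noteq> 0" "d = b\<^sup>2" by (auto simp: squares_def)
  have "(\<Sum>c\<in>prime_field. add_char (d * c\<^sup>2)) = (\<Sum>c\<in>prime_field. add_char (c\<^sup>2))"
    by (rule sum.reindex_bij_witness[of _ "\<lambda>c. c / b" "\<lambda>c. b * c"])
      (use b in \<open>auto simp: power_mult_distrib\<close>)
  then show ?thesis using True d by (simp add: quad_char_def gauss_sum_1)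
next
  case False
  have split: "(\<Sum>c\<in>prime_field. add_char (r * c\<^sup>2)) = 1 + 2 * (\<Sum>z\<in>squares. add_char (r * z))" for r
    using sum_squares[of "\<lambda>z. add_char (r * z)"] by (subst sum.remove[of _ 0]) auto
  have "(\<Sum>z\<in>squares. add_char (d * z)) = (\<Sum>z\<in>prime_field - {0} - squares. add_char z)"
    unfolding nonsquare_times_squares[OF d False, symmetric]
    by (subst sum.reindex) (use d in \<open>auto intro: inj_onI\<close>)
  also have "\<dots> = (\<Sum>z\<in>prime_field. add_char z) - 1 - (\<Sum>z\<in>squares. add_char z)"
    using squares_subset by (subst sum_diff) (auto simp: sum_diff1)
  also have "(\<Sum>z\<in>prime_field. add_char z) = 0"
    using sum_add_char[of 1] by simp
  finally have "(\<Sum>z\<in>squares. add_char (d * z)) = - 1 - (\<Sum>z\<in>squares. add_char z)" by simp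
  then have "(\<Sum>c\<in>prime_field. add_char (d * c\<^sup>2)) = - (1 + 2 * (\<Sum>z\<in>squares. add_char z))"
    unfolding split[of d] by (simp only:) (simp add: algebra_simps)
  also have "1 + 2 * (\<Sum>z\<in>squares. add_char z) = sqrt_pstar p"
    using split[of 1] gauss_sum_1 by simp
  finally show ?thesis
    using False d by (simp add: quad_char_def)
qed

lemma card_sqrt: "z \<in> prime_field \<Longrightarrow> int (card {c \<in> prime_field. c\<^sup>2 = z}) = 1 + quad_char z"
proof -
  assume z: "z \<in> prime_field"
  consider "z = 0" | "z \<noteq> 0" "z \<in> squares" | "z \<noteq> 0" "z \<notin> squares" by blast
  then show ?thesis
  proof cases
    case 1
    have "{c \<in> prime_field. c\<^sup>2 = 0} = {0}" by auto
    then show ?thesis using 1 by (simp add: quad_char_def)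
  next
    case 2
    then obtain b where b: "b \<in> prime_field" "b \<noteq> 0" "z = b\<^sup>2" by (auto simp: squares_def)
    then show ?thesis
      using 2 minus_neq[of b] sqrt_fiber[of b] by (simp add: quad_char_def)
  next
    case 3
    then have "{c \<in> prime_field. c\<^sup>2 = z} = {}" by (auto simp: squares_def)
    then show ?thesis using 3 by (simp add: quad_char_def)
  qed
qed

lemma quad_char_of_int: "quad_char (of_int a) = Legendre a (int p)"
proof -
  have zero: "of_int a = (0 :: 'a) \<longleftrightarrow> [a = 0] (mod int p)" for a
    using of_int_eq_iff_cong_CHAR[of a 0, where 'a = 'a] by (simp add: CHAR_field)
  have of_int_mem: "of_int y \<in> prime_field" for y
    by (cases y rule: int_cases2) auto
  have "of_int a \<in> squares \<longleftrightarrow> QuadRes (int p) a" if "of_int a \<noteq> (0 :: 'a)"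
  proof
    assume "of_int a \<in> squares"
    then obtain n where "of_int a = (of_nat n :: 'a)\<^sup>2" by (auto simp: squares_def prime_field_eq)
    then have "of_int ((int n)\<^sup>2) = (of_int a :: 'a)" by simp
    then show "QuadRes (int p) a"
      unfolding QuadRes_def of_int_eq_iff_cong_CHAR CHAR_field by blast
  next
    assume "QuadRes (int p) a"
    then obtain y where "of_int (y\<^sup>2) = (of_int a :: 'a)"
      unfolding QuadRes_def of_int_eq_iff_cong_CHAR CHAR_field by blast
    then show "of_int a \<in> squares"
      unfolding squares_def using of_int_mem[of y] that
      by (intro image_eqI[of _ _ "of_int y"]) auto
  qed
  then show ?thesis by (auto simp: quad_char_def Legendre_def zero)
qed

end

section \<open>Exponential sums of quadratic forms\<close>

locale quadratic_form = odd_prime_power_field p m ty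
  for p m and ty :: "'a::finite_field itself" +
  fixes R :: "'a \<Rightarrow> 'a" and B :: "'a \<Rightarrow> 'a \<Rightarrow> 'a"
  assumes R_in [simp]: "R x \<in> prime_field"
    and R_add: "R (x + y) = R x + R y + B x y"
    and R_scale: "c \<in> prime_field \<Longrightarrow> R (c * x) = c\<^sup>2 * R x"
    and B_add: "B (x + y) z = B x z + B y z"
    and B_scale: "c \<in> prime_field \<Longrightarrow> B (c * x) z = c * B x z"
begin

lemma B_sym: "B x y = B y x"
  using R_add[of x y] R_add[of y x] by (simp add: add.commute)

lemma B_self: "B x x = 2 * R x"
proof -
  have two: "2 \<in> prime_field" using prime_field_of_nat[of 2] by simp
  have "R x + R x + B x x = R (2 * x)" by (simp only: R_add[symmetric] mult_2)
  also have "\<dots> = 4 * R x" using R_scale[OF two] by simp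
  finally show ?thesis by (simp add: algebra_simps)
qed

lemma B_in [simp]: "B x y \<in> prime_field"
proof -
  have "B x y = R (x + y) - R x - R y" by (simp add: R_add)
  then show ?thesis by simp
qed

text \<open>Projection along \<open>v\<close>, possible because \<open>B v v = 2 * R v\<close> is
  invertible. A general \<open>W\<close> is needed since the induction below descends through
  orthogonal complements.\<close>

lemma orthogonal_split:
  assumes v: "R v \<noteq> 0" "v \<in> W"
    and W_add: "\<And>x y. x \<in> W \<Longrightarrow> y \<in> W \<Longrightarrow> x + y \<in> W"
    and W_scale: "\<And>c x. c \<in> prime_field \<Longrightarrow> x \<in> W \<Longrightarrow> c * x \<in> W"
  shows "bij_betw (\<lambda>(c, w). c * v + w) (prime_field \<times> {w \<in> W. B w v = 0}) W"
proof (rule bij_betw_byWitness[where f' = "\<lambda>x. (B x v / B v v, x - B x v / B v v * v)"])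
  have Bv: "B v v \<noteq> 0" using v two_neq_0 by (simp add: B_self)
  have minus: "x - c * v = x + (- c) * v" for x c by simp
  show "\<forall>a\<in>prime_field \<times> {w \<in> W. B w v = 0}.
      (\<lambda>x. (B x v / B v v, x - B x v / B v v * v)) ((\<lambda>(c, w). c * v + w) a) = a"
    using Bv by (auto simp: B_add B_scale)
  show "\<forall>x\<in>W. (\<lambda>(c, w). c * v + w) (B x v / B v v, x - B x v / B v v * v) = x"
    by auto
  show "(\<lambda>(c, w). c * v + w) ` (prime_field \<times> {w \<in> W. B w v = 0}) \<subseteq> W"
    using assms by auto
  show "(\<lambda>x. (B x v / B v v, x - B x v / B v v * v)) ` W \<subseteq> prime_field \<times> {w \<in> W. B w v = 0}"
  proof (intro subsetI)
    fix y assume "y \<in> (\<lambda>x. (B x v / B v v, x - B x v / B v v * v)) ` W"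
    then obtain x where x: "x \<in> W" "y = (B x v / B v v, x - B x v / B v v * v)" by blast
    define c where "c = B x v / B v v"
    have c: "c \<in> prime_field" "- c \<in> prime_field" by (auto simp: c_def)
    have "B (x + (- c) * v) v = B x v - c * B v v"
      by (simp only: B_add B_scale[OF c(2)]) simp
    also have "\<dots> = 0" using Bv by (simp add: c_def)
    finally have "B (x - c * v) v = 0" by (simp only: minus)
    moreover have "x - c * v \<in> W"
      unfolding minus using W_add[OF x(1) W_scale[OF c(2) v(2)]] .
    ultimately show "y \<in> prime_field \<times> {w \<in> W. B w v = 0}"
      using c x by (simp add: c_def)
  qed
qed

text \<open>Induction on \<open>W\<close>: splitting off a vector \<open>v\<close> with \<open>R v \<noteq> 0\<close> orthogonally contributes one
  Gauss sum. The multiplier \<open>t\<close> is carried along to track the Galois conjugates of the sum.\<close>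
lemma exp_sum_subspace:
  assumes "0 \<in> W"
    and "\<And>x y. x \<in> W \<Longrightarrow> y \<in> W \<Longrightarrow> x + y \<in> W"
    and "\<And>c x. c \<in> prime_field \<Longrightarrow> x \<in> W \<Longrightarrow> c * x \<in> W"
  shows "\<exists>r s. \<exists>\<epsilon>\<in>{1, - 1}. card W = p ^ r * s \<and>
    (\<forall>t\<in>prime_field - {0}. (\<Sum>x\<in>W. add_char (t * R x))
       = of_int (\<epsilon> * quad_char t ^ r) * sqrt_pstar p ^ r * of_nat s)"
  using assms
proof (induction "card W" arbitrary: W rule: less_induct)
  case less
  show ?case
  proof (cases "\<forall>v\<in>W. R v = 0")
    case True
    then show ?thesis
      \<comment> \<open>\<open>R\<close> vanishes on \<open>W\<close>, so every term is 1: the rank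
        \<open>r\<close> is 0 and all of \<open>W\<close> goes into \<open>s\<close>.\<close>
      by (intro exI[of _ 0] exI[of _ "card W"] bexI[of _ 1]) simp_all
  next
    case False
    then obtain v where v: "v \<in> W" "R v \<noteq> 0" by blast
    define V where "V = {w \<in> W. B w v = 0}"
    note bij = orthogonal_split[OF v(2,1) less.prems(2,3), folded V_def]
    have B0: "B 0 v = 0" using B_scale[of 0 0 v] by simp
    have V0: "0 \<in> V" using less.prems(1) B0 by (simp add: V_def)
    have card: "card W = p * card V"
      using bij_betw_same_card[OF bij] by (simp add: card_cartesian_product card_prime_field)
    have "card V > 0" using V0 by (auto simp: card_gt_0_iff)
    then have "card V < card W" using card p_gt_1 by simp
    then have "\<exists>r s. \<exists>\<epsilon>\<in>{1, - 1}. card V = p ^ r * s \<and>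
      (\<forall>t\<in>prime_field - {0}. (\<Sum>x\<in>V. add_char (t * R x))
         = of_int (\<epsilon> * quad_char t ^ r) * sqrt_pstar p ^ r * of_nat s)"
    proof (rule less.hyps)
      show "0 \<in> V" by fact
      show "x + y \<in> V" if "x \<in> V" "y \<in> V" for x y
        using that less.prems by (simp add: V_def B_add)
      show "c * x \<in> V" if "c \<in> prime_field" "x \<in> V" for c x
        using that less.prems by (simp add: V_def B_scale)
    qed
    then obtain r s \<epsilon> where IH: "\<epsilon> \<in> {1, - 1 :: int}" "card V = p ^ r * s"
      "\<And>t. t \<in> prime_field - {0} \<Longrightarrow> (\<Sum>x\<in>V. add_char (t * R x))
         = of_int (\<epsilon> * quad_char t ^ r) * sqrt_pstar p ^ r * of_nat s" by blast
    show ?thesis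
    \<comment> \<open>The vector \<open>v\<close> raises the rank by one; its Gauss sum has
      coefficient \<open>t * R v\<close>, whence the extra sign \<open>quad_char (R v)\<close> and
      the extra factor \<open>quad_char t\<close>.\<close>
    proof (rule exI[of _ "Suc r"], rule exI[of _ s], intro bexI[of _ "\<epsilon> * quad_char (R v)"] conjI ballI)
      show "card W = p ^ Suc r * s" using card IH(2) by simp
      show "\<epsilon> * quad_char (R v) \<in> {1, - 1}"
        using IH(1) v by (auto simp: quad_char_def)
      fix t assume t: "t \<in> prime_field - {0}"
      have "(\<Sum>x\<in>W. add_char (t * R x))
          = (\<Sum>(c, w)\<in>prime_field \<times> V. add_char (t * R (c * v + w)))"
        by (subst sum.reindex_bij_betw[OF bij, symmetric]) (auto intro: sum.cong)
      also have "\<dots> = (\<Sum>(c, w)\<in>prime_field \<times> V. add_char ((t * R v) * c\<^sup>2) * add_char (t * R w))"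
      proof (intro sum.cong refl, clarify)
        fix c w assume cw: "c \<in> prime_field" "w \<in> V"
        have "B (c * v) w = 0"
          using cw B_sym[of v w] by (simp add: V_def B_scale)
        then have "R (c * v + w) = c\<^sup>2 * R v + R w"
          using cw by (simp add: R_add R_scale)
        then have "t * R (c * v + w) = t * R v * c\<^sup>2 + t * R w"
          by (simp add: algebra_simps)
        then show "add_char (t * R (c * v + w)) = add_char (t * R v * c\<^sup>2) * add_char (t * R w)"
          using cw t by (simp add: add_char_add)
      qed
      also have "\<dots> = (\<Sum>c\<in>prime_field. add_char ((t * R v) * c\<^sup>2)) * (\<Sum>w\<in>V. add_char (t * R w))"
        by (simp add: sum_product sum.cartesian_product)
      also have "(\<Sum>c\<in>prime_field. add_char ((t * R v) * c\<^sup>2))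
          = of_int (quad_char t * quad_char (R v)) * sqrt_pstar p"
        using t v by (subst gauss_sum) (auto simp: quad_char_mult)
      finally show "(\<Sum>x\<in>W. add_char (t * R x))
        = of_int (\<epsilon> * quad_char (R v) * quad_char t ^ Suc r) * sqrt_pstar p ^ Suc r * of_nat s"
        unfolding IH(3)[OF t] by (simp add: mult_ac)
    qed
  qed
qed

lemma exp_sum_multiples:
  "\<exists>i\<le>m. \<exists>\<epsilon>\<in>{1, - 1}. \<forall>t\<in>prime_field - {0}. (\<Sum>x\<in>UNIV. add_char (t * R x))
      = of_int (\<epsilon> * quad_char t ^ (m - i)) * sqrt_pstar p ^ (m - i) * of_nat (p ^ i)"
proof -
  obtain r s \<epsilon> where *: "\<epsilon> \<in> {1, - 1 :: int}" "CARD('a) = p ^ r * s"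
    "\<forall>t\<in>prime_field - {0}. (\<Sum>x\<in>UNIV. add_char (t * R x))
       = of_int (\<epsilon> * quad_char t ^ r) * sqrt_pstar p ^ r * of_nat s"
    using exp_sum_subspace[of UNIV, OF UNIV_I UNIV_I UNIV_I]
    by (elim exE bexE conjE) (rule that)
  have "s dvd p ^ m" using *(2) by (simp add: card_field)
  then obtain i where i: "i \<le> m" "s = p ^ i"
    using divides_primepow_nat prime_p by blast
  have "p ^ m = p ^ (r + i)" using *(2) i by (simp add: card_field power_add)
  then have "m = r + i" using p_gt_1 power_inject_exp by blast
  then have r: "r = m - i" by simp
  show ?thesis
    by (rule exI[of _ i], intro conjI i(1) bexI[of _ \<epsilon>] *(1)) (rule *(3)[unfolded r i(2)])
qed

end

section \<open>The two possible values of a sum of given rank\<close>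

lemma sqrt_pstar_squared: "odd p \<Longrightarrow> sqrt_pstar p ^ 2 = (if p mod 4 = 1 then of_nat p else - of_nat p)"
  by (auto simp: sqrt_pstar_def power_mult_distrib simp flip: of_real_power)

lemma norm_sqrt_pstar: "norm (sqrt_pstar p) = sqrt (real p)"
  by (simp add: sqrt_pstar_def norm_mult)

lemma sqrt_pstar_neq_0: "p > 0 \<Longrightarrow> sqrt_pstar p \<noteq> 0"
  by (simp add: sqrt_pstar_def)

lemma sqrt_pstar_even_power:
  assumes "odd p" shows "\<exists>\<epsilon>\<in>{1, - 1 :: int}. sqrt_pstar p ^ (2 * n) = of_int \<epsilon> * of_nat p ^ n"
proof -
  have "sqrt_pstar p ^ (2 * n) = of_int (if p mod 4 = 1 then 1 else (- 1) ^ n) * of_nat p ^ n"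
    using sqrt_pstar_squared[OF assms] power_minus[of "of_nat p :: complex" n] by (simp add: power_mult)
  moreover have "(if p mod 4 = 1 then 1 else (- 1) ^ n) \<in> {1, - 1 :: int}"
    by (cases "even n") auto
  ultimately show ?thesis by blast
qed

text \<open>Here \<open>m\<close> is the dimension of the form and \<open>i\<close> that of its radical.\<close>
definition form_value :: "nat \<Rightarrow> nat \<Rightarrow> int \<Rightarrow> nat \<Rightarrow> complex" where
  "form_value p m \<epsilon> i =
    (if odd (m - i) then of_int \<epsilon> * sqrt_pstar p * of_nat p ^ ((m + i - 1) div 2)
     else of_int \<epsilon> * of_nat p ^ ((m + i) div 2))"

text \<open>The modulus determines \<open>i\<close>; all later separations of the dimension
  \<open>i\<close> rest on this.\<close>

lemma norm_form_value:
  assumes "i \<le> m" "\<epsilon> \<in> {1, - 1}" "p > 0"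
  shows "norm (form_value p m \<epsilon> i) ^ 2 = real p ^ (m + i)"
proof (cases "odd (m - i)")
  case True
  then have "m + i = Suc (2 * ((m + i - 1) div 2))" using assms(1) by presburger
  then have "real p ^ (m + i) = real p * (real p ^ ((m + i - 1) div 2))\<^sup>2"
    by (metis power_Suc power_even_eq)
  then show ?thesis using True assms
    by (auto simp: form_value_def norm_mult norm_power norm_sqrt_pstar power_mult_distrib)
next
  case False
  then have "m + i = 2 * ((m + i) div 2)" using assms(1) by presburger
  then have "real p ^ (m + i) = (real p ^ ((m + i) div 2))\<^sup>2"
    by (metis power_even_eq)
  then show ?thesis using False assms
    by (auto simp: form_value_def norm_mult norm_power)
qed

lemma form_value_neq_0: "\<epsilon> \<in> {1, - 1} \<Longrightarrow> p > 0 \<Longrightarrow> form_value p m \<epsilon> i \<noteq> 0"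
  by (auto simp: form_value_def sqrt_pstar_neq_0)

lemma mult_sqrt_pstar_eq_form_value:
  assumes "odd p" "i \<le> m" "\<epsilon> \<in> {1, - 1 :: int}"
  shows "\<exists>\<epsilon>'\<in>{1, - 1}. of_int \<epsilon> * sqrt_pstar p ^ (m - i) * of_nat (p ^ i) = form_value p m \<epsilon>' i"
proof (cases "odd (m - i)")
  case True
  define n where "n = (m - i) div 2"
  then have n: "m - i = Suc (2 * n)" "n + i = (m + i - 1) div 2" using True assms by presburger+
  obtain \<epsilon>' where e: "\<epsilon>' \<in> {1, - 1 :: int}" "sqrt_pstar p ^ (2 * n) = of_int \<epsilon>' * of_nat p ^ n"
    using sqrt_pstar_even_power[OF assms(1)] by blast
  have "of_int \<epsilon> * sqrt_pstar p ^ (m - i) * of_nat (p ^ i) = form_value p m (\<epsilon> * \<epsilon>') i"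
    unfolding form_value_def if_P[OF True] n(2)[symmetric] by (simp add: n(1) e(2) power_add)
  then show ?thesis using e assms by (intro bexI[of _ "\<epsilon> * \<epsilon>'"]) auto
next
  case False
  define n where "n = (m - i) div 2"
  then have n: "m - i = 2 * n" "n + i = (m + i) div 2" using False assms by presburger+
  obtain \<epsilon>' where e: "\<epsilon>' \<in> {1, - 1 :: int}" "sqrt_pstar p ^ (2 * n) = of_int \<epsilon>' * of_nat p ^ n"
    using sqrt_pstar_even_power[OF assms(1)] by blast
  have "of_int \<epsilon> * sqrt_pstar p ^ (m - i) * of_nat (p ^ i) = form_value p m (\<epsilon> * \<epsilon>') i"
    unfolding form_value_def if_not_P[OF False] n(2)[symmetric] by (simp add: n(1) e(2) power_add)
  then show ?thesis using e assms by (intro bexI[of _ "\<epsilon> * \<epsilon>'"]) auto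
qed

section \<open>Adding a linear term to a quadratic form\<close>

text \<open>Representing the polar form through the trace turns the radical into the kernel of
  \<open>L\<close>, and a linear term with coefficient \<open>L a\<close> into the effect of
  translating by \<open>a\<close>.\<close>

locale represented_quadratic_form = quadratic_form p m ty R B
  for p m and ty :: "'a::finite_field itself" and R B +
  fixes L :: "'a \<Rightarrow> 'a"
  assumes L_add: "L (x + y) = L x + L y"
    and B_eq: "B x y = tr (L x * y)"
begin

definition form_sum :: complex where
  "form_sum = (\<Sum>x\<in>UNIV. add_char (R x))"

definition affine_sum :: "'a \<Rightarrow> complex" where
  "affine_sum \<delta> = (\<Sum>x\<in>UNIV. add_char (R x + tr (\<delta> * x)))"

definition radical :: "'a set" where
  "radical = {x. L x = 0}"

lemma L_diff: "L (x - y) = L x - L y"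
  using L_add[of "x - y" y] by simp

lemma R_radical: "x \<in> radical \<Longrightarrow> R x = 0"
  using B_self[of x] B_eq[of x x] two_neq_0 by (simp add: radical_def)

text \<open>Completing the square: \<open>R x + B x a = R (x + a) - R a\<close>.\<close>

lemma affine_sum_L: "affine_sum (L a) = form_sum * cnj (add_char (R a))"
proof -
  have "affine_sum (L a) = (\<Sum>x\<in>UNIV. add_char (R (x + a) - R a))"
    unfolding affine_sum_def
  proof (rule sum.cong[OF refl])
    fix x
    have "B x a = tr (L a * x)" unfolding B_sym[of x a] by (rule B_eq)
    then show "add_char (R x + tr (L a * x)) = add_char (R (x + a) - R a)" by (simp add: R_add)
  qed
  also have "\<dots> = (\<Sum>x\<in>UNIV. add_char (R (x + a))) * cnj (add_char (R a))"
    by (simp add: add_char_diff sum_distrib_right)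
  also have "(\<Sum>x\<in>UNIV. add_char (R (x + a))) = form_sum"
    unfolding form_sum_def by (rule sum.reindex_bij_witness[of _ "\<lambda>x. x - a" "\<lambda>x. x + a"]) auto
  finally show ?thesis .
qed

text \<open>Each \<open>form_sum * cnj (add_char (R y))\<close> is the affine sum at
  \<open>L y\<close>. After interchanging the sums, orthogonality keeps only \<open>x\<close> in the
  radical, where \<open>R\<close> vanishes.\<close>

lemma form_sum_mult_cnj: "form_sum * cnj form_sum = of_nat (p ^ m * card radical)"
proof -
  have "form_sum * cnj form_sum = (\<Sum>x\<in>UNIV. form_sum * cnj (add_char (R x)))"
    by (simp add: form_sum_def sum_distrib_left)
  also have "\<dots> = (\<Sum>y\<in>UNIV. affine_sum (L y))"
    by (simp add: affine_sum_L)
  also have "\<dots> = (\<Sum>x\<in>UNIV. add_char (R x) * (\<Sum>y\<in>UNIV. psi (L x * y)))"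
    unfolding affine_sum_def
    by (subst sum.swap) (simp add: sum_distrib_left add_char_add psi_def B_eq[symmetric] B_sym)
  also have "\<dots> = (\<Sum>x\<in>UNIV. if x \<in> radical then of_nat (p ^ m) else 0)"
    by (intro sum.cong) (auto simp: sum_psi radical_def R_radical[unfolded radical_def])
  finally show ?thesis by (simp add: sum.If_cases)
qed

lemma card_L_vimage: "D \<subseteq> range L \<Longrightarrow> card {a. L a \<in> D} = card D * card radical"
proof -
  assume D: "D \<subseteq> range L"
  have "card {a. L a \<in> D} = (\<Sum>a\<in>{a. L a \<in> D}. 1)" by simp
  also have "\<dots> = (\<Sum>d\<in>D. \<Sum>a\<in>{a \<in> {a. L a \<in> D}. L a = d}. 1)"
    by (rule sum.group[symmetric]) auto
  also have "\<dots> = (\<Sum>d\<in>D. card radical)"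
  proof (rule sum.cong)
    fix d assume "d \<in> D"
    then obtain b where b: "d = L b" using D by blast
    have "bij_betw (\<lambda>x. x + b) radical {a \<in> {a. L a \<in> D}. L a = d}"
      by (rule bij_betw_byWitness[where f' = "\<lambda>x. x - b"])
        (use b \<open>d \<in> D\<close> in \<open>auto simp: radical_def L_add L_diff\<close>)
    then show "(\<Sum>a\<in>{a \<in> {a. L a \<in> D}. L a = d}. 1) = card radical"
      by (simp add: bij_betw_same_card)
  qed simp
  finally show ?thesis by simp
qed

lemma card_range_L: "card (range L) * card radical = p ^ m"
  using card_L_vimage[of "range L"] by (simp add: card_field)

lemma parseval: "(\<Sum>\<delta>\<in>UNIV. affine_sum \<delta> * cnj (affine_sum \<delta>)) = of_nat (p ^ m) ^ 2"
proof -
  have "(\<Sum>\<delta>\<in>UNIV. affine_sum \<delta> * cnj (affine_sum \<delta>))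
      = (\<Sum>\<delta>\<in>UNIV. \<Sum>x\<in>UNIV. \<Sum>y\<in>UNIV. add_char (R x) * cnj (add_char (R y)) * psi ((x - y) * \<delta>))"
    unfolding affine_sum_def
    by (simp add: sum_product add_char_add psi_def left_diff_distrib right_diff_distrib tr_diff
        add_char_diff mult_ac)
  also have "\<dots> = (\<Sum>x\<in>UNIV. \<Sum>y\<in>UNIV. add_char (R x) * cnj (add_char (R y)) * (\<Sum>\<delta>\<in>UNIV. psi ((x - y) * \<delta>)))"
    by (subst sum.swap, rule sum.cong[OF refl], subst sum.swap) (simp add: sum_distrib_left)
  also have "\<dots> = (\<Sum>x\<in>UNIV. \<Sum>y\<in>UNIV. if x = (y :: 'a) then of_nat (p ^ m) else 0)"
  proof (rule sum.cong[OF refl], rule sum.cong[OF refl])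
    fix x y
    show "add_char (R x) * cnj (add_char (R y)) * (\<Sum>\<delta>\<in>UNIV. psi ((x - y) * \<delta>))
        = (if x = y then of_nat (p ^ m) else 0)"
    proof (cases "x = y")
      case True
      have "add_char (R y) * cnj (add_char (R y)) = 1" by (simp flip: complex_norm_square)
      then show ?thesis using True sum_psi[of 0] by simp
    qed (simp add: sum_psi)
  qed
  finally show ?thesis by (simp add: card_field power2_eq_square)
qed

text \<open>On the range of \<open>L\<close> the modulus is constant and nonzero, and these terms
  alone already exhaust the total in \<open>parseval\<close>; nothing is left for the other
  \<delta>.\<close>

lemma affine_sum_eq_0_iff: "affine_sum \<delta> = 0 \<longleftrightarrow> \<delta> \<notin> range L"
proof -
  have radical: "card radical > 0"
    using L_diff[of 0 0] by (auto simp: card_gt_0_iff radical_def intro: exI[of _ 0])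
  have q: "p ^ m > 0" using p_gt_1 by simp
  have T: "(norm form_sum)\<^sup>2 = real (p ^ m * card radical)"
    using form_sum_mult_cnj unfolding complex_norm_square[symmetric]
    by (metis of_real_eq_iff of_real_of_nat_eq)
  then have T0: "form_sum \<noteq> 0" using radical q by auto
  have L: "norm (affine_sum (L a)) = norm form_sum" for a
    by (simp add: affine_sum_L norm_mult)
  have "(\<Sum>\<delta>\<in>UNIV. of_real ((norm (affine_sum \<delta>))\<^sup>2)) = (of_nat (p ^ m) ^ 2 :: complex)"
    using parseval by (simp only: complex_norm_square)
  then have "complex_of_real (\<Sum>\<delta>\<in>UNIV. (norm (affine_sum \<delta>))\<^sup>2) = of_real (real (p ^ m) ^ 2)"
    by (simp only: of_real_sum of_real_power of_real_of_nat_eq)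
  then have total: "(\<Sum>\<delta>\<in>UNIV. (norm (affine_sum \<delta>))\<^sup>2) = real (p ^ m) ^ 2"
    by (simp only: of_real_eq_iff)
  have "(\<Sum>\<delta>\<in>range L. (norm (affine_sum \<delta>))\<^sup>2) = (\<Sum>\<delta>\<in>range L. real (p ^ m * card radical))"
  proof (rule sum.cong[OF refl])
    fix \<delta> assume "\<delta> \<in> range L"
    then obtain a where a: "\<delta> = L a" by blast
    show "(norm (affine_sum \<delta>))\<^sup>2 = real (p ^ m * card radical)" unfolding a L by (rule T)
  qed
  also have "\<dots> = real (card (range L) * card radical) * real (p ^ m)"
    by (simp only: sum_constant of_nat_mult mult_ac)
  also have "\<dots> = real (p ^ m) ^ 2" by (simp only: card_range_L power2_eq_square)
  finally have "(\<Sum>\<delta>\<in>UNIV - range L. (norm (affine_sum \<delta>))\<^sup>2) = 0"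
    using total by (subst sum_diff) (simp_all only: finite subset_UNIV diff_self)
  then have "\<forall>\<delta>\<in>UNIV - range L. (norm (affine_sum \<delta>))\<^sup>2 = 0"
    by (subst (asm) sum_nonneg_eq_0_iff) auto
  moreover have "affine_sum (L a) \<noteq> 0" for a using L[of a] T0 by auto
  ultimately show ?thesis by auto
qed

text \<open>By \<open>affine_sum_L\<close> the phase at \<open>L a\<close> is \<open>- R a\<close>.
  Counting \<delta> is thus counting the \<open>a\<close> with \<open>R a = - z\<close>, where each
  \<delta> arises from a whole coset of the radical.\<close>

lemma card_affine_sum_eq:
  assumes z: "z \<in> prime_field"
  shows "card {\<delta>. affine_sum \<delta> = form_sum * add_char z} * card radical = card {a. R a = - z}"
proof -
  let ?D = "{\<delta>. affine_sum \<delta> = form_sum * add_char z}"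
  have T0: "form_sum \<noteq> 0"
    using affine_sum_L[of 0] affine_sum_eq_0_iff[of "L 0"] by auto
  have "add_char z \<noteq> 0" using norm_add_char[of z] by (metis norm_zero zero_neq_one)
  then have "?D \<subseteq> range L"
    using T0 affine_sum_eq_0_iff by (metis (mono_tags, lifting) mem_Collect_eq mult_eq_0_iff subsetI)
  then have "card ?D * card radical = card {a. L a \<in> ?D}"
    by (rule card_L_vimage[symmetric])
  also have "{a. L a \<in> ?D} = {a. R a = - z}"
  proof -
    have "affine_sum (L a) = form_sum * add_char z \<longleftrightarrow> R a = - z" for a
    proof -
      have "affine_sum (L a) = form_sum * add_char z \<longleftrightarrow> add_char (- R a) = add_char z"
        using T0 by (simp add: affine_sum_L add_char_minus)
      also have "\<dots> \<longleftrightarrow> - R a = z" using z add_char_inj[of "- R a" z] by auto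
      finally show ?thesis by auto
    qed
    then show ?thesis by simp
  qed
  finally show ?thesis .
qed

lemma affine_sum_values:
  assumes "affine_sum \<delta> \<noteq> 0"
  shows "\<exists>z\<in>prime_field. affine_sum \<delta> = form_sum * add_char z"
proof -
  obtain a where "\<delta> = L a" using assms affine_sum_eq_0_iff by blast
  then show ?thesis
    using affine_sum_L[of a] by (intro bexI[of _ "- R a"]) (auto simp: add_char_minus)
qed

lemma card_affine_sum_eq_0: "card {\<delta>. affine_sum \<delta> = 0} = p ^ m - card (range L)"
proof -
  have "{\<delta>. affine_sum \<delta> = 0} = UNIV - range L" by (auto simp: affine_sum_eq_0_iff)
  then show ?thesis by (simp add: card_Diff_subset card_field)
qed

text \<open>Orthogonality over the prime field brings in the sums of all multiples
  \<open>t * R\<close>; this is why the multiplier \<open>t\<close> was followed through the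
  orthogonal splitting.\<close>

lemma card_level_set:
  assumes z: "z \<in> prime_field"
  shows "of_nat (p * card {a. R a = z})
    = of_nat (p ^ m) + (\<Sum>t\<in>prime_field - {0}. add_char (t * - z) * (\<Sum>x\<in>UNIV. add_char (t * R x)))"
proof -
  have "of_nat (p * card {a. R a = z}) = (\<Sum>x\<in>UNIV. if R x = z then of_nat p else 0 :: complex)"
    by (simp add: sum.If_cases)
  also have "\<dots> = (\<Sum>x\<in>UNIV. \<Sum>t\<in>prime_field. add_char (t * (R x - z)))"
    using z by (intro sum.cong) (auto simp: sum_add_char)
  also have "\<dots> = (\<Sum>t\<in>prime_field. \<Sum>x\<in>UNIV. add_char (t * (R x - z)))"
    by (rule sum.swap)
  also have "\<dots> = (\<Sum>t\<in>prime_field. add_char (t * - z) * (\<Sum>x\<in>UNIV. add_char (t * R x)))"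
    unfolding sum_distrib_left
  proof (intro sum.cong refl)
    fix t x assume t: "t \<in> prime_field"
    have "t * (R x - z) = t * - z + t * R x" by (simp add: algebra_simps)
    then show "add_char (t * (R x - z)) = add_char (t * - z) * add_char (t * R x)"
      using t z by (simp only: add_char_add prime_field_mult prime_field_minus R_in)
  qed
  finally show ?thesis
    by (subst (asm) sum.remove[of _ 0]) (auto simp: card_field)
qed

text \<open>The factor \<open>sqrt_pstar p\<close> turns \<open>quad_char t\<close> into the Gauss
  sum with coefficient \<open>t\<close>; the sum over \<open>t\<close> then detects
  \<open>c\<^sup>2 = z\<close>, and square roots are counted.\<close>

lemma sum_add_char_quad_char:
  assumes z: "z \<in> prime_field"
  shows "(\<Sum>t\<in>prime_field - {0}. add_char (t * - z) * of_int (quad_char t)) * sqrt_pstar p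
    = of_nat p * of_int (quad_char z)"
proof -
  have "(\<Sum>t\<in>prime_field - {0}. add_char (t * - z) * of_int (quad_char t)) * sqrt_pstar p
      = (\<Sum>t\<in>prime_field - {0}. \<Sum>c\<in>prime_field. add_char (t * (c\<^sup>2 - z)))"
    unfolding sum_distrib_right
  proof (rule sum.cong[OF refl])
    fix t assume t: "t \<in> prime_field - {0}"
    have "add_char (t * - z) * of_int (quad_char t) * sqrt_pstar p
        = add_char (t * - z) * (\<Sum>c\<in>prime_field. add_char (t * c\<^sup>2))"
      using t by (simp add: gauss_sum)
    also have "\<dots> = (\<Sum>c\<in>prime_field. add_char (t * (c\<^sup>2 - z)))"
      unfolding sum_distrib_left
    proof (rule sum.cong[OF refl])
      fix c assume c: "c \<in> prime_field"
      have "t * (c\<^sup>2 - z) = t * - z + t * c\<^sup>2" by (simp add: algebra_simps)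
      then show "add_char (t * - z) * add_char (t * c\<^sup>2) = add_char (t * (c\<^sup>2 - z))"
        using t z c by (simp only: add_char_add prime_field_mult prime_field_minus prime_field_pow DiffD1)
    qed
    finally show "add_char (t * - z) * of_int (quad_char t) * sqrt_pstar p
        = (\<Sum>c\<in>prime_field. add_char (t * (c\<^sup>2 - z)))" .
  qed
  also have "\<dots> = (\<Sum>t\<in>prime_field. \<Sum>c\<in>prime_field. add_char (t * (c\<^sup>2 - z))) - of_nat p"
    by (simp add: sum_diff1 card_prime_field)
  also have "(\<Sum>t\<in>prime_field. \<Sum>c\<in>prime_field. add_char (t * (c\<^sup>2 - z)))
      = (\<Sum>c\<in>prime_field. \<Sum>t\<in>prime_field. add_char (t * (c\<^sup>2 - z)))"
    by (rule sum.swap)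
  also have "\<dots> = (\<Sum>c\<in>prime_field. if c\<^sup>2 = z then of_nat p else 0)"
    using z by (intro sum.cong) (auto simp: sum_add_char)
  also have "\<dots> = of_nat p * of_nat (card {c \<in> prime_field. c\<^sup>2 = z})"
    by (simp add: sum.If_cases Int_def)
  also have "(of_nat (card {c \<in> prime_field. c\<^sup>2 = z}) :: complex) = of_int (1 + quad_char z)"
    using card_sqrt[OF z] by (metis of_int_of_nat_eq)
  finally show ?thesis by (simp add: algebra_simps)
qed

text \<open>Orthogonal splitting yields some \<open>i\<close>. Comparing its squared modulus with
  \<open>form_sum_mult_cnj\<close> identifies it as the dimension of the radical.\<close>

lemma form_sum_classification:
  "\<exists>i\<le>m. \<exists>\<epsilon>\<in>{1, - 1}. form_sum = form_value p m \<epsilon> i \<and> card radical = p ^ i \<and>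
    (\<forall>t\<in>prime_field - {0}. (\<Sum>x\<in>UNIV. add_char (t * R x)) = of_int (quad_char t ^ (m - i)) * form_sum)"
proof -
  obtain i \<epsilon> where *: "i \<le> m" "\<epsilon> \<in> {1, - 1 :: int}"
    "\<forall>t\<in>prime_field - {0}. (\<Sum>x\<in>UNIV. add_char (t * R x))
      = of_int (\<epsilon> * quad_char t ^ (m - i)) * sqrt_pstar p ^ (m - i) * of_nat (p ^ i)"
    using exp_sum_multiples by (elim exE bexE conjE) (rule that)
  have "1 \<in> squares" unfolding squares_def by (rule image_eqI[of _ _ 1]) auto
  then have qc1: "quad_char 1 = 1" by (simp add: quad_char_def)
  have T: "form_sum = of_int \<epsilon> * sqrt_pstar p ^ (m - i) * of_nat (p ^ i)"
    using *(3)[rule_format, of 1] by (simp add: form_sum_def qc1)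
  obtain \<epsilon>' where e: "\<epsilon>' \<in> {1, - 1}" "form_sum = form_value p m \<epsilon>' i"
    unfolding T using mult_sqrt_pstar_eq_form_value[OF odd_p *(1,2)] by blast
  have "real p ^ (m + i) = real (p ^ m * card radical)"
  proof -
    have "complex_of_real (real p ^ (m + i)) = of_real (real (p ^ m * card radical))"
      using form_sum_mult_cnj norm_form_value[OF *(1) e(1)] p_gt_1
      by (simp add: e(2) flip: complex_norm_square)
    then show ?thesis by (simp only: of_real_eq_iff)
  qed
  then have "card radical = p ^ i" using p_gt_1 by (simp add: power_add)
  moreover have "\<forall>t\<in>prime_field - {0}.
      (\<Sum>x\<in>UNIV. add_char (t * R x)) = of_int (quad_char t ^ (m - i)) * form_sum"
    using *(3) unfolding T by simp
  ultimately show ?thesis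
    by (intro exI[of _ i] conjI *(1) bexI[of _ \<epsilon>'] e)
qed

context
  fixes i \<epsilon>
  assumes i: "i \<le> m" and \<epsilon>: "\<epsilon> \<in> {1, - 1}" and form_sum_eq: "form_sum = form_value p m \<epsilon> i"
begin

text \<open>The modulus of the given \<open>form_sum\<close> forces \<open>i\<close> to be the
  number supplied by \<open>form_sum_classification\<close>, whose conclusions then carry
  over.\<close>

lemma card_radical: "card radical = p ^ i"
  and form_sum_multiple: "t \<in> prime_field - {0} \<Longrightarrow>
      (\<Sum>x\<in>UNIV. add_char (t * R x)) = of_int (quad_char t ^ (m - i)) * form_sum"
proof -
  obtain i' \<epsilon>' where *: "i' \<le> m" "\<epsilon>' \<in> {1, - 1}" "form_sum = form_value p m \<epsilon>' i'"
    "card radical = p ^ i'"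
    "\<forall>t\<in>prime_field - {0}.
      (\<Sum>x\<in>UNIV. add_char (t * R x)) = of_int (quad_char t ^ (m - i')) * form_sum"
    using form_sum_classification by (elim exE bexE conjE) (rule that)
  have "real p ^ (m + i) = real p ^ (m + i')"
    using norm_form_value[OF i \<epsilon>, of p] norm_form_value[OF *(1,2), of p] *(3) form_sum_eq p_gt_1 by simp
  then have "i' = i" using p_gt_1 by simp
  then show "card radical = p ^ i"
    "t \<in> prime_field - {0} \<Longrightarrow>
      (\<Sum>x\<in>UNIV. add_char (t * R x)) = of_int (quad_char t ^ (m - i)) * form_sum"
    using *(4,5) by auto
qed

lemma card_affine_sum_eq_0': "real (card {\<delta>. affine_sum \<delta> = 0}) = real p ^ m - real p ^ (m - i)"
proof -
  have "card (range L) * p ^ i = p ^ (m - i) * p ^ i"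
    using card_range_L i by (simp add: card_radical flip: power_add)
  then have "card (range L) = p ^ (m - i)" using p_gt_1 by simp
  moreover have "p ^ (m - i) \<le> p ^ m" using p_gt_1 by (intro power_increasing) auto
  ultimately show ?thesis by (simp add: card_affine_sum_eq_0 of_nat_diff)
qed

lemma card_affine_sum_odd_rank:
  assumes odd: "odd (m - i)" and z: "z \<in> prime_field"
  shows "real (card {\<delta>. affine_sum \<delta> = form_sum * add_char z})
    = real p ^ (m - i - 1) + of_int \<epsilon> * of_int (quad_char (- z)) * real p ^ ((m - i - 1) div 2)"
proof -
  define c where "c = card {\<delta>. affine_sum \<delta> = form_sum * add_char z}"
  define h where "h = (m - i - 1) div 2"
  have "m - i = 2 * h + 1" using odd unfolding h_def by presburger
  then have h: "m - i - 1 = 2 * h" "m = 2 * h + i + 1" using i by simp_all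
  then have "m + i - 1 = 2 * (h + i)" by simp
  then have h': "(m + i - 1) div 2 = h + i" by simp
  have N: "card {a. R a = - z} = c * p ^ i"
    using card_affine_sum_eq[OF z] by (simp add: c_def card_radical)
  have g0: "sqrt_pstar p \<noteq> 0" using sqrt_pstar_neq_0 p_gt_1 by simp
  have T: "form_sum = of_int \<epsilon> * sqrt_pstar p * of_nat p ^ (h + i)"
    unfolding form_sum_eq form_value_def if_P[OF odd] h' ..
  \<comment> \<open>Multiplied by \<open>sqrt_pstar p\<close> so that
    \<open>sum_add_char_quad_char\<close> applies; the factor is cancelled at the end.\<close>
  have "of_nat (p * (c * p ^ i)) * sqrt_pstar p = of_nat (p ^ m) * sqrt_pstar p +
      (\<Sum>t\<in>prime_field - {0}. add_char (t * - (- z)) * (of_int (quad_char t) * form_sum)) * sqrt_pstar p"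
  proof -
    have "(\<Sum>t\<in>prime_field - {0}. add_char (t * - (- z)) * (\<Sum>x\<in>UNIV. add_char (t * R x)))
        = (\<Sum>t\<in>prime_field - {0}. add_char (t * - (- z)) * (of_int (quad_char t) * form_sum))"
    proof (rule sum.cong[OF refl])
      fix t assume t: "t \<in> prime_field - {0}"
      have "quad_char t ^ (m - i) = quad_char t"
        using odd t by (auto simp: quad_char_def)
      then show "add_char (t * - (- z)) * (\<Sum>x\<in>UNIV. add_char (t * R x))
          = add_char (t * - (- z)) * (of_int (quad_char t) * form_sum)"
        using form_sum_multiple[OF t] by simp
    qed
    then show ?thesis
      using card_level_set[of "- z"] z unfolding N by (simp only: prime_field_minus distrib_right)
  qed
  also have "(\<Sum>t\<in>prime_field - {0}. add_char (t * - (- z)) * (of_int (quad_char t) * form_sum)) * sqrt_pstar p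
      = form_sum * ((\<Sum>t\<in>prime_field - {0}. add_char (t * - (- z)) * of_int (quad_char t)) * sqrt_pstar p)"
    by (simp add: sum_distrib_left sum_distrib_right mult_ac)
  also have "(\<Sum>t\<in>prime_field - {0}. add_char (t * - (- z)) * of_int (quad_char t)) * sqrt_pstar p
      = of_nat p * of_int (quad_char (- z))"
    using z by (intro sum_add_char_quad_char) auto
  finally have "(of_nat p * of_nat p ^ i * sqrt_pstar p) * of_nat c = (of_nat p * of_nat p ^ i * sqrt_pstar p) *
      (of_nat p ^ (2 * h) + of_int \<epsilon> * of_int (quad_char (- z)) * of_nat p ^ h)"
    unfolding T by (simp add: h(2) power_add algebra_simps)
  then have "of_nat c = (of_nat p ^ (2 * h) + of_int \<epsilon> * of_int (quad_char (- z)) * of_nat p ^ h :: complex)"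
    using g0 p_gt_1 by (subst (asm) mult_left_cancel) auto
  then have "complex_of_real (real c)
      = of_real (real p ^ (2 * h) + of_int \<epsilon> * of_int (quad_char (- z)) * real p ^ h)" by simp
  then show ?thesis unfolding c_def[symmetric] h(1) by (simp only: of_real_eq_iff) simp
qed

text \<open>In even rank all nonzero multiples of the form have the same sum. Only a plain character
  sum over \<open>t\<close> remains, which sees whether \<open>z\<close> is 0 and nothing
  else.\<close>

lemma card_affine_sum_even_rank:
  assumes even: "even (m - i)" "i < m" and z: "z \<in> prime_field"
  shows "real (card {\<delta>. affine_sum \<delta> = form_sum * add_char z})
    = real p ^ (m - i - 1) + of_int \<epsilon> * ((if z = 0 then real p else 0) - 1) * real p ^ ((m - i - 2) div 2)"
proof -
  define c where "c = card {\<delta>. affine_sum \<delta> = form_sum * add_char z}"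
  define h where "h = (m - i - 2) div 2"
  have "m - i \<noteq> 0" using even by simp
  then have "m - i = 2 * h + 2" using even(1) unfolding h_def by presburger
  then have h: "m - i - 1 = 2 * h + 1" "m = 2 * h + i + 2" using i by simp_all
  then have "m + i = 2 * (h + i + 1)" by simp
  then have h': "(m + i) div 2 = h + i + 1" by simp
  have N: "card {a. R a = - z} = c * p ^ i"
    using card_affine_sum_eq[OF z] by (simp add: c_def card_radical)
  have T: "form_sum = of_int \<epsilon> * of_nat p ^ (h + i + 1)"
    using even by (simp add: form_sum_eq form_value_def h')
  have "of_nat (p * (c * p ^ i)) = of_nat (p ^ m) +
      (\<Sum>t\<in>prime_field - {0}. add_char (t * - (- z)) * form_sum)"
  proof -
    have "(\<Sum>t\<in>prime_field - {0}. add_char (t * - (- z)) * (\<Sum>x\<in>UNIV. add_char (t * R x)))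
        = (\<Sum>t\<in>prime_field - {0}. add_char (t * - (- z)) * form_sum)"
    proof (rule sum.cong[OF refl])
      fix t assume t: "t \<in> prime_field - {0}"
      have "quad_char t ^ (m - i) = 1"
        using even t by (auto simp: quad_char_def)
      then show "add_char (t * - (- z)) * (\<Sum>x\<in>UNIV. add_char (t * R x)) = add_char (t * - (- z)) * form_sum"
        using form_sum_multiple[OF t] by simp
    qed
    then show ?thesis
      using card_level_set[of "- z"] z unfolding N by (simp only: prime_field_minus)
  qed
  also have "(\<Sum>t\<in>prime_field - {0}. add_char (t * - (- z)) * form_sum)
      = ((\<Sum>t\<in>prime_field. add_char (t * z)) - 1) * form_sum"
    by (simp add: sum_diff1 flip: sum_distrib_right)
  also have "(\<Sum>t\<in>prime_field. add_char (t * z)) = (if z = 0 then of_nat p else 0)"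
    using z by (rule sum_add_char)
  finally have "(of_nat p * of_nat p ^ i) * of_nat c = (of_nat p * of_nat p ^ i) *
      (of_nat p ^ (2 * h + 1) + of_int \<epsilon> * ((if z = 0 then of_nat p else 0) - 1) * of_nat p ^ h :: complex)"
    unfolding T by (simp add: h(2) power_add algebra_simps)
  then have "of_nat c = (of_nat p ^ (2 * h + 1) + of_int \<epsilon> * ((if z = 0 then of_nat p else 0) - 1) * of_nat p ^ h :: complex)"
    using p_gt_1 by (subst (asm) mult_left_cancel) auto
  then have "complex_of_real (real c)
      = of_real (real p ^ (2 * h + 1) + of_int \<epsilon> * ((if z = 0 then real p else 0) - 1) * real p ^ h)" by simp
  then show ?thesis unfolding c_def[symmetric] h(1) h_def[symmetric] by (simp only: of_real_eq_iff)
qed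

end

end

section \<open>The family of quadratic forms\<close>

text \<open>Abel summation. When the coefficients sum to 0, it divides a polynomial in
  \<open>sig\<close> by \<open>sig - 1\<close>.\<close>

lemma sum_by_parts:
  fixes b y :: "nat \<Rightarrow> 'a::comm_ring_1"
  shows "(\<Sum>j\<le>n. b j * y j)
    = (\<Sum>j\<le>n. b j) * y 0 + (\<Sum>j<n. (\<Sum>i\<in>{j<..n}. b i) * (y (Suc j) - y j))"
proof (induction n)
  case (Suc n)
  have "(\<Sum>j<Suc n. (\<Sum>i\<in>{j<..Suc n}. b i) * (y (Suc j) - y j))
      = (\<Sum>j<Suc n. (\<Sum>i\<in>{j<..n}. b i) * (y (Suc j) - y j) + b (Suc n) * (y (Suc j) - y j))"
  proof (rule sum.cong[OF refl])
    fix j assume "j \<in> {..<Suc n}"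
    then have "{j<..Suc n} = insert (Suc n) {j<..n}" by auto
    then show "(\<Sum>i\<in>{j<..Suc n}. b i) * (y (Suc j) - y j)
        = (\<Sum>i\<in>{j<..n}. b i) * (y (Suc j) - y j) + b (Suc n) * (y (Suc j) - y j)"
      by (simp add: algebra_simps)
  qed
  also have "\<dots> = (\<Sum>j<n. (\<Sum>i\<in>{j<..n}. b i) * (y (Suc j) - y j)) + b (Suc n) * (y (Suc n) - y 0)"
    by (simp only: sum.distrib sum_distrib_left[symmetric] sum_lessThan_telescope) simp
  finally show ?case using Suc by (simp add: algebra_simps)
qed simp

lemma card_le_mult_fibers:
  assumes "finite A" "finite C" "f ` A \<subseteq> C" "\<And>c. c \<in> C \<Longrightarrow> card {x \<in> A. f x = c} \<le> n"
  shows "card A \<le> n * card C"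
proof -
  have "card A = (\<Sum>c\<in>C. card {x \<in> A. f x = c})"
    using sum.group[OF assms(1-3), of "\<lambda>_. 1 :: nat"] by simp
  also have "\<dots> \<le> (\<Sum>c\<in>C. n)" using assms(4) by (rule sum_mono)
  finally show ?thesis by (simp add: mult.commute)
qed

section \<open>The automorphism \<sigma> and polynomials in it\<close>

locale frobenius_twist = odd_prime_power_field p m ty
  for p m and ty :: "'a::finite_field itself" +
  fixes k :: nat
  assumes coprime_mk: "coprime m k" and odd_m: "odd m"
begin

definition sig :: "'a \<Rightarrow> 'a" where
  "sig x = x ^ p ^ k"

lemma sig_add: "sig (x + y) = sig x + sig y"
  and sig_diff: "sig (x - y) = sig x - sig y"
  and sig_minus: "sig (- x) = - sig x"
  and sig_mult: "sig (x * y) = sig x * sig y"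
  by (simp_all add: sig_def frobenius_add frobenius_diff frobenius_minus power_mult_distrib)

lemma sig_eq_0_iff [simp]: "sig x = 0 \<longleftrightarrow> x = 0"
  using p_gt_1 by (simp add: sig_def)

lemma sig_0 [simp]: "sig 0 = 0"
  by simp

lemma sig_prime_field: "c \<in> prime_field \<Longrightarrow> sig c = c"
  by (simp add: sig_def prime_field_power)

lemma sig_numeral: "sig (numeral n) = numeral n"
  using sig_prime_field[OF prime_field_of_nat[of "numeral n"]] by simp

lemma funpow_sig: "(sig ^^ j) x = x ^ p ^ (k * j)"
  by (induction j arbitrary: x) (simp_all add: sig_def power_add mult.commute flip: power_mult funpow_swap1)

text \<open>By Bezout, \<open>k * u = m * v + 1\<close> for some \<open>u\<close> and
  \<open>v\<close>, so an iterate of \<open>sig\<close> is the map \<open>x ^ p\<close>.\<close>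

lemma sig_fixed: "sig x = x \<longleftrightarrow> x \<in> prime_field"
proof
  assume x: "sig x = x"
  have *: "(sig ^^ j) x = x" for j by (induction j) (simp_all add: x)
  show "x \<in> prime_field"
  \<comment> \<open>Coprimality permits \<open>k = 0\<close> only for \<open>m = 1\<close>, and
    \<open>bezout_nat\<close> needs a nonzero \<open>k\<close>.\<close>
  proof (cases "m = 1")
    case True
    then show ?thesis
      using finite_field_power_card_eq_same[of x] by (simp add: prime_field_def card_field)
  next
    case False
    have "k \<noteq> 0" using coprime_mk False by (intro notI) simp
    then obtain u v where uv: "k * u = m * v + gcd k m" using bezout_nat by blast
    moreover have "gcd k m = 1" using coprime_mk by (simp add: coprime_iff_gcd_eq_1 gcd.commute)
    ultimately have "x = (x ^ p ^ (m * v)) ^ p"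
      using *[of u] by (simp add: funpow_sig power_add mult.commute flip: power_mult)
    also have "x ^ p ^ (m * v) = x"
      by (rule finite_field_power_card_power_eq_same[of _ v]) (simp add: card_field power_mult)
    finally show ?thesis by (simp add: prime_field_def)
  qed
qed (rule sig_prime_field)

text \<open>The ordinary degree would only give \<open>p ^ (k * d)\<close>. Instead the order is
  reduced as for differential equations: with a nonzero root \<open>u\<close>, the substitution
  \<open>x = u * y\<close> makes 1 a root, so the operator factors through \<open>sig - 1\<close>,
  whose kernel has just \<open>p\<close> elements.\<close>

lemma card_sig_polynomial_roots:
  assumes "\<exists>j\<le>d. a j \<noteq> 0"
  shows "card {x. (\<Sum>j\<le>d. a j * (sig ^^ j) x) = 0} \<le> p ^ d"
  using assms
proof (induction d arbitrary: a)
  case 0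
  then have "{x. (\<Sum>j\<le>0. a j * (sig ^^ j) x) = 0} = {0}" by auto
  then show ?case by simp
next
  case (Suc d)
  let ?K = "{x. (\<Sum>j\<le>Suc d. a j * (sig ^^ j) x) = 0}"
  show ?case
  proof (cases "?K \<subseteq> {0}")
    case True
    then have "card ?K \<le> card {0 :: 'a}" by (intro card_mono) auto
    also have "\<dots> \<le> p ^ Suc d" using p_gt_1 by simp
    finally show ?thesis .
  next
    case False
    then obtain u where u: "u \<in> ?K" "u \<noteq> 0" by blast
    \<comment> \<open>\<open>b\<close> are the coefficients after the substitution, with sum 0
      because \<open>u\<close> is a root; \<open>c\<close> are their tails, the coefficients of the
      quotient by \<open>sig - 1\<close>.\<close>
    define b where "b j = a j * (sig ^^ j) u" for j
    define c where "c j = (\<Sum>i\<in>{j<..Suc d}. b i)" for j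
    have pow0: "(sig ^^ j) u \<noteq> 0" for j using u(2) p_gt_1 by (simp add: funpow_sig)
    have sum_b: "(\<Sum>j\<le>Suc d. b j) = 0" using u(1) by (simp add: b_def)
    have c_ex: "\<exists>j\<le>d. c j \<noteq> 0"
    proof (rule ccontr)
      assume "\<not> ?thesis"
      then have c0: "c j = 0" if "j \<le> Suc d" for j
        using that by (cases "j = Suc d") (auto simp: c_def)
      have b: "b (Suc j) = 0" if "j \<le> d" for j
      proof -
        have "{j<..Suc d} = insert (Suc j) {Suc j<..Suc d}" using that by auto
        then have "c j = b (Suc j) + c (Suc j)" by (simp add: c_def)
        then show ?thesis using c0[of j] c0[of "Suc j"] that by simp
      qed
      then have "(\<Sum>j\<le>Suc d. b j) = b 0"
        unfolding sum.atMost_Suc_shift by simp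
      then have "b 0 = 0" using sum_b by simp
      with b have "b j = 0" if "j \<le> Suc d" for j
        using that by (cases j) auto
      then show False using Suc.prems pow0 by (auto simp: b_def)
    qed
    have key: "(\<Sum>j\<le>d. c j * (sig ^^ j) (sig (x / u) - x / u)) = 0" if "x \<in> ?K" for x
    proof -
      have "0 = (\<Sum>j\<le>Suc d. b j * (sig ^^ j) (x / u))"
        using that u(2) p_gt_1 by (simp add: b_def funpow_sig power_divide)
      also have "\<dots> = (\<Sum>j<Suc d. c j * ((sig ^^ Suc j) (x / u) - (sig ^^ j) (x / u)))"
        unfolding sum_by_parts[of b] sum_b by (simp add: c_def)
      also have "\<dots> = (\<Sum>j\<le>d. c j * (sig ^^ j) (sig (x / u) - x / u))"
        unfolding lessThan_Suc_atMost
        by (intro sum.cong) (simp_all add: funpow_swap1, simp add: funpow_sig frobenius_diff)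
      finally show ?thesis by simp
    qed
    have "card ?K \<le> p * card {x. (\<Sum>j\<le>d. c j * (sig ^^ j) x) = 0}"
    proof (rule card_le_mult_fibers)
      show "(\<lambda>x. sig (x / u) - x / u) ` ?K \<subseteq> {x. (\<Sum>j\<le>d. c j * (sig ^^ j) x) = 0}"
        using key by blast
      fix z
      let ?F = "{x \<in> ?K. sig (x / u) - x / u = z}"
      show "card ?F \<le> p"
      proof (cases "?F = {}")
        case True
        then show ?thesis by (simp only: card.empty)
      next
        case False
        then obtain w where w: "sig (w / u) - w / u = z" by blast
        have "?F \<subseteq> (\<lambda>t. w + t * u) ` prime_field"
        proof
          fix x assume "x \<in> ?F"
          then have "sig (x / u) - x / u = sig (w / u) - w / u" using w by simp
          then have "sig (x / u - w / u) = x / u - w / u" by (simp add: sig_diff algebra_simps)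
          then have "x / u - w / u \<in> prime_field" by (simp add: sig_fixed)
          moreover have "x = w + (x / u - w / u) * u" using u(2) by (simp add: field_simps)
          ultimately show "x \<in> (\<lambda>t. w + t * u) ` prime_field" by (rule rev_image_eqI)
        qed
        then have "card ?F \<le> card ((\<lambda>t. w + t * u) ` prime_field)" by (intro card_mono) auto
        also have "\<dots> \<le> p" using card_image_le[of prime_field] by (simp add: card_prime_field)
        finally show ?thesis .
      qed
    qed auto
    also have "\<dots> \<le> p * p ^ d" using Suc.IH[OF c_ex] by simp
    finally show ?thesis by simp
  qed
qed

section \<open>The trace forms and their polar operators\<close>

text \<open>The \<open>m\<close>-th iterate of \<open>sig\<close> is the identity, so its inverse is
  the iterate before that.\<close>

definition sig_inv :: "'a \<Rightarrow> 'a" where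
  "sig_inv x = x ^ p ^ (k * (m - 1))"

lemma sig_sig_inv [simp]: "sig (sig_inv x) = x"
proof -
  have "k * (m - 1) + k = m * k" using m_pos by (cases m) auto
  then have "sig (sig_inv x) = x ^ p ^ (m * k)"
    unfolding sig_def sig_inv_def by (simp flip: power_mult power_add)
  also have "\<dots> = x"
    by (rule finite_field_power_card_power_eq_same[of _ k]) (simp add: card_field power_mult)
  finally show ?thesis .
qed

lemma sig_inv_add: "sig_inv (x + y) = sig_inv x + sig_inv y"
  by (simp add: sig_inv_def frobenius_add)

lemma tr_sig_adjoint: "tr (x * sig y) = tr (sig_inv x * y)"
proof -
  have "tr (sig_inv x * y) = tr (sig (sig_inv x * y))"
    unfolding sig_def by (rule tr_frobenius[symmetric])
  then show ?thesis by (simp add: sig_mult)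
qed

definition quad :: "'a \<Rightarrow> 'a \<Rightarrow> 'a \<Rightarrow> 'a \<Rightarrow> 'a" where
  "quad \<alpha> \<beta> \<gamma> x = \<alpha> * (x * sig (sig x)) + \<beta> * (x * sig x) + \<gamma> * (x * x)"

definition polar :: "'a \<Rightarrow> 'a \<Rightarrow> 'a \<Rightarrow> 'a \<Rightarrow> 'a \<Rightarrow> 'a" where
  "polar \<alpha> \<beta> \<gamma> x y = \<alpha> * (x * sig (sig y) + y * sig (sig x)) + \<beta> * (x * sig y + y * sig x)
    + \<gamma> * (2 * (x * y))"

text \<open>The polar form with every \<open>sig\<close> moved off the second argument by
  \<open>tr_sig_adjoint\<close>.\<close>

definition polar_op :: "'a \<Rightarrow> 'a \<Rightarrow> 'a \<Rightarrow> 'a \<Rightarrow> 'a" where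
  "polar_op \<alpha> \<beta> \<gamma> x = sig_inv (sig_inv (\<alpha> * x)) + \<alpha> * sig (sig x) + sig_inv (\<beta> * x) + \<beta> * sig x
    + 2 * \<gamma> * x"

lemma represented_quad:
  "represented_quadratic_form p m (\<lambda>x. tr (quad \<alpha> \<beta> \<gamma> x)) (\<lambda>x y. tr (polar \<alpha> \<beta> \<gamma> x y)) (polar_op \<alpha> \<beta> \<gamma>)"
proof
  show "tr (quad \<alpha> \<beta> \<gamma> x) \<in> prime_field" for x by simp
  show "tr (quad \<alpha> \<beta> \<gamma> (x + y)) = tr (quad \<alpha> \<beta> \<gamma> x) + tr (quad \<alpha> \<beta> \<gamma> y) + tr (polar \<alpha> \<beta> \<gamma> x y)" for x y
    unfolding tr_add[symmetric] by (rule arg_cong[where f = tr])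
      (simp add: quad_def polar_def sig_add algebra_simps)
  show "tr (quad \<alpha> \<beta> \<gamma> (c * x)) = c\<^sup>2 * tr (quad \<alpha> \<beta> \<gamma> x)" if "c \<in> prime_field" for c x
  proof -
    have "quad \<alpha> \<beta> \<gamma> (c * x) = c\<^sup>2 * quad \<alpha> \<beta> \<gamma> x"
      by (simp add: quad_def sig_mult sig_prime_field that power2_eq_square algebra_simps)
    then show ?thesis using that by (simp add: tr_scale)
  qed
  show "tr (polar \<alpha> \<beta> \<gamma> (x + y) z) = tr (polar \<alpha> \<beta> \<gamma> x z) + tr (polar \<alpha> \<beta> \<gamma> y z)" for x y z
    unfolding tr_add[symmetric] by (rule arg_cong[where f = tr])
      (simp add: polar_def sig_add algebra_simps)
  show "tr (polar \<alpha> \<beta> \<gamma> (c * x) z) = c * tr (polar \<alpha> \<beta> \<gamma> x z)" if "c \<in> prime_field" for c x z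
  proof -
    have "polar \<alpha> \<beta> \<gamma> (c * x) z = c * polar \<alpha> \<beta> \<gamma> x z"
      by (simp add: polar_def sig_mult sig_prime_field that algebra_simps)
    then show ?thesis using that by (simp add: tr_scale)
  qed
  show "polar_op \<alpha> \<beta> \<gamma> (x + y) = polar_op \<alpha> \<beta> \<gamma> x + polar_op \<alpha> \<beta> \<gamma> y" for x y
    by (simp add: polar_op_def distrib_left sig_add sig_inv_add algebra_simps)
  show "tr (polar \<alpha> \<beta> \<gamma> x y) = tr (polar_op \<alpha> \<beta> \<gamma> x * y)" for x y
  proof -
    have "tr (polar \<alpha> \<beta> \<gamma> x y)
        = tr ((\<alpha> * x) * sig (sig y)) + tr (\<alpha> * sig (sig x) * y) + tr ((\<beta> * x) * sig y)
          + tr (\<beta> * sig x * y) + tr (2 * \<gamma> * x * y)"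
      by (simp add: polar_def algebra_simps flip: tr_add)
    also have "tr ((\<alpha> * x) * sig (sig y)) = tr (sig_inv (sig_inv (\<alpha> * x)) * y)"
      by (simp only: tr_sig_adjoint)
    also have "tr ((\<beta> * x) * sig y) = tr (sig_inv (\<beta> * x) * y)"
      by (simp only: tr_sig_adjoint)
    finally show ?thesis by (simp add: polar_op_def distrib_right flip: tr_add)
  qed
qed

text \<open>Applying \<open>sig\<close> twice clears the inverses, leaving a polynomial of degree 4 in \<open>sig\<close>.\<close>
lemma card_polar_op_kernel:
  assumes "(\<alpha>, \<beta>, \<gamma>) \<noteq> (0, 0, 0)"
  shows "card {x. polar_op \<alpha> \<beta> \<gamma> x = 0} \<le> p ^ 4"
proof -
  define a where "a j = [\<alpha>, sig \<beta>, 2 * sig (sig \<gamma>), sig (sig \<beta>), sig (sig \<alpha>)] ! j" for j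
  have "sig (sig (polar_op \<alpha> \<beta> \<gamma> x)) = (\<Sum>j\<le>4. a j * (sig ^^ j) x)" for x
    by (simp add: polar_op_def sig_add sig_mult sig_numeral a_def eval_nat_numeral algebra_simps)
  then have "{x. polar_op \<alpha> \<beta> \<gamma> x = 0} = {x. (\<Sum>j\<le>4. a j * (sig ^^ j) x) = 0}"
    by (metis (no_types, lifting) sig_eq_0_iff)
  also have "card \<dots> \<le> p ^ 4"
  proof (rule card_sig_polynomial_roots)
    have "a 0 = \<alpha>" "a 1 = sig \<beta>" "a 2 = 2 * sig (sig \<gamma>)"
      by (simp_all add: a_def numeral_2_eq_2)
    then consider "a 0 \<noteq> 0" | "a 1 \<noteq> 0" | "a 2 \<noteq> 0"
      using assms two_neq_0 by auto
    then show "\<exists>j\<le>4. a j \<noteq> 0"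
    proof cases
      case 1 then show ?thesis by (intro exI[of _ 0]) simp
    next
      case 2 then show ?thesis by (intro exI[of _ 1]) simp
    next
      case 3 then show ?thesis by (intro exI[of _ 2]) simp
    qed
  qed
  finally show ?thesis .
qed

end

section \<open>Moments\<close>

context frobenius_twist
begin

text \<open>The coefficients \<alpha>, \<beta>, \<gamma> are packed into one triple so that a moment
  is a sum over a single type and \<open>sum_psi_dot3\<close> is its only orthogonality
  relation.\<close>

definition dot3 :: "'a \<times> 'a \<times> 'a \<Rightarrow> 'a \<times> 'a \<times> 'a \<Rightarrow> 'a" where
  "dot3 t v = fst t * fst v + fst (snd t) * fst (snd v) + snd (snd t) * snd (snd v)"

lemma dot3_add: "dot3 t (v + w) = dot3 t v + dot3 t w"
  by (simp add: dot3_def algebra_simps)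

lemma sum_psi_dot3: "(\<Sum>t\<in>UNIV. psi (dot3 t v)) = (if v = 0 then of_nat (p ^ m) ^ 3 else 0)"
proof -
  have "(\<Sum>t\<in>UNIV. psi (dot3 t v))
      = (\<Sum>x\<in>UNIV. psi (fst v * x)) * ((\<Sum>x\<in>UNIV. psi (fst (snd v) * x)) * (\<Sum>x\<in>UNIV. psi (snd (snd v) * x)))"
    by (simp add: dot3_def psi_add sum_product sum.cartesian_product case_prod_unfold mult_ac flip: UNIV_Times_UNIV)
  then show ?thesis
    by (simp add: sum_psi prod_eq_iff power3_eq_cube)
qed

lemma moment:
  fixes v :: "'b::finite \<Rightarrow> 'a \<times> 'a \<times> 'a"
  shows "(\<Sum>t\<in>UNIV. \<Sum>x\<in>UNIV. psi (dot3 t (v x))) = of_nat (p ^ m) ^ 3 * of_nat (card {x. v x = 0})"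
proof -
  have "(\<Sum>t\<in>UNIV. \<Sum>x\<in>UNIV. psi (dot3 t (v x))) = (\<Sum>x\<in>UNIV. \<Sum>t\<in>UNIV. psi (dot3 t (v x)))"
    by (rule sum.swap)
  then show ?thesis by (simp add: sum_psi_dot3 sum.If_cases)
qed

lemma sum_psi_dot3_mult:
  fixes v :: "'b::finite \<Rightarrow> 'a \<times> 'a \<times> 'a" and w :: "'c::finite \<Rightarrow> 'a \<times> 'a \<times> 'a"
  shows "(\<Sum>x\<in>UNIV. psi (dot3 t (v x))) * (\<Sum>y\<in>UNIV. psi (dot3 t (w y)))
    = (\<Sum>z\<in>UNIV. psi (dot3 t (v (fst z) + w (snd z))))"
  by (simp add: dot3_add psi_add sum_product sum.cartesian_product case_prod_unfold flip: UNIV_Times_UNIV)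

definition diag_vec :: "'a \<Rightarrow> 'a \<times> 'a \<times> 'a" where
  "diag_vec x = (x * sig (sig x), x * sig x, x * x)"

definition polar_vec :: "'a \<Rightarrow> 'a \<Rightarrow> 'a \<times> 'a \<times> 'a" where
  "polar_vec a b = (a * sig (sig b) + b * sig (sig a), a * sig b + b * sig a, 2 * (a * b))"

definition smult3 :: "'a \<Rightarrow> 'a \<times> 'a \<times> 'a \<Rightarrow> 'a \<times> 'a \<times> 'a" where
  "smult3 c v = (c * fst v, c * fst (snd v), c * snd (snd v))"

definition qsum :: "'a \<times> 'a \<times> 'a \<Rightarrow> complex" where
  "qsum t = (\<Sum>x\<in>UNIV. psi (dot3 t (diag_vec x)))"

lemma qsum_smult3: "qsum (smult3 c t) = (\<Sum>x\<in>UNIV. psi (dot3 t (smult3 c (diag_vec x))))"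
  unfolding qsum_def by (intro sum.cong) (simp_all add: dot3_def smult3_def mult_ac)

lemma cnj_qsum: "cnj (qsum t) = qsum (smult3 (- 1) t)"
  unfolding qsum_def cnj_sum
  by (intro sum.cong) (simp_all add: dot3_def smult3_def algebra_simps flip: psi_minus)

text \<open>The source of hyperbolic pairs: at \<open>x = a + b\<close> and \<open>y = a - b\<close>
  the difference of the two \<open>diag_vec\<close> is \<open>polar_vec a (2 * b)\<close>, in the
  coordinates with \<open>sig\<close> just as in \<open>x * x - y * y\<close>.\<close>

lemma qsum_mult_cnj:
  "qsum t * cnj (qsum t) = (\<Sum>z\<in>UNIV. psi (dot3 t (polar_vec (fst z) (snd z))))"
proof -
  have "(2 :: 'a) * 2 \<noteq> 0" "(2 :: 'a) * 2 * 2 \<noteq> 0"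
    by (simp_all only: mult_eq_0_iff two_neq_0 simp_thms)
  then have nz: "(4 :: 'a) \<noteq> 0" "(8 :: 'a) \<noteq> 0" by simp_all
  have "qsum t * cnj (qsum t)
      = (\<Sum>z\<in>UNIV. psi (dot3 t (diag_vec (fst z) + smult3 (- 1) (diag_vec (snd z)))))"
    unfolding cnj_qsum qsum_smult3 unfolding qsum_def by (simp only: sum_psi_dot3_mult)
  also have "\<dots> = (\<Sum>z\<in>UNIV. psi (dot3 t (polar_vec (fst z) (snd z))))"
  proof (rule sum.reindex_bij_witness[of _ "\<lambda>z. (fst z + snd z / 2, fst z - snd z / 2)"
        "\<lambda>z. ((fst z + snd z) / 2, fst z - snd z)"])
    fix z :: "'a \<times> 'a"
    define a b where "a = (fst z + snd z) / 2" and "b = (fst z - snd z) / 2"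
    have "a + b = fst z" "a - b = snd z"
      using two_neq_0 unfolding a_def b_def
      by (simp_all add: add_divide_distrib[symmetric] diff_divide_distrib[symmetric])
    then have z: "z = (a + b, a - b)" by (simp add: prod_eq_iff)
    have "diag_vec (a + b) + smult3 (- 1) (diag_vec (a - b)) = polar_vec a (2 * b)"
      by (simp add: diag_vec_def smult3_def polar_vec_def sig_add sig_diff sig_mult sig_numeral algebra_simps)
    moreover have "(fst z + snd z) / 2 = a" "fst z - snd z = 2 * b"
      using two_neq_0 by (simp_all add: a_def b_def)
    ultimately show "psi (dot3 t (polar_vec (fst ((fst z + snd z) / 2, fst z - snd z)) (snd ((fst z + snd z) / 2, fst z - snd z))))
        = psi (dot3 t (diag_vec (fst z) + smult3 (- 1) (diag_vec (snd z))))"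
      by (simp add: z)
  qed (use two_neq_0 nz in \<open>auto simp: field_simps prod_eq_iff\<close>)
  finally show ?thesis .
qed

lemma moment_1: "(\<Sum>t\<in>UNIV. qsum t) = of_nat (p ^ m) ^ 3"
proof -
  have "{x. diag_vec x = 0} = {0}" by (auto simp: diag_vec_def zero_prod_def)
  then show ?thesis unfolding qsum_def moment by simp
qed

text \<open>Solutions of \<open>polar_vec a b + N \<xi> = 0\<close> with \<open>a \<noteq> 0\<close>: after scaling \<open>\<xi>\<close> by \<open>1 / a\<close>, the last
  coordinate determines \<open>b\<close> and the other two become conditions on \<open>\<xi>\<close> alone.\<close>
lemma card_polar_vec_plus:
  fixes N0 N1 N2 :: "'b::finite \<Rightarrow> 'a" and scale :: "'a \<Rightarrow> 'b \<Rightarrow> 'b"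
  assumes scale_scale: "\<And>a b \<xi>. scale a (scale b \<xi>) = scale (a * b) \<xi>" and scale_1: "\<And>\<xi>. scale 1 \<xi> = \<xi>"
    and N0: "\<And>a \<xi>. N0 (scale a \<xi>) = a * a * N0 \<xi>"
    and N1: "\<And>a \<xi>. N1 (scale a \<xi>) = a * sig a * N1 \<xi>"
    and N2: "\<And>a \<xi>. N2 (scale a \<xi>) = a * sig (sig a) * N2 \<xi>"
  shows "card {z. polar_vec (fst (fst z)) (snd (fst z)) + (N2 (snd z), N1 (snd z), N0 (snd z)) = 0}
    = p ^ m * card {\<xi>. N0 \<xi> = 0 \<and> N1 \<xi> = 0 \<and> N2 \<xi> = 0}
      + (p ^ m - 1) * card {\<xi>. 2 * N1 \<xi> = N0 \<xi> + sig (N0 \<xi>) \<and> 2 * N2 \<xi> = N0 \<xi> + sig (sig (N0 \<xi>))}"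
    (is "card ?S = _ * card ?Z + _ * card ?G")
proof -
  define f where "f = (\<lambda>(a, \<xi>). ((a, - a * N0 \<xi> / 2), scale a \<xi>))"
  have S_iff: "((a, b), \<xi>) \<in> ?S \<longleftrightarrow> a * sig (sig b) + b * sig (sig a) + N2 \<xi> = 0
      \<and> a * sig b + b * sig a + N1 \<xi> = 0 \<and> 2 * (a * b) + N0 \<xi> = 0" for a b \<xi>
    by (simp add: polar_vec_def zero_prod_def)
  have f_in: "f (a, \<xi>) \<in> ?S \<longleftrightarrow> \<xi> \<in> ?G" if "a \<noteq> 0" for a \<xi>
  proof -
    define e where "e = - N0 \<xi> / 2"
    have e: "N0 \<xi> = - 2 * e" using two_neq_0 by (simp add: e_def)
    have "a * sig (a * e) + a * e * sig a + N1 (scale a \<xi>) = a * sig a * (sig e + e + N1 \<xi>)"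
      by (simp add: N1 sig_mult algebra_simps)
    moreover have "a * sig (sig (a * e)) + a * e * sig (sig a) + N2 (scale a \<xi>)
        = a * sig (sig a) * (sig (sig e) + e + N2 \<xi>)"
      by (simp add: N2 sig_mult algebra_simps)
    moreover have "2 * (a * (a * e)) + N0 (scale a \<xi>) = 0"
      unfolding N0 e by (simp add: algebra_simps)
    moreover have "f (a, \<xi>) = ((a, a * e), scale a \<xi>)" by (simp add: f_def e_def)
    ultimately have "f (a, \<xi>) \<in> ?S \<longleftrightarrow> sig (sig e) + e + N2 \<xi> = 0 \<and> sig e + e + N1 \<xi> = 0"
      by (simp only: S_iff mult_eq_0_iff sig_eq_0_iff that simp_thms)
    also have "\<dots> \<longleftrightarrow> 2 * (sig (sig e) + e + N2 \<xi>) = 0 \<and> 2 * (sig e + e + N1 \<xi>) = 0"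
      by (simp only: mult_eq_0_iff two_neq_0 simp_thms)
    also have "\<dots> \<longleftrightarrow> \<xi> \<in> ?G"
      by (auto simp: e sig_mult sig_minus sig_numeral algebra_simps eq_neg_iff_add_eq_0)
    finally show ?thesis .
  qed
  \<comment> \<open>For \<open>a = 0\<close> the variable \<open>b\<close> drops out of the
    equations and is free; only the vanishing of \<open>N0\<close>, \<open>N1\<close>,
    \<open>N2\<close> is required.\<close>
  have S: "?S = (\<lambda>(b, \<xi>). ((0, b), \<xi>)) ` (UNIV \<times> ?Z) \<union> f ` ((UNIV - {0}) \<times> ?G)"
  proof (intro equalityI subsetI)
    fix z assume z: "z \<in> ?S"
    obtain a b \<xi> where zz: "z = ((a, b), \<xi>)" by (metis surj_pair)
    show "z \<in> (\<lambda>(b, \<xi>). ((0, b), \<xi>)) ` (UNIV \<times> ?Z) \<union> f ` ((UNIV - {0}) \<times> ?G)"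
    proof (cases "a = 0")
      case True
      then show ?thesis using z unfolding zz S_iff by (intro UnI1 image_eqI[of _ _ "(b, \<xi>)"]) auto
    next
      case False
      define \<eta> where "\<eta> = scale (1 / a) \<xi>"
      have \<xi>: "\<xi> = scale a \<eta>" using False by (simp add: \<eta>_def scale_scale scale_1)
      have "2 * (a * b) + a * a * N0 \<eta> = 0" using z unfolding zz S_iff \<xi> N0 by blast
      then have "a * (2 * b + a * N0 \<eta>) = 0" by (simp add: algebra_simps)
      then have "2 * b + a * N0 \<eta> = 0" using False by simp
      then have "b = - a * N0 \<eta> / 2" using two_neq_0 by (simp add: field_simps eq_neg_iff_add_eq_0)
      then have "z = f (a, \<eta>)" by (simp add: zz f_def \<xi>)
      then show ?thesis using False z f_in[of a \<eta>] by (intro UnI2 image_eqI[of _ _ "(a, \<eta>)"]) auto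
    qed
  next
    fix z assume "z \<in> (\<lambda>(b, \<xi>). ((0, b), \<xi>)) ` (UNIV \<times> ?Z) \<union> f ` ((UNIV - {0}) \<times> ?G)"
    then show "z \<in> ?S"
    proof
      assume "z \<in> (\<lambda>(b, \<xi>). ((0, b), \<xi>)) ` (UNIV \<times> ?Z)"
      then obtain b \<xi> where "z = ((0, b), \<xi>)" "\<xi> \<in> ?Z" by auto
      then show ?thesis using S_iff[of 0 b \<xi>] by simp
    next
      assume "z \<in> f ` ((UNIV - {0}) \<times> ?G)"
      then obtain a \<xi> where "z = f (a, \<xi>)" "a \<noteq> 0" "\<xi> \<in> ?G" by blast
      then show ?thesis using f_in[of a \<xi>] by blast
    qed
  qed
  have "inj_on f ((UNIV - {0}) \<times> ?G)"
  proof (rule inj_onI)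
    fix x y assume xy: "x \<in> (UNIV - {0}) \<times> ?G" "y \<in> (UNIV - {0}) \<times> ?G" "f x = f y"
    obtain a \<xi> b \<eta> where ab: "x = (a, \<xi>)" "y = (b, \<eta>)" by (metis surj_pair)
    then have "a \<noteq> 0" "a = b" "scale a \<xi> = scale a \<eta>" using xy by (auto simp: f_def)
    then have "scale (1 / a) (scale a \<xi>) = scale (1 / a) (scale a \<eta>)" by simp
    then show "x = y" using \<open>a \<noteq> 0\<close> \<open>a = b\<close> by (simp add: ab scale_scale scale_1)
  qed
  then have "card (f ` ((UNIV - {0}) \<times> ?G)) = (p ^ m - 1) * card ?G"
    by (subst card_image) (simp_all add: card_cartesian_product card_field)
  moreover have "card ((\<lambda>(b, \<xi>). ((0 :: 'a, b :: 'a), \<xi>)) ` (UNIV \<times> ?Z)) = p ^ m * card ?Z"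
    by (subst card_image) (auto simp: card_cartesian_product card_field intro!: inj_onI)
  moreover have "(\<lambda>(b, \<xi>). ((0, b), \<xi>)) ` (UNIV \<times> ?Z) \<inter> f ` ((UNIV - {0}) \<times> ?G) = {}"
    by (auto simp: f_def)
  ultimately show ?thesis unfolding S by (subst card_Un_disjoint) auto
qed

text \<open>The sides differ by \<open>2 * ((sig c - c) * (sig d - d))\<close>; this factorisation
  is what puts coordinates into the prime field.\<close>

lemma half_sum_eq_prod_iff:
  "2 * (c * sig d + d * sig c) = 2 * (c * d) + sig (2 * (c * d)) \<longleftrightarrow> c \<in> prime_field \<or> d \<in> prime_field"
proof -
  have "2 * (c * d) + sig (2 * (c * d)) - 2 * (c * sig d + d * sig c) = 2 * ((sig c - c) * (sig d - d))"
    by (simp add: sig_mult sig_numeral algebra_simps)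
  then have "2 * (c * sig d + d * sig c) = 2 * (c * d) + sig (2 * (c * d)) \<longleftrightarrow>
      2 * ((sig c - c) * (sig d - d)) = 0"
    by (metis eq_iff_diff_eq_0)
  also have "\<dots> \<longleftrightarrow> sig c = c \<or> sig d = d" using two_neq_0 by simp
  finally show ?thesis by (simp only: sig_fixed)
qed

lemma card_axes: "card ({0} \<times> UNIV \<union> (UNIV - {0 :: 'a}) \<times> {0 :: 'a}) = 2 * p ^ m - 1"
  by (subst card_Un_disjoint) (auto simp: card_cartesian_product card_field)

lemma moment_2: "(\<Sum>t\<in>UNIV. qsum t * cnj (qsum t)) = of_nat (p ^ m) ^ 3 * of_nat (2 * p ^ m - 1)"
proof -
  have "{z. polar_vec (fst z) (snd z) = 0} = {0} \<times> UNIV \<union> (UNIV - {0}) \<times> {0}"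
    using two_neq_0 by (auto simp: polar_vec_def zero_prod_def)
  then show ?thesis
    unfolding qsum_mult_cnj moment by (simp only: card_axes)
qed

text \<open>The condition from the middle coordinate reads
  \<open>(sig x - x) * (sig x - x) = 0\<close>; the one with \<open>sig (sig x)\<close> then holds
  by itself.\<close>

lemma moment_3:
  "(\<Sum>t\<in>UNIV. qsum t * cnj (qsum t) * qsum t) = of_nat (p ^ m) ^ 3 * of_nat (p ^ m + (p ^ m - 1) * p)"
proof -
  have "card {z. polar_vec (fst (fst z)) (snd (fst z)) + diag_vec (snd z) = 0}
      = p ^ m * card {x. x * x = 0 \<and> x * sig x = 0 \<and> x * sig (sig x) = 0}
        + (p ^ m - 1) * card {x. 2 * (x * sig x) = x * x + sig (x * x)
            \<and> 2 * (x * sig (sig x)) = x * x + sig (sig (x * x))}"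
    unfolding diag_vec_def
    by (rule card_polar_vec_plus[where scale = "(*)"]) (simp_all add: sig_mult mult_ac)
  also have "{x. x * x = 0 \<and> x * sig x = 0 \<and> x * sig (sig x) = 0} = {0}" by auto
  also have "{x. 2 * (x * sig x) = x * x + sig (x * x) \<and> 2 * (x * sig (sig x)) = x * x + sig (sig (x * x))}
      = prime_field"
  proof (intro equalityI subsetI)
    fix x assume "x \<in> {x. 2 * (x * sig x) = x * x + sig (x * x) \<and> 2 * (x * sig (sig x)) = x * x + sig (sig (x * x))}"
    then have "2 * (x * sig x) = x * x + sig (x * x)" by blast
    then have "(sig x - x) * (sig x - x) = 0" by (simp add: sig_mult algebra_simps)
    then show "x \<in> prime_field" by (simp flip: sig_fixed)
  qed (simp add: sig_mult sig_prime_field)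
  finally show ?thesis
    unfolding qsum_mult_cnj by (simp only: qsum_def sum_psi_dot3_mult moment) (simp add: card_prime_field)
qed

text \<open>Of the two hyperbolic pairs one is eliminated by \<open>card_polar_vec_plus\<close> and
  the other is its parameter \<open>\<xi> = (c, d)\<close>; by \<open>half_sum_eq_prod_iff\<close>
  one of \<open>c\<close>, \<open>d\<close> must lie in the prime field.\<close>

lemma moment_4:
  "(\<Sum>t\<in>UNIV. qsum t * cnj (qsum t) * (qsum t * cnj (qsum t)))
    = of_nat (p ^ m) ^ 3 * of_nat (p ^ m * (2 * p ^ m - 1) + (p ^ m - 1) * (2 * p * p ^ m - p\<^sup>2))"
proof -
  define N0 N1 N2 where "N0 = (\<lambda>(c, d). 2 * (c * d) :: 'a)"
    and "N1 = (\<lambda>(c, d). c * sig d + d * sig c)" and "N2 = (\<lambda>(c, d). c * sig (sig d) + d * sig (sig c))"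
  have pv: "polar_vec (fst x) (snd x) = (N2 x, N1 x, N0 x)" for x
    by (simp add: polar_vec_def N0_def N1_def N2_def case_prod_unfold)
  have "card {z. polar_vec (fst (fst z)) (snd (fst z)) + polar_vec (fst (snd z)) (snd (snd z)) = 0}
      = p ^ m * card {\<xi>. N0 \<xi> = 0 \<and> N1 \<xi> = 0 \<and> N2 \<xi> = 0}
        + (p ^ m - 1) * card {\<xi>. 2 * N1 \<xi> = N0 \<xi> + sig (N0 \<xi>) \<and> 2 * N2 \<xi> = N0 \<xi> + sig (sig (N0 \<xi>))}"
    unfolding pv[of "snd _"]
    by (rule card_polar_vec_plus[where scale = "\<lambda>a (c, d). (a * c, a * d)"])
      (auto simp: N0_def N1_def N2_def sig_mult algebra_simps)
  also have "{\<xi>. N0 \<xi> = 0 \<and> N1 \<xi> = 0 \<and> N2 \<xi> = 0} = {0} \<times> UNIV \<union> (UNIV - {0}) \<times> {0}"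
    using two_neq_0 by (auto simp: N0_def N1_def N2_def)
  also have "card \<dots> = 2 * p ^ m - 1"
    by (rule card_axes)
  also have "{\<xi>. 2 * N1 \<xi> = N0 \<xi> + sig (N0 \<xi>) \<and> 2 * N2 \<xi> = N0 \<xi> + sig (sig (N0 \<xi>))}
      = prime_field \<times> UNIV \<union> (UNIV - prime_field) \<times> prime_field"
  proof (intro equalityI subsetI)
    fix x assume "x \<in> {\<xi>. 2 * N1 \<xi> = N0 \<xi> + sig (N0 \<xi>) \<and> 2 * N2 \<xi> = N0 \<xi> + sig (sig (N0 \<xi>))}"
    then have "2 * N1 (fst x, snd x) = N0 (fst x, snd x) + sig (N0 (fst x, snd x))" by simp
    then have "fst x \<in> prime_field \<or> snd x \<in> prime_field"
      unfolding N0_def N1_def case_prod_conv half_sum_eq_prod_iff .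
    then show "x \<in> prime_field \<times> UNIV \<union> (UNIV - prime_field) \<times> prime_field"
      by (cases x) auto
  next
    fix x assume "x \<in> prime_field \<times> UNIV \<union> (UNIV - prime_field) \<times> prime_field"
    then have x: "fst x \<in> prime_field \<or> snd x \<in> prime_field" by auto
    then have "2 * N1 (fst x, snd x) = N0 (fst x, snd x) + sig (N0 (fst x, snd x))"
      unfolding N0_def N1_def case_prod_conv half_sum_eq_prod_iff .
    moreover have "2 * N2 (fst x, snd x) = N0 (fst x, snd x) + sig (sig (N0 (fst x, snd x)))"
      unfolding N0_def N2_def case_prod_conv using x
      by (auto simp: sig_mult sig_numeral sig_prime_field algebra_simps)
    ultimately show "x \<in> {\<xi>. 2 * N1 \<xi> = N0 \<xi> + sig (N0 \<xi>) \<and> 2 * N2 \<xi> = N0 \<xi> + sig (sig (N0 \<xi>))}"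
      by simp
  qed
  also have "card \<dots> = p * p ^ m + (p ^ m - p) * p"
    by (subst card_Un_disjoint)
      (auto simp: card_cartesian_product card_prime_field card_field card_Diff_subset)
  also have "p * p ^ m + (p ^ m - p) * p = 2 * p * p ^ m - p\<^sup>2"
  proof -
    have "p ^ 1 \<le> p ^ m" using p_gt_1 m_pos by (intro power_increasing) auto
    then have "p * p \<le> p * p ^ m" by simp
    moreover have "(p ^ m - p) * p = p * p ^ m - p * p"
      unfolding mult.commute[of "p ^ m" p, symmetric] by (rule diff_mult_distrib)
    ultimately show ?thesis by (simp only: power2_eq_square mult.assoc)
  qed
  finally show ?thesis
    unfolding qsum_mult_cnj by (simp only: sum_psi_dot3_mult moment)
qed

text \<open>If \<open>x\<^sup>2 = c\<close> with \<open>x\<close> outside the prime field then \<open>x ^ p = - x\<close>, hence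
  \<open>x = x ^ p ^ m = - x\<close> as \<open>m\<close> is odd.\<close>
lemma nonsquare_extension:
  assumes c: "c \<in> prime_field - {0} - squares"
  shows "c \<noteq> x * x"
proof
  assume x: "c = x * x"
  have "(x ^ p)\<^sup>2 = c ^ p" by (simp add: x power2_eq_square power_mult_distrib)
  also have "\<dots> = x\<^sup>2" using c by (simp add: prime_field_def x power2_eq_square)
  finally have "x ^ p = x \<or> x ^ p = - x" by (simp add: power2_eq_iff)
  moreover have "x ^ p \<noteq> x"
  proof
    assume "x ^ p = x"
    then have "c \<in> squares"
      unfolding squares_def using c x
      by (intro image_eqI[of _ _ x]) (auto simp: power2_eq_square prime_field_def)
    then show False using c by blast
  qed
  ultimately have x': "x ^ p = - x" by blast
  have "x ^ p ^ n = (- 1) ^ n * x" for n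
  proof (induction n)
    case (Suc n)
    have "x ^ p ^ Suc n = (x ^ p ^ n) ^ p" by (simp add: mult.commute flip: power_mult)
    also have "\<dots> = ((- 1) ^ p) ^ n * x ^ p"
      by (simp add: Suc power_mult_distrib mult.commute flip: power_mult)
    also have "\<dots> = (- 1) ^ Suc n * x" using odd_p by (simp add: x')
    finally show ?case .
  qed simp
  from this[of m] have "x ^ p ^ m = - x" using odd_m by simp
  moreover have "x ^ p ^ m = x"
    using finite_field_power_card_eq_same[of x] by (simp add: card_field)
  ultimately show False using minus_neq[of x] c x by auto
qed

section \<open>Moments twisted by a nonsquare\<close>

lemma anisotropic:
  assumes "c \<in> prime_field - {0} - squares" "x * x = c * (y * y)"
  shows "x = 0 \<and> y = 0"
proof (cases "y = 0")
  case False
  then have "c = (x / y) * (x / y)" using assms(2) by (simp add: field_simps)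
  then show ?thesis using nonsquare_extension[OF assms(1)] by blast
qed (use assms in simp)

lemma moment_2_twisted:
  assumes c: "c \<in> prime_field - {0} - squares"
  shows "(\<Sum>t\<in>UNIV. qsum t * qsum (smult3 (- c) t)) = of_nat (p ^ m) ^ 3"
proof -
  have "{z. diag_vec (fst z) + smult3 (- c) (diag_vec (snd z)) = 0} = {0}"
    by (auto simp: diag_vec_def smult3_def zero_prod_def dest: anisotropic[OF c])
  then show ?thesis
    unfolding qsum_smult3 by (simp only: qsum_def sum_psi_dot3_mult moment) simp
qed

text \<open>The second pair is now an anisotropic plane: the condition becomes
  \<open>(sig x - x)\<^sup>2 = c * (sig y - y)\<^sup>2\<close>, which forces both coordinates into
  the prime field.\<close>

lemma moment_4_twisted:
  assumes c: "c \<in> prime_field - {0} - squares"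
  shows "(\<Sum>t\<in>UNIV. qsum t * cnj (qsum t) * (qsum t * qsum (smult3 (- c) t)))
    = of_nat (p ^ m) ^ 3 * of_nat (p ^ m + (p ^ m - 1) * p\<^sup>2)"
proof -
  define N0 N1 N2 where "N0 = (\<lambda>(x, y). x * x - c * (y * y))"
    and "N1 = (\<lambda>(x, y). x * sig x - c * (y * sig y))"
    and "N2 = (\<lambda>(x, y). x * sig (sig x) - c * (y * sig (sig y)))"
  have c': "sig c = c" using c by (simp add: sig_prime_field)
  have dv: "diag_vec (fst x) + smult3 (- c) (diag_vec (snd x)) = (N2 x, N1 x, N0 x)" for x
    by (simp add: diag_vec_def smult3_def N0_def N1_def N2_def case_prod_unfold)
  have "card {z. polar_vec (fst (fst z)) (snd (fst z))
          + (diag_vec (fst (snd z)) + smult3 (- c) (diag_vec (snd (snd z)))) = 0}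
      = p ^ m * card {\<xi>. N0 \<xi> = 0 \<and> N1 \<xi> = 0 \<and> N2 \<xi> = 0}
        + (p ^ m - 1) * card {\<xi>. 2 * N1 \<xi> = N0 \<xi> + sig (N0 \<xi>) \<and> 2 * N2 \<xi> = N0 \<xi> + sig (sig (N0 \<xi>))}"
    unfolding dv
    by (rule card_polar_vec_plus[where scale = "\<lambda>a (x, y). (a * x, a * y)"])
      (auto simp: N0_def N1_def N2_def sig_mult algebra_simps)
  also have "{\<xi>. N0 \<xi> = 0 \<and> N1 \<xi> = 0 \<and> N2 \<xi> = 0} = {(0, 0)}"
    by (auto simp: N0_def N1_def N2_def dest: anisotropic[OF c])
  also have "{\<xi>. 2 * N1 \<xi> = N0 \<xi> + sig (N0 \<xi>) \<and> 2 * N2 \<xi> = N0 \<xi> + sig (sig (N0 \<xi>))}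
      = prime_field \<times> prime_field"
  proof (intro equalityI subsetI)
    fix z assume "z \<in> {\<xi>. 2 * N1 \<xi> = N0 \<xi> + sig (N0 \<xi>) \<and> 2 * N2 \<xi> = N0 \<xi> + sig (sig (N0 \<xi>))}"
    moreover obtain x y where xy: "z = (x, y)" by (metis surj_pair)
    ultimately have "2 * N1 (x, y) = N0 (x, y) + sig (N0 (x, y))" by simp
    moreover have "N0 (x, y) + sig (N0 (x, y)) - 2 * N1 (x, y)
        = (sig x - x) * (sig x - x) - c * ((sig y - y) * (sig y - y))"
      by (simp add: N0_def N1_def sig_diff sig_mult c' algebra_simps)
    ultimately have "(sig x - x) * (sig x - x) = c * ((sig y - y) * (sig y - y))" by simp
    then have "sig x - x = 0 \<and> sig y - y = 0" by (rule anisotropic[OF c])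
    then show "z \<in> prime_field \<times> prime_field" by (simp add: xy flip: sig_fixed)
  next
    fix z assume "z \<in> prime_field \<times> prime_field"
    then show "z \<in> {\<xi>. 2 * N1 \<xi> = N0 \<xi> + sig (N0 \<xi>) \<and> 2 * N2 \<xi> = N0 \<xi> + sig (sig (N0 \<xi>))}"
      using c by (auto simp: N0_def N1_def N2_def sig_prime_field)
  qed
  finally show ?thesis
    unfolding qsum_mult_cnj qsum_smult3
    by (simp only: qsum_def sum_psi_dot3_mult moment)
      (simp add: card_cartesian_product card_prime_field power2_eq_square)
qed

end

section \<open>The linear system for the class sizes\<close>

lemma two_linear_equations:
  fixes a b c d x y :: "'a::idom"
  assumes "a * x + b * y = a * x' + b * y'" "c * x + d * y = c * x' + d * y'" "a * d \<noteq> b * c"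
  shows "x = x' \<and> y = y'"
proof -
  have 1: "a * (x - x') + b * (y - y') = 0" and 2: "c * (x - x') + d * (y - y') = 0"
    using assms(1,2) by (simp_all add: algebra_simps)
  have "(a * d - b * c) * (x - x') = d * (a * (x - x') + b * (y - y')) - b * (c * (x - x') + d * (y - y'))"
    "(a * d - b * c) * (y - y') = a * (c * (x - x') + d * (y - y')) - c * (a * (x - x') + b * (y - y'))"
    by (simp_all add: algebra_simps)
  then have "(a * d - b * c) * (x - x') = 0" "(a * d - b * c) * (y - y') = 0"
    unfolding 1 2 by simp_all
  then show ?thesis using assms(3) by simp
qed

text \<open>A Vandermonde system with nodes 1, \<open>r\<close>, \<open>r ^ 2\<close>; for the
  classes \<open>i\<close> = 0, 2, 4 the base is \<open>r = P ^ 2\<close>.\<close>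

lemma three_linear_equations:
  fixes x y z r :: real
  assumes r: "r > 1"
    and 1: "x + y + z = x' + y' + z'"
    and 2: "x + r * y + r ^ 2 * z = x' + r * y' + r ^ 2 * z'"
    and 3: "x + r ^ 2 * y + r ^ 4 * z = x' + r ^ 2 * y' + r ^ 4 * z'"
  shows "x = x' \<and> y = y' \<and> z = z'"
proof -
  have "(r - 1) * y + (r ^ 2 - 1) * z = (r - 1) * y' + (r ^ 2 - 1) * z'"
    "(r ^ 2 - 1) * y + (r ^ 4 - 1) * z = (r ^ 2 - 1) * y' + (r ^ 4 - 1) * z'"
    using 1 2 3 by (simp_all add: algebra_simps)
  moreover have "(r - 1) * (r ^ 4 - 1) - (r ^ 2 - 1) * (r ^ 2 - 1) = r * (r - 1) ^ 3 * (r + 1)"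
    by (simp add: algebra_simps power2_eq_square power3_eq_cube power4_eq_xxxx)
  then have "(r - 1) * (r ^ 4 - 1) \<noteq> (r ^ 2 - 1) * (r ^ 2 - 1)" using r by auto
  ultimately have "y = y' \<and> z = z'" by (rule two_linear_equations)
  then show ?thesis using 1 by simp
qed

text \<open>Here \<open>P\<close> is p, \<open>u\<close> is p^((m - 3)/2), and the \<open>x\<close>
  and \<open>y\<close> are the class sizes of sign 1 and -1; every power of p in the formulas
  becomes a monomial in \<open>P\<close> and \<open>u\<close>. Sums and differences of plain and
  twisted moments separate odd from even \<open>i\<close>, while M1 and M3 see only
  \<open>x1 - y1\<close> and \<open>x3 - y3\<close>. Two systems of size 2 and one of size 3 result,
  and it suffices to verify the claimed solutions.\<close>

lemma class_size_system:
  fixes P u q :: real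
  assumes P: "P > 1" and u: "u > 0" and q: "q = P ^ 3 * u ^ 2"
    and K: "K = P ^ 6 * u ^ 4 - P ^ 4 * u ^ 4 - P ^ 3 * u ^ 4 + P * u ^ 2 + u ^ 2 - 1"
    and count: "1 + 2 * x0 + (x1 + y1) + 2 * x2 + (x3 + y3) + 2 * x4 = q ^ 3"
    and M1: "q + P ^ 2 * u * (x1 - y1) + P ^ 3 * u * (x3 - y3) = q ^ 3"
    and M2: "q ^ 2 + q * (2 * x0 + P * (x1 + y1) + P ^ 2 * (2 * x2) + P ^ 3 * (x3 + y3) + P ^ 4 * (2 * x4))
      = q ^ 3 * (2 * q - 1)"
    and M2': "q ^ 2 + q * (- (2 * x0) + P * (x1 + y1) - P ^ 2 * (2 * x2) + P ^ 3 * (x3 + y3) - P ^ 4 * (2 * x4))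
      = q ^ 3"
    and M3: "q ^ 3 + q * (P * (P ^ 2 * u) * (x1 - y1) + P ^ 3 * (P ^ 3 * u) * (x3 - y3))
      = q ^ 3 * (q + (q - 1) * P)"
    and M4: "q ^ 4 + q ^ 2 * (2 * x0 + P ^ 2 * (x1 + y1) + P ^ 4 * (2 * x2) + P ^ 6 * (x3 + y3) + P ^ 8 * (2 * x4))
      = q ^ 3 * (q * (2 * q - 1) + (q - 1) * (2 * P * q - P ^ 2))"
    and M4': "q ^ 4 + q ^ 2 * (- (2 * x0) + P ^ 2 * (x1 + y1) - P ^ 4 * (2 * x2) + P ^ 6 * (x3 + y3) - P ^ 8 * (2 * x4))
      = q ^ 3 * (q + (q - 1) * P ^ 2)"
  shows "x1 = (P ^ 4 * u ^ 2 + P ^ 3 * u) * K / (2 * (P ^ 2 - 1))"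
    and "y1 = (P ^ 4 * u ^ 2 - P ^ 3 * u) * K / (2 * (P ^ 2 - 1))"
    and "x3 = (u ^ 2 + u) * (P ^ 2 * u ^ 2 - 1) * (q - 1) / (2 * (P ^ 2 - 1))"
    and "y3 = (u ^ 2 - u) * (P ^ 2 * u ^ 2 - 1) * (q - 1) / (2 * (P ^ 2 - 1))"
    and "x2 = P ^ 2 * (P ^ 2 * u ^ 2 - 1) * K / (2 * (P ^ 2 - 1) ^ 2)" (is "x2 = ?x2")
    and "x4 = (q - 1) * (P ^ 2 * u ^ 2 - 1) * (u ^ 2 - 1) / (2 * (P ^ 2 - 1) * (P ^ 4 - 1))" (is "x4 = ?x4")
    and "x0 = 1 / 2 * (q - 1) * (P ^ 6 * u ^ 4 - P ^ 5 * u ^ 4 + P ^ 2 * u ^ 4 + q - P ^ 2 * u ^ 2 - u ^ 2 + 1)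
      - P ^ 2 * (P ^ 2 * u ^ 2 - 1) * K / (2 * (P ^ 2 - 1) ^ 2)
      - (q - 1) * (P ^ 2 * u ^ 2 - 1) * (u ^ 2 - 1) / (2 * (P ^ 2 - 1) * (P ^ 4 - 1))" (is "x0 = ?x0")
proof -
  have q0: "q \<noteq> 0" using P u q by simp
  have P2: "P ^ 2 > 1" using P by (simp add: one_less_power)
  \<comment> \<open>\<open>D\<close> stays opaque while denominators are cleared and is expanded
    only in the final polynomial identities.\<close>
  define D where "D = P ^ 2 - 1"
  have D: "D \<noteq> 0" using P2 by (simp add: D_def)
  have S1: "P * (x1 + y1) + P ^ 3 * (x3 + y3) = q ^ 3 - q"
  proof -
    have "2 * (q * (P * (x1 + y1) + P ^ 3 * (x3 + y3))) = 2 * (q * (q ^ 3 - q))"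
      using M2 M2' by (simp add: algebra_simps power2_eq_square power3_eq_cube power4_eq_xxxx)
    then show ?thesis using q0 by simp
  qed
  have S2: "2 * x0 + P ^ 2 * (2 * x2) + P ^ 4 * (2 * x4) = q ^ 3 - q ^ 2"
  proof -
    have "2 * (q * (2 * x0 + P ^ 2 * (2 * x2) + P ^ 4 * (2 * x4))) = 2 * (q * (q ^ 3 - q ^ 2))"
      using M2 M2' by (simp add: algebra_simps power2_eq_square power3_eq_cube power4_eq_xxxx)
    then show ?thesis using q0 by simp
  qed
  have S3: "P ^ 2 * (x1 + y1) + P ^ 6 * (x3 + y3) = q ^ 3 + P * q ^ 2 * (q - 1) - q ^ 2"
  proof -
    have "2 * (q ^ 2 * (P ^ 2 * (x1 + y1) + P ^ 6 * (x3 + y3))) = 2 * (q ^ 2 * (q ^ 3 + P * q ^ 2 * (q - 1) - q ^ 2))"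
      using M4 M4' by (simp add: algebra_simps power2_eq_square power3_eq_cube power4_eq_xxxx)
    then show ?thesis using q0 by simp
  qed
  have S4: "2 * x0 + P ^ 4 * (2 * x2) + P ^ 8 * (2 * x4) = q * (q - 1) * (q + P * q - P ^ 2)"
  proof -
    have "2 * (q ^ 2 * (2 * x0 + P ^ 4 * (2 * x2) + P ^ 8 * (2 * x4)))
        = 2 * (q ^ 2 * (q * (q - 1) * (q + P * q - P ^ 2)))"
      using M4 M4' by (simp add: algebra_simps power2_eq_square power3_eq_cube power4_eq_xxxx)
    then show ?thesis using q0 by simp
  qed
  have S5: "P ^ 2 * u * (x1 - y1) + P ^ 3 * u * (x3 - y3) = q ^ 3 - q" using M1 by simp
  have S6: "P ^ 3 * u * (x1 - y1) + P ^ 6 * u * (x3 - y3) = q ^ 2 * (q - 1) * (P + 1)"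
  proof -
    have "q * (P ^ 3 * u * (x1 - y1) + P ^ 6 * u * (x3 - y3)) = q * (q ^ 2 * (q - 1) * (P + 1))"
      using M3 by (simp add: algebra_simps power2_eq_square power3_eq_cube power4_eq_xxxx eval_nat_numeral)
    then show ?thesis using q0 by simp
  qed
  have s: "x1 + y1 = P ^ 4 * u ^ 2 * K / D \<and> x3 + y3 = u ^ 2 * (P ^ 2 * u ^ 2 - 1) * (q - 1) / D"
  proof (rule two_linear_equations)
    show "P * (x1 + y1) + P ^ 3 * (x3 + y3)
        = P * (P ^ 4 * u ^ 2 * K / D) + P ^ 3 * (u ^ 2 * (P ^ 2 * u ^ 2 - 1) * (q - 1) / D)"
      unfolding S1 using D unfolding q K
      by (simp add: field_simps) (simp add: D_def algebra_simps eval_nat_numeral)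
    show "P ^ 2 * (x1 + y1) + P ^ 6 * (x3 + y3)
        = P ^ 2 * (P ^ 4 * u ^ 2 * K / D) + P ^ 6 * (u ^ 2 * (P ^ 2 * u ^ 2 - 1) * (q - 1) / D)"
      unfolding S3 using D unfolding q K
      by (simp add: field_simps) (simp add: D_def algebra_simps eval_nat_numeral)
    have "P * P ^ 6 - P ^ 3 * P ^ 2 = P ^ 5 * D" by (simp add: D_def algebra_simps eval_nat_numeral)
    then show "P * P ^ 6 \<noteq> P ^ 3 * P ^ 2" using D P by auto
  qed
  have d: "x1 - y1 = P ^ 3 * u * K / D \<and> x3 - y3 = u * (P ^ 2 * u ^ 2 - 1) * (q - 1) / D"
  proof (rule two_linear_equations)
    show "P ^ 2 * u * (x1 - y1) + P ^ 3 * u * (x3 - y3)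
        = P ^ 2 * u * (P ^ 3 * u * K / D) + P ^ 3 * u * (u * (P ^ 2 * u ^ 2 - 1) * (q - 1) / D)"
      unfolding S5 using D unfolding q K
      by (simp add: field_simps) (simp add: D_def algebra_simps eval_nat_numeral)
    show "P ^ 3 * u * (x1 - y1) + P ^ 6 * u * (x3 - y3)
        = P ^ 3 * u * (P ^ 3 * u * K / D) + P ^ 6 * u * (u * (P ^ 2 * u ^ 2 - 1) * (q - 1) / D)"
      unfolding S6 using D unfolding q K
      by (simp add: field_simps) (simp add: D_def algebra_simps eval_nat_numeral)
    have "P ^ 2 * u * (P ^ 6 * u) - P ^ 3 * u * (P ^ 3 * u) = P ^ 6 * u ^ 2 * D"
      by (simp add: D_def algebra_simps eval_nat_numeral)
    then show "P ^ 2 * u * (P ^ 6 * u) \<noteq> P ^ 3 * u * (P ^ 3 * u)" using D P u by auto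
  qed
  have half: "x = (a + b) / 2 \<and> y = (a - b) / 2" if "x + y = a" "x - y = b" for x y a b :: real
    using that by (auto simp: field_simps)
  show "x1 = (P ^ 4 * u ^ 2 + P ^ 3 * u) * K / (2 * (P ^ 2 - 1))"
    "y1 = (P ^ 4 * u ^ 2 - P ^ 3 * u) * K / (2 * (P ^ 2 - 1))"
    using half[OF s[THEN conjunct1] d[THEN conjunct1]]
    by (simp_all add: distrib_right left_diff_distrib add_divide_distrib diff_divide_distrib mult.commute[of D] flip: D_def)
  show "x3 = (u ^ 2 + u) * (P ^ 2 * u ^ 2 - 1) * (q - 1) / (2 * (P ^ 2 - 1))"
    "y3 = (u ^ 2 - u) * (P ^ 2 * u ^ 2 - 1) * (q - 1) / (2 * (P ^ 2 - 1))"
    using half[OF s[THEN conjunct2] d[THEN conjunct2]]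
    by (simp_all add: distrib_right left_diff_distrib add_divide_distrib diff_divide_distrib mult.commute[of D] flip: D_def)
  have P4_eq: "P ^ 4 - 1 = D * (D + 2)" by (simp add: D_def algebra_simps eval_nat_numeral)
  have E: "D + 2 \<noteq> 0" using P2 by (simp add: D_def)
  have double: "2 * (1 / 2 * r * x - a - b) = r * x - 2 * a - 2 * b" for r x a b :: real by simp
  have double_sum: "r * x = 2 * (1 / 2 * r * x - a - b) + 2 * a + 2 * b" for r x a b :: real by simp
  have "2 * x0 = 2 * ?x0 \<and> 2 * x2 = 2 * ?x2 \<and> 2 * x4 = 2 * ?x4"
  proof (rule three_linear_equations[of "P ^ 2"])
    show "1 < P ^ 2" by fact
    have "2 * x0 + 2 * x2 + 2 * x4 = q ^ 3 - 1 - (x1 + y1) - (x3 + y3)" using count by simp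
    also have "\<dots> = (q - 1) * (P ^ 6 * u ^ 4 - P ^ 5 * u ^ 4 + P ^ 2 * u ^ 4 + q - P ^ 2 * u ^ 2 - u ^ 2 + 1)"
      using D unfolding s[THEN conjunct1] s[THEN conjunct2] q K
      by (simp add: field_simps) (simp add: D_def algebra_simps eval_nat_numeral)
    also have "\<dots> = 2 * ?x0 + 2 * ?x2 + 2 * ?x4" by (rule double_sum)
    finally show "2 * x0 + 2 * x2 + 2 * x4 = 2 * ?x0 + 2 * ?x2 + 2 * ?x4" .
    have x2: "2 * ?x2 = P ^ 2 * (P ^ 2 * u ^ 2 - 1) * K / (D * D)"
      by (simp add: D_def power2_eq_square)
    have x4: "2 * ?x4 = (q - 1) * (P ^ 2 * u ^ 2 - 1) * (u ^ 2 - 1) / (D * D * (D + 2))"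
      unfolding P4_eq D_def[symmetric] by (simp add: mult.assoc)
    have x0: "2 * ?x0 = (q - 1) * (P ^ 6 * u ^ 4 - P ^ 5 * u ^ 4 + P ^ 2 * u ^ 4 + q - P ^ 2 * u ^ 2 - u ^ 2 + 1)
        - 2 * ?x2 - 2 * ?x4" by (rule double)
    define G X2 X4 where "G = (q - 1) * (P ^ 6 * u ^ 4 - P ^ 5 * u ^ 4 + P ^ 2 * u ^ 4 + q - P ^ 2 * u ^ 2 - u ^ 2 + 1)"
      and "X2 = P ^ 2 * (P ^ 2 * u ^ 2 - 1) * K" and "X4 = (q - 1) * (P ^ 2 * u ^ 2 - 1) * (u ^ 2 - 1)"
    \<comment> \<open>\<open>2 * ?x0\<close> is \<open>G\<close> minus the other two unknowns, so
      the weights enter as \<open>c - 1\<close> and \<open>c' - 1\<close>. Their factors cancel the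
      denominators up to a single \<open>D\<close>.\<close>
    have combine: "2 * ?x0 + c * (2 * ?x2) + c' * (2 * ?x4) = A"
      if "c - 1 = D * e" "c' - 1 = D * (D + 2) * e'" "D * (A - G) = X2 * e + X4 * e'" for c c' e e' A
    proof -
      have "2 * ?x0 + c * (2 * ?x2) + c' * (2 * ?x4)
          = G + (c - 1) * (X2 / (D * D)) + (c' - 1) * (X4 / (D * D * (D + 2)))"
        unfolding x0 unfolding x2 x4 unfolding G_def[symmetric] X2_def[symmetric] X4_def[symmetric]
        by (simp add: left_diff_distrib diff_divide_distrib)
      also have "\<dots> = G + (X2 * e + X4 * e') / D"
        unfolding that(1,2) using D E by (simp add: add_divide_distrib mult.commute)
      also have "\<dots> = A" unfolding that(3)[symmetric] using D by simp
      finally show ?thesis .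
    qed
    have "2 * ?x0 + P ^ 2 * (2 * ?x2) + (P ^ 2) ^ 2 * (2 * ?x4) = q ^ 3 - q ^ 2"
    proof (rule combine)
      show "P ^ 2 - 1 = D * 1" by (simp add: D_def)
      show "(P ^ 2) ^ 2 - 1 = D * (D + 2) * 1" by (simp add: D_def algebra_simps eval_nat_numeral)
      show "D * (q ^ 3 - q ^ 2 - G) = X2 * 1 + X4 * 1"
        unfolding D_def G_def X2_def X4_def q K by (simp add: algebra_simps eval_nat_numeral)
    qed
    then show "2 * x0 + P ^ 2 * (2 * x2) + (P ^ 2) ^ 2 * (2 * x4)
        = 2 * ?x0 + P ^ 2 * (2 * ?x2) + (P ^ 2) ^ 2 * (2 * ?x4)"
      using S2 by simp
    have "2 * ?x0 + (P ^ 2) ^ 2 * (2 * ?x2) + (P ^ 2) ^ 4 * (2 * ?x4) = q * (q - 1) * (q + P * q - P ^ 2)"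
    proof (rule combine)
      show "(P ^ 2) ^ 2 - 1 = D * (D + 2)" by (simp add: D_def algebra_simps eval_nat_numeral)
      show "(P ^ 2) ^ 4 - 1 = D * (D + 2) * (P ^ 4 + 1)" by (simp add: D_def algebra_simps eval_nat_numeral)
      show "D * (q * (q - 1) * (q + P * q - P ^ 2) - G) = X2 * (D + 2) + X4 * (P ^ 4 + 1)"
        unfolding D_def G_def X2_def X4_def q K by (simp add: algebra_simps eval_nat_numeral)
    qed
    then show "2 * x0 + (P ^ 2) ^ 2 * (2 * x2) + (P ^ 2) ^ 4 * (2 * x4)
        = 2 * ?x0 + (P ^ 2) ^ 2 * (2 * ?x2) + (P ^ 2) ^ 4 * (2 * ?x4)"
      using S4 by simp
  qed
  note sol = this
  have cancel: "2 * a = 2 * b \<Longrightarrow> a = b" for a b :: real by simp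
  show "x2 = ?x2" "x4 = ?x4" "x0 = ?x0"
    by (rule cancel[OF sol[THEN conjunct2, THEN conjunct1]] cancel[OF sol[THEN conjunct2, THEN conjunct2]]
        cancel[OF sol[THEN conjunct1]])+
qed

section \<open>Classes of quadratic forms\<close>

lemma form_value_minus: "form_value p m (- \<epsilon>) i = - form_value p m \<epsilon> i"
  by (simp add: form_value_def)

context odd_prime_power_field
begin

text \<open>For odd \<open>p\<close>, -1 is not a \<open>p\<close>-th root of unity; hence a phase
  cannot hide the sign of a value.\<close>

lemma add_char_neq_uminus:
  assumes "z \<in> prime_field" "w \<in> prime_field" shows "add_char z \<noteq> - add_char w"
proof
  assume "add_char z = - add_char w"
  then have minus_1: "add_char (z - w) = - 1"
    using assms by (simp add: add_char_diff flip: complex_norm_square)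
  then have "add_char ((z - w) + (z - w)) = 1"
    using assms by (subst add_char_add) auto
  moreover have "(z - w) + (z - w) \<in> prime_field"
    using assms by (intro prime_field_add prime_field_diff)
  ultimately have "(z - w) + (z - w) = 0"
    using add_char_eq_1_iff by blast
  then have "2 * (z - w) = 0" by (simp only: mult_2)
  then have "z - w = 0" using two_neq_0 by (simp only: mult_eq_0_iff) simp
  then show False using minus_1 by simp
qed

end

locale quadratic_family = frobenius_twist p m ty k
  for p m and ty :: "'a::finite_field itself" and k +
  assumes m_ge_5: "m \<ge> 5"
begin

lemma dot3_diag_vec: "dot3 (\<alpha>, \<beta>, \<gamma>) (diag_vec x) = quad \<alpha> \<beta> \<gamma> x"
  by (simp add: dot3_def diag_vec_def quad_def)

lemma exp_sum_eq: "exp_sum p m k \<alpha> \<beta> \<gamma> \<delta>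
    = represented_quadratic_form.affine_sum p m (\<lambda>x. tr (quad \<alpha> \<beta> \<gamma> x)) \<delta>"
proof -
  interpret Q: represented_quadratic_form p m ty "\<lambda>x. tr (quad \<alpha> \<beta> \<gamma> x)" "\<lambda>x y. tr (polar \<alpha> \<beta> \<gamma> x y)" "polar_op \<alpha> \<beta> \<gamma>"
    by (rule represented_quad)
  have "x ^ (p ^ (2 * k) + 1) = x * sig (sig x)" for x
    by (simp add: sig_def mult_2 power_add flip: power_mult)
  moreover have "x ^ (p ^ k + 1) = x * sig x" for x
    by (simp add: sig_def)
  ultimately show ?thesis
    unfolding exp_sum_def Q.affine_sum_def add_char_def[symmetric] tr_add[symmetric]
    by (simp only: quad_def power2_eq_square)
qed

lemma qsum_eq: "qsum (\<alpha>, \<beta>, \<gamma>) = represented_quadratic_form.form_sum p (\<lambda>x. tr (quad \<alpha> \<beta> \<gamma> x))"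
proof -
  interpret Q: represented_quadratic_form p m ty "\<lambda>x. tr (quad \<alpha> \<beta> \<gamma> x)" "\<lambda>x y. tr (polar \<alpha> \<beta> \<gamma> x y)" "polar_op \<alpha> \<beta> \<gamma>"
    by (rule represented_quad)
  show ?thesis unfolding qsum_def Q.form_sum_def by (simp add: dot3_diag_vec psi_def)
qed

definition form_class :: "int \<Rightarrow> nat \<Rightarrow> ('a \<times> 'a \<times> 'a) set" where
  "form_class \<epsilon> i = {t. qsum t = form_value p m \<epsilon> i}"

lemma qsum_0: "qsum 0 = of_nat (p ^ m)"
  by (simp add: qsum_def dot3_def card_field)

text \<open>Since \<open>i \<le> 4 < m\<close>, the modulus is strictly below \<open>p ^ m\<close>,
  the value of the zero triple.\<close>

lemma norm_form_value_neq:
  assumes "i \<le> 4" "\<epsilon> \<in> {1, - 1}"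
  shows "norm (form_value p m \<epsilon> i) \<noteq> norm (of_nat (p ^ m) :: complex)"
proof
  assume eq: "norm (form_value p m \<epsilon> i) = norm (of_nat (p ^ m) :: complex)"
  have "norm (of_nat (p ^ m) :: complex) = real p ^ m"
    unfolding norm_of_nat by simp
  then have "real p ^ (m + i) = (real p ^ m)\<^sup>2"
    using norm_form_value[of i m \<epsilon> p] eq assms m_ge_5 p_gt_1 by simp
  then have "real p ^ (m + i) = real p ^ (m + m)"
    by (simp only: power_add power2_eq_square)
  then have "m + i = m + m" using p_gt_1 by (subst (asm) power_inject_exp) auto
  then show False using assms m_ge_5 by simp
qed

text \<open>The modulus gives \<open>i\<close>; opposite signs would make two phases negatives of
  each other.\<close>

lemma form_value_phase_inject:
  assumes "form_value p m \<epsilon> i * add_char z = form_value p m \<epsilon>' i' * add_char z'"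
    "i \<le> 4" "i' \<le> 4" "\<epsilon> \<in> {1, - 1}" "\<epsilon>' \<in> {1, - 1}" "z \<in> prime_field" "z' \<in> prime_field"
  shows "i = i' \<and> \<epsilon> = \<epsilon>'"
proof -
  have "norm (form_value p m \<epsilon> i * add_char z) = norm (form_value p m \<epsilon>' i' * add_char z')"
    using assms(1) by simp
  then have "norm (form_value p m \<epsilon> i) = norm (form_value p m \<epsilon>' i')"
    by (simp add: norm_mult)
  then have "real p ^ (m + i) = real p ^ (m + i')"
    using norm_form_value[of i m \<epsilon> p] norm_form_value[of i' m \<epsilon>' p] assms(2-5) p_gt_1 m_ge_5
    by simp
  then have i: "i = i'" using p_gt_1 by simp
  moreover have "\<epsilon> \<noteq> - \<epsilon>'"
  proof
    assume "\<epsilon> = - \<epsilon>'"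
    then have "form_value p m \<epsilon>' i' * - add_char z = form_value p m \<epsilon>' i' * add_char z'"
      using assms(1) i by (simp add: form_value_minus)
    moreover have "form_value p m \<epsilon>' i' \<noteq> 0" using assms(5) p_gt_1 by (intro form_value_neq_0) auto
    ultimately have "add_char z' = - add_char z" by (metis mult_left_cancel)
    then show False using add_char_neq_uminus assms(6,7) by blast
  qed
  ultimately show ?thesis using assms(4,5) by auto
qed

lemma zero_notin_form_class: "i \<le> 4 \<Longrightarrow> \<epsilon> \<in> {1, - 1} \<Longrightarrow> 0 \<notin> form_class \<epsilon> i"
  using norm_form_value_neq[of i \<epsilon>] by (auto simp: form_class_def qsum_0)

lemma form_class_cover:
  assumes "t \<noteq> 0" shows "\<exists>i\<le>4. \<exists>\<epsilon>\<in>{1, - 1}. t \<in> form_class \<epsilon> i"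
proof -
  obtain \<alpha> \<beta> \<gamma> where t: "t = (\<alpha>, \<beta>, \<gamma>)" by (metis surj_pair)
  interpret Q: represented_quadratic_form p m ty "\<lambda>x. tr (quad \<alpha> \<beta> \<gamma> x)" "\<lambda>x y. tr (polar \<alpha> \<beta> \<gamma> x y)" "polar_op \<alpha> \<beta> \<gamma>"
    by (rule represented_quad)
  obtain i \<epsilon> where i: "i \<le> m" "\<epsilon> \<in> {1, - 1 :: int}" "Q.form_sum = form_value p m \<epsilon> i" "card Q.radical = p ^ i"
    using Q.form_sum_classification by (elim exE bexE conjE) (rule that)
  have "p ^ i \<le> p ^ 4"
    using card_polar_op_kernel[of \<alpha> \<beta> \<gamma>] assms i(4) by (simp add: t zero_prod_def Q.radical_def)
  then have "i \<le> 4" using p_gt_1 by (simp add: power_increasing_iff)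
  moreover have "t \<in> form_class \<epsilon> i" using i(3) by (simp add: form_class_def t qsum_eq)
  ultimately show ?thesis using i(2) by (intro exI[of _ i] conjI bexI[of _ \<epsilon>])
qed

lemma sum_over_classes:
  fixes F :: "'a \<times> 'a \<times> 'a \<Rightarrow> 'b::comm_semiring_1"
  assumes F: "\<And>i \<epsilon> t. i \<le> 4 \<Longrightarrow> \<epsilon> \<in> {1, - 1} \<Longrightarrow> t \<in> form_class \<epsilon> i \<Longrightarrow> F t = \<phi> \<epsilon> i"
  shows "(\<Sum>t\<in>UNIV. F t)
    = F 0 + (\<Sum>i\<le>4. of_nat (card (form_class 1 i)) * \<phi> 1 i + of_nat (card (form_class (- 1) i)) * \<phi> (- 1) i)"
proof -
  define I :: "(nat \<times> int) set" where "I = {..4} \<times> {1, - 1}"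
  define C where "C = (\<lambda>(i, \<epsilon>). form_class \<epsilon> i)"
  have UNIV: "UNIV = insert 0 (\<Union>j\<in>I. C j)"
  proof (intro equalityI subsetI)
    fix t :: "'a \<times> 'a \<times> 'a"
    show "t \<in> insert 0 (\<Union>j\<in>I. C j)"
    proof (cases "t = 0")
      case False
      then obtain i \<epsilon> where "i \<le> 4" "\<epsilon> \<in> {1, - 1 :: int}" "t \<in> form_class \<epsilon> i"
        using form_class_cover by blast
      then have "(i, \<epsilon>) \<in> I" "t \<in> C (i, \<epsilon>)" by (auto simp: I_def C_def)
      then show ?thesis by blast
    qed simp
  qed simp
  have zero: "0 \<notin> (\<Union>j\<in>I. C j)" by (auto simp: I_def C_def zero_notin_form_class)
  have disj: "C j \<inter> C l = {}" if "j \<in> I" "l \<in> I" "j \<noteq> l" for j l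
  proof (rule ccontr)
    assume "C j \<inter> C l \<noteq> {}"
    then obtain t where "t \<in> C j" "t \<in> C l" by blast
    then have "form_value p m (snd j) (fst j) * add_char 0 = form_value p m (snd l) (fst l) * add_char 0"
      by (simp add: C_def form_class_def case_prod_unfold)
    then have "fst j = fst l \<and> snd j = snd l"
      by (rule form_value_phase_inject) (use that in \<open>auto simp: I_def\<close>)
    then show False using that(3) by (simp add: prod_eq_iff)
  qed
  have "(\<Sum>t\<in>UNIV. F t) = F 0 + (\<Sum>t\<in>(\<Union>j\<in>I. C j). F t)"
    by (subst UNIV, subst sum.insert) (use zero in \<open>auto simp: I_def\<close>)
  also have "(\<Sum>t\<in>(\<Union>j\<in>I. C j). F t) = (\<Sum>j\<in>I. \<Sum>t\<in>C j. F t)"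
    by (rule sum.UNION_disjoint) (use disj in \<open>auto simp: I_def\<close>)
  also have "\<dots> = (\<Sum>j\<in>I. of_nat (card (form_class (snd j) (fst j))) * \<phi> (snd j) (fst j))"
  proof (rule sum.cong[OF refl])
    fix j assume "j \<in> I"
    then have j: "fst j \<le> 4" "snd j \<in> {1, - 1}" by (auto simp: I_def)
    have "(\<Sum>t\<in>C j. F t) = (\<Sum>t\<in>C j. \<phi> (snd j) (fst j))"
    proof (rule sum.cong[OF refl])
      fix t assume "t \<in> C j"
      then have "t \<in> form_class (snd j) (fst j)" by (simp add: C_def case_prod_unfold)
      then show "F t = \<phi> (snd j) (fst j)" by (rule F[OF j])
    qed
    then show "(\<Sum>t\<in>C j. F t) = of_nat (card (form_class (snd j) (fst j))) * \<phi> (snd j) (fst j)"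
      by (simp add: C_def case_prod_unfold)
  qed
  also have "\<dots> = (\<Sum>i\<le>4. \<Sum>\<epsilon>\<in>{1, - 1}. of_nat (card (form_class \<epsilon> i)) * \<phi> \<epsilon> i)"
    unfolding I_def sum.cartesian_product by (simp add: case_prod_unfold)
  finally show ?thesis by simp
qed

lemma qsum_smult3_class:
  assumes "i \<le> m" "\<epsilon> \<in> {1, - 1}" "t \<in> form_class \<epsilon> i" "c \<in> prime_field - {0}"
  shows "qsum (smult3 c t) = of_int (quad_char c ^ (m - i)) * qsum t"
proof -
  obtain \<alpha> \<beta> \<gamma> where t: "t = (\<alpha>, \<beta>, \<gamma>)" by (metis surj_pair)
  interpret Q: represented_quadratic_form p m ty "\<lambda>x. tr (quad \<alpha> \<beta> \<gamma> x)" "\<lambda>x y. tr (polar \<alpha> \<beta> \<gamma> x y)" "polar_op \<alpha> \<beta> \<gamma>"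
    by (rule represented_quad)
  have form_sum: "Q.form_sum = form_value p m \<epsilon> i"
    using assms(3) by (simp add: form_class_def t qsum_eq)
  have "dot3 (smult3 c t) (diag_vec x) = c * quad \<alpha> \<beta> \<gamma> x" for x
    by (simp add: t smult3_def dot3_def diag_vec_def quad_def algebra_simps)
  then have "qsum (smult3 c t) = (\<Sum>x\<in>UNIV. add_char (c * tr (quad \<alpha> \<beta> \<gamma> x)))"
    unfolding qsum_def psi_def using assms(4) by (simp add: tr_scale)
  then show ?thesis
    unfolding Q.form_sum_multiple[OF assms(1,2) form_sum assms(4)] t qsum_eq .
qed

text \<open>Scaling the triple by a nonsquare multiplies the sum by \<open>(- 1) ^ (m - i)\<close>,
  so in odd rank it maps each class injectively into the other.\<close>

lemma card_form_class_symmetric: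
  assumes "odd (m - i)" "i \<le> m" shows "card (form_class 1 i) = card (form_class (- 1) i)"
proof -
  obtain c where c: "c \<in> prime_field - {0} - squares" using ex_nonsquare by blast
  have qc: "quad_char c = - 1" using c by (simp add: quad_char_def)
  have mem: "smult3 c t \<in> form_class (- \<epsilon>) i" if "t \<in> form_class \<epsilon> i" "\<epsilon> \<in> {1, - 1}" for t \<epsilon>
    using qsum_smult3_class[OF assms(2) that(2,1), of c] c that assms(1)
    by (simp add: form_class_def form_value_minus qc)
  have inj: "inj_on (smult3 c) A" for A
    using c by (auto simp: inj_on_def smult3_def prod_eq_iff)
  have "card (form_class \<epsilon> i) \<le> card (form_class (- \<epsilon>) i)" if "\<epsilon> \<in> {1, - 1}" for \<epsilon>
  proof (rule card_inj_on_le[OF inj])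
    show "smult3 c ` form_class \<epsilon> i \<subseteq> form_class (- \<epsilon>) i" using mem that by blast
  qed simp
  from this[of 1] this[of "- 1"] show ?thesis by simp
qed

end

section \<open>Value distribution\<close>

lemma sum_atMost_4: "(\<Sum>i\<le>4. f i) = f 0 + f 1 + f 2 + f 3 + f (4 :: nat)"
  for f :: "nat \<Rightarrow> 'a::comm_monoid_add"
proof -
  have "{..4 :: nat} = {0, 1, 2, 3, 4}" by auto
  then show ?thesis by (simp add: add.assoc)
qed

context quadratic_family
begin

section \<open>Solving for the class sizes\<close>

definition class_size :: "int \<Rightarrow> nat \<Rightarrow> real" where
  "class_size \<epsilon> i = real (card (form_class \<epsilon> i))"

lemma real_sum_over_classes:
  assumes "\<And>i \<epsilon> t. i \<le> 4 \<Longrightarrow> \<epsilon> \<in> {1, - 1} \<Longrightarrow> t \<in> form_class \<epsilon> i \<Longrightarrow> F t = of_real (\<phi> \<epsilon> i)"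
    and "F 0 = of_real a" and "(\<Sum>t\<in>UNIV. F t) = (of_real b :: complex)"
  shows "a + (\<Sum>i\<le>4. class_size 1 i * \<phi> 1 i + class_size (- 1) i * \<phi> (- 1) i) = b"
proof -
  have "complex_of_real b = of_real (a + (\<Sum>i\<le>4. class_size 1 i * \<phi> 1 i + class_size (- 1) i * \<phi> (- 1) i))"
    using sum_over_classes[of F "\<lambda>\<epsilon> i. of_real (\<phi> \<epsilon> i)", OF assms(1)] assms(2,3)
    by (simp add: class_size_def)
  then show ?thesis by (simp only: of_real_eq_iff)
qed

lemma qsum_mult_cnj_class:
  assumes "i \<le> 4" "\<epsilon> \<in> {1, - 1}" "t \<in> form_class \<epsilon> i"
  shows "qsum t * cnj (qsum t) = of_real (real p ^ (m + i))"
  using norm_form_value[of i m \<epsilon> p] assms m_ge_5 p_gt_1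
  by (simp add: form_class_def flip: complex_norm_square)

text \<open>Scaling by \<open>c\<close> contributes the sign \<open>(- 1) ^ (m - i)\<close>, and the
  remaining -1 conjugates. So a twisted moment is an absolute moment weighted by the parity of the
  rank.\<close>

lemma qsum_twisted_class:
  assumes "i \<le> 4" "\<epsilon> \<in> {1, - 1}" "t \<in> form_class \<epsilon> i" "c \<in> prime_field - {0} - squares"
  shows "qsum t * qsum (smult3 (- c) t) = of_real ((- 1) ^ (m - i) * real p ^ (m + i))"
proof -
  have "quad_char c = - 1" using assms(4) by (simp add: quad_char_def)
  then have "qsum (smult3 c t) = (- 1) ^ (m - i) * qsum t"
    using qsum_smult3_class[of i \<epsilon> t c] assms m_ge_5 by simp
  moreover have "smult3 (- c) t = smult3 (- 1) (smult3 c t)"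
    by (simp add: smult3_def)
  ultimately have "qsum (smult3 (- c) t) = (- 1) ^ (m - i) * cnj (qsum t)"
    by (simp flip: cnj_qsum)
  then have "qsum t * qsum (smult3 (- c) t) = (- 1) ^ (m - i) * (qsum t * cnj (qsum t))"
    by simp
  then show ?thesis
    unfolding qsum_mult_cnj_class[OF assms(1-3)] by simp
qed

lemma qsum_twisted_0: "qsum (smult3 c 0) = of_nat (p ^ m)"
proof -
  have "smult3 c 0 = 0" by (simp add: smult3_def zero_prod_def)
  then show ?thesis by (simp only: qsum_0)
qed

lemma class_sizes:
  assumes "i \<le> 4" "\<epsilon> \<in> {1, - 1}"
  shows "class_size \<epsilon> i = n_signed p m \<epsilon> i"
proof -
  define h where "h = (m - 3) div 2"
  have m: "m = 2 * h + 3" using odd_m m_ge_5 unfolding h_def by presburger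
  define P q u where "P = real p" and "q = P ^ m" and "u = P ^ h"
  define K where "K = P ^ 6 * u ^ 4 - P ^ 4 * u ^ 4 - P ^ 3 * u ^ 4 + P * u ^ 2 + u ^ 2 - 1"
  define x y where "x = class_size 1" and "y = class_size (- 1)"
  obtain c where c: "c \<in> prime_field - {0} - squares" using ex_nonsquare by blast
  have P1: "P > 1" and u0: "u > 0" using p_gt_1 by (simp_all add: P_def u_def)
  have q: "q = P ^ 3 * u ^ 2"
    unfolding q_def u_def m by (simp add: power_add power_mult mult.commute)
  have q_nat: "complex_of_nat (p ^ m) = of_real q" by (simp add: q_def P_def)
  have pow: "real p ^ (m + j) = q * P ^ j" for j by (simp add: q_def P_def power_add)
  have sgn: "(- 1) ^ (m - 0) = (- 1 :: real)" "(- 1) ^ (m - 1) = (1 :: real)" "(- 1) ^ (m - 2) = (- 1 :: real)"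
    "(- 1) ^ (m - 3) = (1 :: real)" "(- 1) ^ (m - 4) = (- 1 :: real)"
    using odd_m m_ge_5 by simp_all
  have sym: "y 0 = x 0" "y 2 = x 2" "y 4 = x 4"
    using card_form_class_symmetric[of 0] card_form_class_symmetric[of 2] card_form_class_symmetric[of 4]
      odd_m m_ge_5 by (simp_all add: x_def y_def class_size_def)
  have val: "form_value p m \<epsilon> 1 = of_real (of_int \<epsilon> * (P ^ 2 * u))"
    "form_value p m \<epsilon> 3 = of_real (of_int \<epsilon> * (P ^ 3 * u))" for \<epsilon>
  proof -
    have "(m + 1) div 2 = h + 2" "(m + 3) div 2 = h + 3" "even (m - 1)" "even (m - 3)" using m by simp_all
    then show "form_value p m \<epsilon> 1 = of_real (of_int \<epsilon> * (P ^ 2 * u))"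
      "form_value p m \<epsilon> 3 = of_real (of_int \<epsilon> * (P ^ 3 * u))"
      by (simp_all add: form_value_def P_def u_def power_add power2_eq_square power3_eq_cube mult_ac)
  qed
  have count: "1 + 2 * x 0 + (x 1 + y 1) + 2 * x 2 + (x 3 + y 3) + 2 * x 4 = q ^ 3"
  proof -
    have "1 + (\<Sum>i\<le>4. class_size 1 i * 1 + class_size (- 1) i * 1) = q ^ 3"
    proof (rule real_sum_over_classes[of "\<lambda>_. 1"])
      show "(\<Sum>t\<in>(UNIV :: ('a \<times> 'a \<times> 'a) set). 1) = complex_of_real (q ^ 3)"
        by (simp add: card_cartesian_product card_field q_def P_def power3_eq_cube flip: UNIV_Times_UNIV)
    qed simp_all
    then show ?thesis unfolding sum_atMost_4 x_def[symmetric] y_def[symmetric] sym by simp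
  qed
  \<comment> \<open>Classes of odd rank drop out of M1: their sizes agree and their values are
    opposite.\<close>
  have odd_cancel: "a * form_value p m 1 i + a * form_value p m (- 1) i = 0" for a i
    by (simp add: form_value_minus)
  have M1: "q + P ^ 2 * u * (x 1 - y 1) + P ^ 3 * u * (x 3 - y 3) = q ^ 3"
  proof -
    have "complex_of_real (q ^ 3) = of_real q + (\<Sum>i\<le>4. of_real (x i) * form_value p m 1 i + of_real (y i) * form_value p m (- 1) i)"
      using sum_over_classes[of qsum "form_value p m"] moment_1
      by (simp add: form_class_def qsum_0 x_def y_def class_size_def q_def P_def)
    also have "\<dots> = of_real (q + P ^ 2 * u * (x 1 - y 1) + P ^ 3 * u * (x 3 - y 3))"
      unfolding sum_atMost_4 sym odd_cancel val by (simp add: algebra_simps)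
    finally show ?thesis by (simp only: of_real_eq_iff)
  qed
  have M2: "q ^ 2 + q * (2 * x 0 + P * (x 1 + y 1) + P ^ 2 * (2 * x 2) + P ^ 3 * (x 3 + y 3) + P ^ 4 * (2 * x 4))
      = q ^ 3 * (2 * q - 1)"
  proof -
    have "q ^ 2 + (\<Sum>i\<le>4. class_size 1 i * real p ^ (m + i) + class_size (- 1) i * real p ^ (m + i)) = q ^ 3 * (2 * q - 1)"
    proof (rule real_sum_over_classes)
      show "(\<Sum>t\<in>UNIV. qsum t * cnj (qsum t)) = complex_of_real (q ^ 3 * (2 * q - 1))"
        unfolding moment_2 using p_gt_1 by (simp add: of_nat_diff q_def P_def)
    qed (simp_all add: qsum_mult_cnj_class qsum_0 q_def P_def power2_eq_square)
    then show ?thesis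
      unfolding sum_atMost_4 x_def[symmetric] y_def[symmetric] sym pow by (simp add: algebra_simps)
  qed
  have M2': "q ^ 2 + q * (- (2 * x 0) + P * (x 1 + y 1) - P ^ 2 * (2 * x 2) + P ^ 3 * (x 3 + y 3) - P ^ 4 * (2 * x 4))
      = q ^ 3"
  proof -
    have "q ^ 2 + (\<Sum>i\<le>4. class_size 1 i * ((- 1) ^ (m - i) * real p ^ (m + i))
        + class_size (- 1) i * ((- 1) ^ (m - i) * real p ^ (m + i))) = q ^ 3"
    proof (rule real_sum_over_classes)
      show "(\<Sum>t\<in>UNIV. qsum t * qsum (smult3 (- c) t)) = complex_of_real (q ^ 3)"
        unfolding moment_2_twisted[OF c] by (simp add: q_def P_def)
      show "qsum 0 * qsum (smult3 (- c) 0) = complex_of_real (q ^ 2)"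
        by (simp add: qsum_0 qsum_twisted_0 q_def P_def power2_eq_square)
    qed (rule qsum_twisted_class[OF _ _ _ c])
    then show ?thesis
      unfolding sum_atMost_4 x_def[symmetric] y_def[symmetric] sym pow sgn by (simp add: algebra_simps)
  qed
  have M3: "q ^ 3 + q * (P * (P ^ 2 * u) * (x 1 - y 1) + P ^ 3 * (P ^ 3 * u) * (x 3 - y 3))
      = q ^ 3 * (q + (q - 1) * P)"
  proof -
    have "complex_of_real (q ^ 3 * (q + (q - 1) * P)) = of_real (q ^ 3)
        + (\<Sum>i\<le>4. of_real (x i) * (of_real (real p ^ (m + i)) * form_value p m 1 i)
          + of_real (y i) * (of_real (real p ^ (m + i)) * form_value p m (- 1) i))"
    proof -
      have "(\<Sum>t\<in>UNIV. qsum t * cnj (qsum t) * qsum t) = qsum 0 * cnj (qsum 0) * qsum 0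
        + (\<Sum>i\<le>4. of_nat (card (form_class 1 i)) * (of_real (real p ^ (m + i)) * form_value p m 1 i)
          + of_nat (card (form_class (- 1) i)) * (of_real (real p ^ (m + i)) * form_value p m (- 1) i))"
      proof (rule sum_over_classes)
        fix i \<epsilon> t assume a: "i \<le> 4" "\<epsilon> \<in> {1, - 1 :: int}" "t \<in> form_class \<epsilon> i"
        then have t: "qsum t = form_value p m \<epsilon> i" by (simp add: form_class_def)
        have "qsum t * cnj (qsum t) * qsum t = of_real (real p ^ (m + i)) * qsum t"
          by (simp only: qsum_mult_cnj_class[OF a])
        then show "qsum t * cnj (qsum t) * qsum t = of_real (real p ^ (m + i)) * form_value p m \<epsilon> i"
          by (simp only: t)
      qed
      moreover have "complex_of_nat (p ^ m + (p ^ m - 1) * p) = of_real (q + (q - 1) * P)"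
        using p_gt_1 by (simp add: of_nat_diff q_def P_def)
      ultimately show ?thesis
        unfolding moment_3 by (simp add: qsum_0 x_def y_def class_size_def q_nat power3_eq_cube mult.assoc
            del: of_nat_power of_real_power)
    qed
    also have "\<dots> = of_real (q ^ 3 + q * (P * (P ^ 2 * u) * (x 1 - y 1) + P ^ 3 * (P ^ 3 * u) * (x 3 - y 3)))"
    proof -
      have cancel: "of_real (x i) * (of_real (real p ^ (m + i)) * form_value p m 1 i)
          + of_real (x i) * (of_real (real p ^ (m + i)) * form_value p m (- 1) i) = 0" for i
        by (simp add: form_value_minus)
      show ?thesis
        unfolding sum_atMost_4 sym cancel unfolding val pow by (simp add: algebra_simps)
    qed
    finally show ?thesis by (simp only: of_real_eq_iff)
  qed
  have M4: "q ^ 4 + q ^ 2 * (2 * x 0 + P ^ 2 * (x 1 + y 1) + P ^ 4 * (2 * x 2) + P ^ 6 * (x 3 + y 3) + P ^ 8 * (2 * x 4))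
      = q ^ 3 * (q * (2 * q - 1) + (q - 1) * (2 * P * q - P ^ 2))"
  proof -
    have "q ^ 4 + (\<Sum>i\<le>4. class_size 1 i * (real p ^ (m + i) * real p ^ (m + i))
          + class_size (- 1) i * (real p ^ (m + i) * real p ^ (m + i)))
        = q ^ 3 * (q * (2 * q - 1) + (q - 1) * (2 * P * q - P ^ 2))"
    proof (rule real_sum_over_classes)
      have "p\<^sup>2 \<le> p ^ m" using p_gt_1 m_ge_5 by (intro power_increasing) auto
      also have "\<dots> \<le> 2 * p * p ^ m" using p_gt_1 by simp
      finally have le: "p\<^sup>2 \<le> 2 * p * p ^ m" .
      show "(\<Sum>t\<in>UNIV. qsum t * cnj (qsum t) * (qsum t * cnj (qsum t)))
          = complex_of_real (q ^ 3 * (q * (2 * q - 1) + (q - 1) * (2 * P * q - P ^ 2)))"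
        unfolding moment_4 using p_gt_1 le by (simp add: of_nat_diff q_def P_def)
    qed (simp_all add: qsum_mult_cnj_class qsum_0 q_def P_def power4_eq_xxxx)
    then show ?thesis
      unfolding sum_atMost_4 x_def[symmetric] y_def[symmetric] sym pow
      by (simp add: algebra_simps power2_eq_square eval_nat_numeral)
  qed
  have M4': "q ^ 4 + q ^ 2 * (- (2 * x 0) + P ^ 2 * (x 1 + y 1) - P ^ 4 * (2 * x 2) + P ^ 6 * (x 3 + y 3) - P ^ 8 * (2 * x 4))
      = q ^ 3 * (q + (q - 1) * P ^ 2)"
  proof -
    have "q ^ 4 + (\<Sum>i\<le>4. class_size 1 i * (real p ^ (m + i) * ((- 1) ^ (m - i) * real p ^ (m + i)))
          + class_size (- 1) i * (real p ^ (m + i) * ((- 1) ^ (m - i) * real p ^ (m + i))))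
        = q ^ 3 * (q + (q - 1) * P ^ 2)"
    proof (rule real_sum_over_classes)
      show "(\<Sum>t\<in>UNIV. qsum t * cnj (qsum t) * (qsum t * qsum (smult3 (- c) t)))
          = complex_of_real (q ^ 3 * (q + (q - 1) * P ^ 2))"
        unfolding moment_4_twisted[OF c] using p_gt_1 by (simp add: of_nat_diff q_def P_def)
      show "qsum 0 * cnj (qsum 0) * (qsum 0 * qsum (smult3 (- c) 0)) = complex_of_real (q ^ 4)"
        by (simp add: qsum_0 qsum_twisted_0 q_def P_def power4_eq_xxxx)
      fix i \<epsilon> t assume a: "i \<le> 4" "\<epsilon> \<in> {1, - 1 :: int}" "t \<in> form_class \<epsilon> i"
      show "qsum t * cnj (qsum t) * (qsum t * qsum (smult3 (- c) t))
          = complex_of_real (real p ^ (m + i) * ((- 1) ^ (m - i) * real p ^ (m + i)))"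
        unfolding qsum_mult_cnj_class[OF a] qsum_twisted_class[OF a c] by (simp only: of_real_mult)
    qed
    then show ?thesis
      unfolding sum_atMost_4 x_def[symmetric] y_def[symmetric] sym pow sgn
      by (simp add: algebra_simps power2_eq_square eval_nat_numeral)
  qed
  note sol = class_size_system[OF P1 u0 q K_def count M1 M2 M2' M3 M4 M4']
  have powers: "real p ^ (m + 1) = P ^ 4 * u ^ 2" "real p ^ ((m + 3) div 2) = P ^ 3 * u"
    "real p ^ (2 * m) = P ^ 6 * u ^ 4" "real p ^ (2 * m - 2) = P ^ 4 * u ^ 4"
    "real p ^ (2 * m - 3) = P ^ 3 * u ^ 4" "real p ^ (m - 2) = P * u ^ 2" "real p ^ (m - 3) = u ^ 2"
    "real p ^ ((m - 3) div 2) = u" "real p ^ (m - 1) = P ^ 2 * u ^ 2" "real p ^ m = q"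
    "real p ^ (2 * m - 1) = P ^ 5 * u ^ 4" "real p ^ (2 * m - 4) = P ^ 2 * u ^ 4"
  proof -
    have e: "m + 1 = 4 + h * 2" "(m + 3) div 2 = 3 + h" "2 * m = 6 + h * 4" "2 * m - 2 = 4 + h * 4"
      "2 * m - 3 = 3 + h * 4" "m - 2 = 1 + h * 2" "m - 3 = h * 2" "(m - 3) div 2 = h" "m - 1 = 2 + h * 2"
      "2 * m - 1 = 5 + h * 4" "2 * m - 4 = 2 + h * 4" using m by simp_all
    show "real p ^ (m + 1) = P ^ 4 * u ^ 2" "real p ^ ((m + 3) div 2) = P ^ 3 * u"
      "real p ^ (2 * m) = P ^ 6 * u ^ 4" "real p ^ (2 * m - 2) = P ^ 4 * u ^ 4"
      "real p ^ (2 * m - 3) = P ^ 3 * u ^ 4" "real p ^ (m - 2) = P * u ^ 2" "real p ^ (m - 3) = u ^ 2"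
      "real p ^ ((m - 3) div 2) = u" "real p ^ (m - 1) = P ^ 2 * u ^ 2" "real p ^ m = q"
      "real p ^ (2 * m - 1) = P ^ 5 * u ^ 4" "real p ^ (2 * m - 4) = P ^ 2 * u ^ 4"
      \<comment> \<open>\<open>e(3)\<close> rewrites \<open>2 * m\<close>, which also occurs inside
        \<open>2 * m - 2\<close> and its like, so it has to come after the others.\<close>
      unfolding e(1,2,4-) unfolding e(3) P_def[symmetric] u_def power_add power_mult q_def by simp_all
  qed
  consider "i = 0" | "i = 1" | "i = 2" | "i = 3" | "i = 4" using assms(1) by linarith
  moreover have n: "class_size 1 0 = n0 p m" "class_size 1 1 = n1 p m 1" "class_size (- 1) 1 = n1 p m (- 1)"
    "class_size 1 2 = n2 p m" "class_size 1 3 = n3 p m 1" "class_size (- 1) 3 = n3 p m (- 1)"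
    "class_size 1 4 = n4 p m"
    unfolding n0_def n1_def n2_def n3_def n4_def unfolding powers
    unfolding x_def[symmetric] y_def[symmetric] P_def[symmetric] K_def[symmetric] sol by simp_all
  moreover have "class_size (- 1) 0 = n0 p m" "class_size (- 1) 2 = n2 p m" "class_size (- 1) 4 = n4 p m"
    using sym n by (simp_all add: x_def y_def)
  ultimately show ?thesis using assms(2)
    by cases (auto simp: n_signed_def eval_nat_numeral)
qed

section \<open>From coefficient triples to quadruples\<close>

definition quad_sum :: "'a \<times> 'a \<times> 'a \<Rightarrow> 'a \<Rightarrow> complex" where
  "quad_sum t = exp_sum p m k (fst t) (fst (snd t)) (snd (snd t))"

lemma num_quadruples_eq:
  "real (num_quadruples (exp_sum p m k :: 'a \<Rightarrow> _) v) = (\<Sum>t\<in>UNIV. real (card {\<delta>. quad_sum t \<delta> = v}))"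
proof -
  have "bij_betw (\<lambda>(t, \<delta>). (fst t, fst (snd t), snd (snd t), \<delta>)) (SIGMA t:UNIV. {\<delta> :: 'a. quad_sum t \<delta> = v})
      {(\<alpha>, \<beta>, \<gamma>, \<delta>). exp_sum p m k \<alpha> \<beta> \<gamma> \<delta> = v}"
    by (rule bij_betw_byWitness[where f' = "\<lambda>(\<alpha>, \<beta>, \<gamma>, \<delta>). ((\<alpha>, \<beta>, \<gamma>), \<delta>)"]) (auto simp: quad_sum_def)
  from bij_betw_same_card[OF this] show ?thesis
    unfolding num_quadruples_def of_nat_sum[symmetric] by simp
qed

lemma quad_sum_0: "quad_sum 0 \<delta> = (if \<delta> = 0 then of_nat (p ^ m) else 0)"
proof -
  have "quad_sum 0 \<delta> = (\<Sum>x\<in>UNIV. psi (\<delta> * x))"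
    by (simp add: quad_sum_def exp_sum_def psi_def add_char_def)
  then show ?thesis by (simp only: sum_psi)
qed

text \<open>How many \<delta> produce the phase \<open>z\<close> for one fixed triple of the class,
  with both parities of the rank in one formula.\<close>

definition phase_count :: "int \<Rightarrow> nat \<Rightarrow> 'a \<Rightarrow> real" where
  "phase_count \<epsilon> i z =
    (if odd (m - i)
     then real p ^ (m - i - 1) + of_int \<epsilon> * of_int (quad_char (- z)) * real p ^ ((m - i - 1) div 2)
     else real p ^ (m - i - 1) + of_int \<epsilon> * ((if z = 0 then real p else 0) - 1) * real p ^ ((m - i - 2) div 2))"

context
  fixes i \<epsilon> t
  assumes i: "i \<le> 4" and \<epsilon>: "\<epsilon> \<in> {1, - 1}" and t: "t \<in> form_class \<epsilon> i"
begin

lemma card_quad_sum_eq: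
    "z \<in> prime_field \<Longrightarrow> real (card {\<delta>. quad_sum t \<delta> = form_value p m \<epsilon> i * add_char z}) = phase_count \<epsilon> i z"
  and card_quad_sum_eq_0: "real (card {\<delta>. quad_sum t \<delta> = 0}) = real p ^ m - real p ^ (m - i)"
  and quad_sum_values: "quad_sum t \<delta> \<noteq> 0 \<Longrightarrow> \<exists>z\<in>prime_field. quad_sum t \<delta> = form_value p m \<epsilon> i * add_char z"
proof -
  obtain \<alpha> \<beta> \<gamma> where abc: "t = (\<alpha>, \<beta>, \<gamma>)" by (metis surj_pair)
  interpret Q: represented_quadratic_form p m ty "\<lambda>x. tr (quad \<alpha> \<beta> \<gamma> x)" "\<lambda>x y. tr (polar \<alpha> \<beta> \<gamma> x y)" "polar_op \<alpha> \<beta> \<gamma>"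
    by (rule represented_quad)
  have form_sum: "Q.form_sum = form_value p m \<epsilon> i"
    using t by (simp add: form_class_def abc qsum_eq)
  have eq: "quad_sum t \<delta> = Q.affine_sum \<delta>" for \<delta> by (simp add: quad_sum_def abc exp_sum_eq)
  have im: "i \<le> m" "i < m" using i m_ge_5 by simp_all
  show "z \<in> prime_field \<Longrightarrow> real (card {\<delta>. quad_sum t \<delta> = form_value p m \<epsilon> i * add_char z}) = phase_count \<epsilon> i z"
    using Q.card_affine_sum_odd_rank[OF im(1) \<epsilon> form_sum, of z]
      Q.card_affine_sum_even_rank[OF im(1) \<epsilon> form_sum _ im(2), of z]
    unfolding phase_count_def eq form_sum by simp
  show "real (card {\<delta>. quad_sum t \<delta> = 0}) = real p ^ m - real p ^ (m - i)"
    unfolding eq by (rule Q.card_affine_sum_eq_0'[OF im(1) \<epsilon> form_sum])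
  show "quad_sum t \<delta> \<noteq> 0 \<Longrightarrow> \<exists>z\<in>prime_field. quad_sum t \<delta> = form_value p m \<epsilon> i * add_char z"
    using Q.affine_sum_values unfolding eq form_sum by blast
qed

lemma norm_quad_sum: "quad_sum t \<delta> \<noteq> 0 \<Longrightarrow> norm (quad_sum t \<delta>) = norm (form_value p m \<epsilon> i)"
  using quad_sum_values[of \<delta>] by (auto simp: norm_mult)

end

text \<open>Only triples of the class of \<epsilon> and \<open>i\<close> contribute:
  \<open>form_value_phase_inject\<close> rules out the other classes, and the zero triple takes only
  the values 0 and \<open>p ^ m\<close>.\<close>

lemma num_quadruples_phase:
  assumes "i \<le> 4" "\<epsilon> \<in> {1, - 1}" "z \<in> prime_field"
  shows "real (num_quadruples (exp_sum p m k :: 'a \<Rightarrow> _) (form_value p m \<epsilon> i * add_char z))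
    = phase_count \<epsilon> i z * n_signed p m \<epsilon> i"
proof -
  define v where "v = form_value p m \<epsilon> i * add_char z"
  define F where "F t = real (card {\<delta>. quad_sum t \<delta> = v})" for t
  define \<phi> where "\<phi> \<epsilon>' i' = (if \<epsilon>' = \<epsilon> \<and> i' = i then phase_count \<epsilon> i z else 0)" for \<epsilon>' i'
  have norm_v: "norm v = norm (form_value p m \<epsilon> i)" by (simp add: v_def norm_mult)
  have v0: "v \<noteq> 0" using form_value_neq_0[of \<epsilon> p m i] assms(2) p_gt_1 norm_v by auto
  have F: "F t = \<phi> \<epsilon>' i'" if a: "i' \<le> 4" "\<epsilon>' \<in> {1, - 1}" "t \<in> form_class \<epsilon>' i'" for i' \<epsilon>' t
  proof (cases "\<epsilon>' = \<epsilon> \<and> i' = i")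
    case True
    then show ?thesis using card_quad_sum_eq[OF a assms(3)] by (simp add: F_def \<phi>_def v_def)
  next
    case False
    have "quad_sum t \<delta> \<noteq> v" for \<delta>
    proof
      assume eq: "quad_sum t \<delta> = v"
      then obtain z' where "z' \<in> prime_field" "v = form_value p m \<epsilon>' i' * add_char z'"
        using quad_sum_values[OF a, of \<delta>] v0 by auto
      then show False
        using form_value_phase_inject[of \<epsilon> i z \<epsilon>' i' z'] False a assms by (simp add: v_def)
    qed
    then show ?thesis unfolding F_def \<phi>_def if_not_P[OF False] by simp
  qed
  have "v \<noteq> of_nat (p ^ m)" using norm_form_value_neq[OF assms(1,2)] norm_v by metis
  then have "quad_sum 0 \<delta> \<noteq> v" for \<delta> using v0 by (auto simp: quad_sum_0)
  then have F0: "F 0 = 0" by (simp add: F_def)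
  have "real (num_quadruples (exp_sum p m k :: 'a \<Rightarrow> _) v)
      = (\<Sum>i'\<le>4. class_size 1 i' * \<phi> 1 i' + class_size (- 1) i' * \<phi> (- 1) i')"
    unfolding num_quadruples_eq F_def[symmetric] using sum_over_classes[of F \<phi>, OF F] F0
    by (simp add: class_size_def)
  also have "\<dots> = (\<Sum>i'\<le>4. if i' = i then class_size \<epsilon> i * phase_count \<epsilon> i z else 0)"
    using assms(2) by (intro sum.cong) (auto simp: \<phi>_def)
  also have "\<dots> = phase_count \<epsilon> i z * n_signed p m \<epsilon> i"
    using assms by (simp add: class_sizes)
  finally show ?thesis by (simp add: v_def)
qed

lemma num_quadruples_0: "real (num_quadruples (exp_sum p m k :: 'a \<Rightarrow> _) 0) = freq_zero p m"
proof -
  define F where "F t = real (card {\<delta>. quad_sum t \<delta> = 0})" for t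
  have "{\<delta>. quad_sum 0 \<delta> = 0} = UNIV - {0}" using p_gt_1 by (auto simp: quad_sum_0)
  then have F0: "F 0 = real p ^ m - 1"
    using p_gt_1 by (simp add: F_def card_Diff_subset card_field of_nat_diff)
  have "real (num_quadruples (exp_sum p m k :: 'a \<Rightarrow> _) 0)
      = F 0 + (\<Sum>i\<le>4. class_size 1 i * (real p ^ m - real p ^ (m - i))
          + class_size (- 1) i * (real p ^ m - real p ^ (m - i)))"
    unfolding num_quadruples_eq F_def[symmetric] class_size_def
    by (rule sum_over_classes) (simp add: F_def card_quad_sum_eq_0)
  also have "\<dots> = freq_zero p m"
    unfolding sum_atMost_4 F0 freq_zero_def n_total_def by (simp add: class_sizes algebra_simps)
  finally show ?thesis .
qed

lemma num_quadruples_q: "num_quadruples (exp_sum p m k :: 'a \<Rightarrow> _) (of_nat (p ^ m)) = 1"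
proof -
  define F where "F t = real (card {\<delta>. quad_sum t \<delta> = of_nat (p ^ m)})" for t
  have "{\<delta>. quad_sum 0 \<delta> = of_nat (p ^ m)} = {0}" using p_gt_1 by (auto simp: quad_sum_0)
  then have F0: "F 0 = 1" by (simp add: F_def)
  have F: "F t = 0" if a: "i \<le> 4" "\<epsilon> \<in> {1, - 1}" "t \<in> form_class \<epsilon> i" for i \<epsilon> t
  proof -
    have "quad_sum t \<delta> \<noteq> of_nat (p ^ m)" for \<delta>
      using norm_quad_sum[OF a, of \<delta>] norm_form_value_neq[OF a(1,2)] p_gt_1 by auto
    then show ?thesis by (simp add: F_def)
  qed
  have "real (num_quadruples (exp_sum p m k :: 'a \<Rightarrow> _) (of_nat (p ^ m))) = F 0 + (\<Sum>i\<le>4. class_size 1 i * 0 + class_size (- 1) i * 0)"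
    unfolding num_quadruples_eq F_def[symmetric] class_size_def
    by (rule sum_over_classes) (rule F)
  then show ?thesis by (simp add: F0)
qed

text \<open>Because \<open>m\<close> is odd, an even \<open>i\<close> means odd rank, the branch of
  \<open>form_value\<close> with \<open>sqrt_pstar\<close>.\<close>

lemma value_even_eq: "i \<in> {0, 2, 4} \<Longrightarrow> value_even p m \<epsilon> i j = form_value p m \<epsilon> i * add_char (of_nat j)"
  using odd_m m_ge_5 by (auto simp: value_even_def form_value_def add_char_of_nat)

lemma value_odd_eq: "i \<in> {1, 3} \<Longrightarrow> value_odd p m \<epsilon> i j = form_value p m \<epsilon> i * add_char (of_nat j)"
  using odd_m m_ge_5 by (auto simp: value_odd_def form_value_def add_char_of_nat)

text \<open>The separate case \<open>j = 0\<close> of \<open>freq_even\<close> is absorbed by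
  \<open>quad_char 0 = 0\<close>.\<close>

lemma freq_even_eq:
  "i \<in> {0, 2, 4} \<Longrightarrow> freq_even p m \<epsilon> i j = phase_count \<epsilon> i (of_nat j) * n_signed p m \<epsilon> i"
  using odd_m m_ge_5 quad_char_of_int[of "- int j"] quad_char_of_int[of 0]
  by (auto simp: freq_even_def phase_count_def quad_char_def)

lemma freq_odd_eq:
  assumes "i \<in> {1, 3}" "j < p"
  shows "freq_odd p m \<epsilon> i j = phase_count \<epsilon> i (of_nat j) * n_signed p m \<epsilon> i"
proof -
  \<comment> \<open>\<open>freq_odd\<close> tests \<open>j = 0\<close> among naturals and
    \<open>phase_count\<close> tests it in the field; the bound \<open>j < p\<close> makes the tests
    agree.\<close>
  have "of_nat j = (0 :: 'a) \<longleftrightarrow> j = 0"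
    using assms(2) by (auto simp: of_nat_eq_0_iff_char_dvd CHAR_field dest: dvd_imp_le)
  then show ?thesis
    using odd_m m_ge_5 assms by (auto simp: freq_odd_def phase_count_def)
qed

lemma exp_sum_range:
  fixes \<alpha> \<beta> \<gamma> \<delta> :: 'a
  shows "exp_sum p m k \<alpha> \<beta> \<gamma> \<delta> \<in>
     {value_even p m \<epsilon> i j | \<epsilon> i j. \<epsilon> \<in> {1,-1} \<and> i \<in> {0,2,4} \<and> j < p}
     \<union> {value_odd p m \<epsilon> i j | \<epsilon> i j. \<epsilon> \<in> {1,-1} \<and> i \<in> {1,3} \<and> j < p}
     \<union> {0, of_nat p ^ m}"
proof -
  define t where "t = (\<alpha>, \<beta>, \<gamma>)"
  have S: "exp_sum p m k \<alpha> \<beta> \<gamma> \<delta> = quad_sum t \<delta>" by (simp add: t_def quad_sum_def)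
  consider "t = 0" | "quad_sum t \<delta> = 0" | "t \<noteq> 0" "quad_sum t \<delta> \<noteq> 0" by blast
  then show ?thesis
  proof cases
    case 1
    then show ?thesis unfolding S by (simp add: quad_sum_0)
  next
    case 2
    then show ?thesis unfolding S by simp
  next
    case 3
    then obtain i \<epsilon> where i: "i \<le> 4" "\<epsilon> \<in> {1, - 1 :: int}" "t \<in> form_class \<epsilon> i"
      using form_class_cover by blast
    then obtain z where z: "z \<in> prime_field" "quad_sum t \<delta> = form_value p m \<epsilon> i * add_char z"
      using quad_sum_values[OF i] 3 by blast
    from z(1) obtain j where j: "j < p" "z = of_nat j" by (auto simp: prime_field_eq)
    have "i \<in> {0, 2, 4} \<or> i \<in> {1, 3}" using i(1) by auto
    then show ?thesis
    proof
      assume "i \<in> {0, 2, 4}"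
      then show ?thesis unfolding S z(2) j(2) value_even_eq[symmetric, OF \<open>i \<in> _\<close>] using i(2) j(1) by blast
    next
      assume "i \<in> {1, 3}"
      then show ?thesis unfolding S z(2) j(2) value_odd_eq[symmetric, OF \<open>i \<in> _\<close>] using i(2) j(1) by blast
    qed
  qed
qed

end

theorem theorem3p2:
  fixes p m k :: nat
    and S :: "'a::finite_field \<Rightarrow> 'a \<Rightarrow> 'a \<Rightarrow> 'a \<Rightarrow> complex"
  assumes "prime p" and "odd p"
    and "m \<ge> 5" and "odd m"
    and "k > 0" and "gcd m k = 1"
    and "CARD('a) = p ^ m"
    and S_def: "S = exp_sum p m k"
  shows "(\<forall>i\<in>{0,2,4}. \<forall>\<epsilon>\<in>{1,-1}. \<forall>j<p.
            real (num_quadruples S (value_even p m \<epsilon> i j)) = freq_even p m \<epsilon> i j)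
       \<and> (\<forall>i\<in>{1,3}. \<forall>\<epsilon>\<in>{1,-1}. \<forall>j<p.
            real (num_quadruples S (value_odd p m \<epsilon> i j)) = freq_odd p m \<epsilon> i j)
       \<and> real (num_quadruples S 0) = freq_zero p m
       \<and> num_quadruples S (of_nat p ^ m) = 1
       \<and> (\<forall>\<alpha> \<beta> \<gamma> \<delta>. S \<alpha> \<beta> \<gamma> \<delta> \<in>
             {value_even p m \<epsilon> i j | \<epsilon> i j. \<epsilon> \<in> {1,-1} \<and> i \<in> {0,2,4} \<and> j < p}
           \<union> {value_odd p m \<epsilon> i j | \<epsilon> i j. \<epsilon> \<in> {1,-1} \<and> i \<in> {1,3} \<and> j < p}
           \<union> {0, of_nat p ^ m})"
proof -
  interpret quadratic_family p m "TYPE('a)" k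
    using assms by unfold_locales (auto simp: coprime_iff_gcd_eq_1)
  have S: "S = exp_sum p m k" by (rule S_def)
  show ?thesis
  proof (intro conjI ballI allI impI)
    fix i :: nat and \<epsilon> :: int and j assume a: "i \<in> {0, 2, 4}" "\<epsilon> \<in> {1, - 1}" "j < p"
    then have "i \<le> 4" by auto
    then show "real (num_quadruples S (value_even p m \<epsilon> i j)) = freq_even p m \<epsilon> i j"
      unfolding S value_even_eq[OF a(1)] freq_even_eq[OF a(1)] using a(2)
      by (intro num_quadruples_phase) auto
  next
    fix i :: nat and \<epsilon> :: int and j assume a: "i \<in> {1, 3}" "\<epsilon> \<in> {1, - 1}" "j < p"
    then have "i \<le> 4" by auto
    then show "real (num_quadruples S (value_odd p m \<epsilon> i j)) = freq_odd p m \<epsilon> i j"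
      unfolding S value_odd_eq[OF a(1)] freq_odd_eq[OF a(1,3)] using a(2)
      by (intro num_quadruples_phase) auto
  next
    show "real (num_quadruples S 0) = freq_zero p m"
      unfolding S by (rule num_quadruples_0)
    show "num_quadruples S (of_nat p ^ m) = 1"
      unfolding S using num_quadruples_q by simp
  next
    fix \<alpha> \<beta> \<gamma> \<delta> :: 'a
    show "S \<alpha> \<beta> \<gamma> \<delta> \<in>
             {value_even p m \<epsilon> i j | \<epsilon> i j. \<epsilon> \<in> {1,-1} \<and> i \<in> {0,2,4} \<and> j < p}
           \<union> {value_odd p m \<epsilon> i j | \<epsilon> i j. \<epsilon> \<in> {1,-1} \<and> i \<in> {1,3} \<and> j < p}
           \<union> {0, of_nat p ^ m}"
      unfolding S by (rule exp_sum_range)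
  qed
qed

end
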